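(* Let $\mathbb{F}_{3,2}$ be the $3$-graph on $\{1,2,3,4,5\}$ with edges $\{123,124,125,345\}$. There exist constants $N_0$ and $c>0$ such that for all integers $n\ge N_0$ and all integers $t\in[0,cn]$ we have \[ \mathrm{EX}\left(n,(t+1)\mathbb{F}_{3,2}\right)=\{K_t^3\bowtie S_3(n-t)\}. \]
   Context: A $3$-graph is semibipartite if its vertex set can be partitioned into $V_1,V_2$ such that every edge contains exactly one vertex of $V_1$; $S_3(n)$ is the semibipartite $3$-graph on $n$ vertices with the maximum number of edges. $K_t^3$ is the complete $3$-graph on $t$ vertices; for $3$-graphs on disjoint vertex sets, $\mathcal{G}\bowtie\mathcal{H}$ consists of the edges of both plus all $3$-subsets meeting both vertex sets. $\mathrm{EX}(n,(t+1)F)$ is the set (up to isomorphism) of $n$-vertex $3$-graphs not containing $t+1$ pairwise vertex-disjoint copies of $F$ with the maximum number of edges among such.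
   Formalization: S_3(m) is not unique up to isomorphism when m ≡ 2 mod 3 (for m=5, parts |V_1|=1 and |V_1|=2 both give 6 edges), so the right-hand side is taken as the set of all K_t^3 ⋈ S with S any maximum semibipartite 3-graph on n−t vertices. *)

theory Defs
  imports Complex_Main
begin

record 'a hgraph =
  verts :: "'a set"
  edges :: "'a set set"

definition three_graph :: "'a hgraph \<Rightarrow> bool" where
  "three_graph G \<longleftrightarrow> finite (verts G) \<and> (\<forall>e\<in>edges G. e \<subseteq> verts G \<and> card e = 3)"

definition iso :: "'a hgraph \<Rightarrow> 'b hgraph \<Rightarrow> bool" (infix "\<simeq>" 50) where
  "G \<simeq> H \<longleftrightarrow> (\<exists>f. bij_betw f (verts G) (verts H) \<and> edges H = (\<lambda>e. f ` e) ` edges G)"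

text \<open>
  Vertices of representatives are natural numbers: every finite 3-graph is isomorphic to
  one of these, so isomorphism types of 3-graphs are the sets \<open>iso_class G\<close>.
\<close>

definition iso_class :: "nat hgraph \<Rightarrow> nat hgraph set" where
  "iso_class G = {H. three_graph H \<and> G \<simeq> H}"

definition subgraph :: "'a hgraph \<Rightarrow> 'a hgraph \<Rightarrow> bool" where
  "subgraph H G \<longleftrightarrow> three_graph H \<and> verts H \<subseteq> verts G \<and> edges H \<subseteq> edges G"

text \<open>Copies are not required to be induced.\<close>

definition contains_disjoint_copies :: "nat \<Rightarrow> 'b hgraph \<Rightarrow> 'a hgraph \<Rightarrow> bool" where
  "contains_disjoint_copies k F G \<longleftrightarrow>
     (\<exists>C :: nat \<Rightarrow> 'a hgraph.
        (\<forall>i<k. subgraph (C i) G \<and> F \<simeq> C i) \<and>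
        (\<forall>i<k. \<forall>j<k. i \<noteq> j \<longrightarrow> verts (C i) \<inter> verts (C j) = {}))"

definition copies_free :: "nat \<Rightarrow> nat \<Rightarrow> 'b hgraph \<Rightarrow> nat hgraph set" where
  "copies_free n k F =
     {G. three_graph G \<and> card (verts G) = n \<and> \<not> contains_disjoint_copies k F G}"

text \<open>\<open>EX_types n k F\<close> is the set of isomorphism types usually written $\mathrm{EX}(n, kF)$.\<close>

definition EX_types :: "nat \<Rightarrow> nat \<Rightarrow> 'b hgraph \<Rightarrow> nat hgraph set set" where
  "EX_types n k F =
     {iso_class G | G. G \<in> copies_free n k F \<and>
        (\<forall>H \<in> copies_free n k F. card (edges H) \<le> card (edges G))}"

definition semibipartite :: "'a hgraph \<Rightarrow> bool" where
  "semibipartite G \<longleftrightarrow> three_graph G \<and>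
     (\<exists>V1 V2. V1 \<union> V2 = verts G \<and> V1 \<inter> V2 = {} \<and> (\<forall>e\<in>edges G. card (e \<inter> V1) = 1))"

text \<open>
  \<open>S3 n\<close> is the set of all edge-maximum semibipartite 3-graphs on \<open>n\<close> vertices.
  It may contain more than one isomorphism type: a part \<open>V1\<close> of size \<open>x\<close> allows
  \<open>x * ((n - x) choose 2)\<close> edges, and for \<open>n = 3 * m + 2\<close> with \<open>m \<ge> 1\<close> the
  maximum is attained both at \<open>x = m\<close> and at \<open>x = m + 1\<close>.
\<close>

definition S3 :: "nat \<Rightarrow> nat hgraph set" where
  "S3 n =
     {G. semibipartite G \<and> card (verts G) = n \<and>
        (\<forall>H :: nat hgraph. semibipartite H \<and> card (verts H) = n \<longrightarrow>
           card (edges H) \<le> card (edges G))}"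

definition complete3 :: "'a set \<Rightarrow> 'a hgraph" where
  "complete3 A = \<lparr>verts = A, edges = {e. e \<subseteq> A \<and> card e = 3}\<rparr>"

text \<open>The join is only meaningful for 3-graphs with disjoint vertex sets.\<close>

definition join :: "'a hgraph \<Rightarrow> 'a hgraph \<Rightarrow> 'a hgraph" (infixl "\<bowtie>" 65) where
  "G \<bowtie> H =
     \<lparr>verts = verts G \<union> verts H,
      edges = edges G \<union> edges H \<union>
        {e. e \<subseteq> verts G \<union> verts H \<and> card e = 3 \<and>
            e \<inter> verts G \<noteq> {} \<and> e \<inter> verts H \<noteq> {}}\<rparr>"

definition F32 :: "nat hgraph" where
  "F32 = \<lparr>verts = {1, 2, 3, 4, 5},
          edges = {{1, 2, 3}, {1, 2, 4}, {1, 2, 5}, {3, 4, 5}}\<rparr>"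

end

theory Submission
  imports Defs
begin

text \<open>
  A triple system is free of \<open>F32\<close> iff all its pair neighbourhoods are independent sets.
  Let \<open>A\<close> be a maximum independent set, so that every codegree is at most \<open>|A|\<close>.  If all degrees
  are almost those of the semibipartite system, counting edges through pairs in \<open>A \<times> B\<close>, with
  \<open>B = V - A\<close>, and applying independence of neighbourhoods to the vertex \<open>c\<close> of \<open>B\<close> whose link
  misses the fewest pairs of \<open>A\<close>, forces \<open>|A|\<close> to be almost \<open>2n/3\<close>.  Then every vertex is of one
  of two types, the only possible bad edges have two vertices in the small part, and each of them
  costs more good triples than it gains.  As cloning a vertex preserves freeness, an extremal
  system is almost regular, which gives the case \<open>t = 0\<close>.

  Blowing up one vertex shows that a nearly extremal free system has no vertex of degree above
  \<open>(2/9 + 0.014) n\<^sup>2\<close>.  Hence vertices of larger degree each contribute a disjoint copy greedily;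
  there are at most \<open>t\<close> of them, and deleting fewer than \<open>t\<close> of them together with a maximal family
  of disjoint copies in the rest loses edges, because \<open>(2/9 + 0.015) n\<^sup>2\<close> per vertex of a copy is
  too little compared with the \<open>5/18 n\<^sup>2\<close> gained for each vertex joined to everything.
\<close>

section \<open>Triple systems and maximum independent sets\<close>

text \<open>The quantity behind all estimates for one copy is the deficit
  \<open>K = 2ab - D\<close>: since codegrees are at most \<open>a\<close>, it bounds what any
  vertex of \<open>A\<close> can miss, and averaging passes it on to \<open>B\<close>. The
  difficulty is that \<open>K\<close> need not be small while \<open>|A|\<close> is well below 2n/3;
  only several competing bounds at one vertex \<open>c\<close> together exclude that range, with
  little to spare. Once \<open>|A|\<close> is right, \<open>K\<close> is tiny and the constants can
  be generous. For several copies the obstacle is that deleting vertices leaves systems that are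
  only nearly extremal. The degree cap is therefore derived from an edge count alone, by applying
  the sharp single-copy bound to the larger, blown-up vertex set. The thresholds 0.014 and 0.015
  differ so that a vertex of large degree stays above the cap when the few vertices already used are
  deleted. The gain 5/18 is 1/2 - 2/9: a vertex joined to everything lies in about n^2/2 edges,
  while the semibipartite maximum on the other vertices drops by about 2/9 n^2. A vertex of a
  low-degree copy gains at most 0.015 n^2 beyond that drop.\<close>

locale triple_system =
  fixes V :: "'a set" and E :: "'a set set"
  assumes fin: "finite V"
    and uniform: "e \<in> E \<Longrightarrow> e \<subseteq> V \<and> card e = 3"
begin

definition T :: "'a \<Rightarrow> 'a \<Rightarrow> 'a \<Rightarrow> real" where
  "T x y z = of_bool ({x, y, z} \<in> E)"

definition indep :: "'a set \<Rightarrow> bool" where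
  "indep I \<longleftrightarrow> I \<subseteq> V \<and> (\<forall>e\<in>E. \<not> e \<subseteq> I)"

text \<open>Ordered counting: \<open>deg2\<close> is twice the degree.\<close>

definition deg2 :: "'a \<Rightarrow> real" where
  "deg2 v = (\<Sum>x\<in>V. \<Sum>y\<in>V. T v x y)"

lemma T_swap12: "T x y z = T y x z"
  by (simp add: T_def insert_commute)

lemma T_swap23: "T x y z = T x z y"
  by (simp add: T_def insert_commute)

lemma T_rot: "T x y z = T y z x"
  using T_swap12 T_swap23 by metis

lemma T_nonneg [simp]: "0 \<le> T x y z"
  by (simp add: T_def)

lemma T_le_1 [simp]: "T x y z \<le> 1"
  by (simp add: T_def)

lemma T_eq_0: "T x y z = 0 \<longleftrightarrow> {x, y, z} \<notin> E"
  by (simp add: T_def)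

lemma edge_distinct: "{x, y, z} \<in> E \<Longrightarrow> x \<noteq> y \<and> y \<noteq> z \<and> x \<noteq> z"
  using uniform[of "{x, y, z}"] by (auto simp: card_insert_if split: if_splits)

lemma edge_verts: "{x, y, z} \<in> E \<Longrightarrow> x \<in> V \<and> y \<in> V \<and> z \<in> V"
  using uniform[of "{x, y, z}"] by auto

lemma edge_cases:
  assumes "e \<in> E"
  obtains x y z where "e = {x, y, z}" "x \<noteq> y" "y \<noteq> z" "x \<noteq> z"
proof -
  have "card e = 3" using uniform assms by blast
  then show ?thesis using that by (auto simp: card_3_iff)
qed

lemma finite_E: "finite E"
  using fin uniform by (meson Pow_iff finite_Pow_iff finite_subset subsetI)

lemma sum_T_le: "finite B \<Longrightarrow> (\<Sum>z\<in>B. T x y z) \<le> real (card B)"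
  using sum_mono[of B "T x y" "\<lambda>_. 1"] by simp

lemma sum_T_card: "finite B \<Longrightarrow> (\<Sum>z\<in>B. T x y z) = real (card {z\<in>B. {x, y, z} \<in> E})"
  by (simp add: T_def of_bool_def sum.If_cases Int_def)

lemma sum2_T_sym: "(\<Sum>x\<in>A. \<Sum>y\<in>B. T v x y) = (\<Sum>y\<in>B. \<Sum>x\<in>A. T v y x)"
  by (subst sum.swap) (simp add: T_swap23)

end

text \<open>No distinctness is needed: it follows from the four edges having three elements.\<close>

locale f32_free = triple_system +
  assumes free: "\<lbrakk>{a, b, c} \<in> E; {a, b, d} \<in> E; {a, b, e} \<in> E; {c, d, e} \<in> E\<rbrakk> \<Longrightarrow> False"
begin

lemma free_perm:
  assumes "{c, a, b} \<in> E" "{d, a, b} \<in> E" "{e, a, b} \<in> E" "{c, d, e} \<in> E"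
  shows False
  using free[of a b c d e] assms by (simp add: insert_commute)

lemma indep_nbhd: "indep {z\<in>V. {x, y, z} \<in> E}"
  unfolding indep_def
proof (intro conjI ballI notI)
  fix e assume e: "e \<in> E" "e \<subseteq> {z\<in>V. {x, y, z} \<in> E}"
  then obtain p q r where "e = {p, q, r}" by (blast elim: edge_cases)
  then show False using free[of x y p q r] e by auto
qed auto

end

section \<open>Degree deficits relative to a maximum independent set\<close>

locale max_indep = f32_free +
  fixes A :: "'a set" and D :: real
  assumes indep_A: "indep A"
    and max_A: "indep I \<Longrightarrow> card I \<le> card A"
    and deg_ge: "v \<in> V \<Longrightarrow> D \<le> deg2 v"
begin

definition B :: "'a set" where "B = V - A"

abbreviation a :: real where "a \<equiv> real (card A)"
abbreviation b :: real where "b \<equiv> real (card B)"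

definition X :: "'a \<Rightarrow> 'a \<Rightarrow> real" where "X u v = (\<Sum>p\<in>A. T u v p)"
definition Y :: "'a \<Rightarrow> 'a \<Rightarrow> real" where "Y u v = (\<Sum>p\<in>B. T u v p)"
text \<open>\<open>2 * a * b\<close> would be the ordered degree of a vertex whose link consists of
  all pairs between \<open>A\<close> and \<open>B\<close>; \<open>K\<close> is the slack of the
  degree bound against this ideal.\<close>

definition K :: real where "K = 2 * a * b - D"
text \<open>Diagonal pairs count as missing, so \<open>S v\<close> is the exact complement in
  \<open>A \<times> A\<close>, and squares such as \<open>(X u v)^2\<close> compare with it without
  correction terms.\<close>

definition S :: "'a \<Rightarrow> real" where "S v = a\<^sup>2 - (\<Sum>p\<in>A. \<Sum>q\<in>A. T v p q)"

lemma A_sub: "A \<subseteq> V" using indep_A by (simp add: indep_def)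
lemma finA [simp]: "finite A" using A_sub fin finite_subset by blast
lemma finB [simp]: "finite B" using fin by (simp add: B_def)
lemma V_split: "V = A \<union> B" "A \<inter> B = {}" using A_sub by (auto simp: B_def)

lemma ab_n: "a + b = real (card V)"
  using V_split by (metis card_Un_disjoint finA finB of_nat_add)

lemma sum_V: "(\<Sum>x\<in>V. f x) = (\<Sum>x\<in>A. f x) + (\<Sum>x\<in>B. (f x :: real))"
  using V_split by (metis finA finB sum.union_disjoint)

lemma T_A: "x \<in> A \<Longrightarrow> y \<in> A \<Longrightarrow> z \<in> A \<Longrightarrow> T x y z = 0"
  using indep_A by (auto simp: indep_def T_def)

lemma Y_nonneg: "0 \<le> Y u v"
  by (simp add: Y_def sum_nonneg)

lemma codeg_le: "X u v + Y u v \<le> a"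
proof -
  have "X u v + Y u v = (\<Sum>p\<in>V. T u v p)" by (simp add: X_def Y_def sum_V)
  also have "\<dots> = real (card {z\<in>V. {u, v, z} \<in> E})" using fin by (rule sum_T_card)
  also have "\<dots> \<le> a" using max_A[OF indep_nbhd] by simp
  finally show ?thesis .
qed

lemma X_le: "X u v \<le> a" using codeg_le[of u v] Y_nonneg[of u v] by linarith

lemma S_eq: "S v = (\<Sum>p\<in>A. \<Sum>q\<in>A. 1 - T v p q)"
  by (simp add: S_def sum_subtractf power2_eq_square)

lemma S_nonneg: "0 \<le> S v"
  by (simp add: S_eq sum_nonneg)

lemma deg2_split:
  "deg2 v = (a\<^sup>2 - S v) + 2 * (\<Sum>x\<in>A. Y x v) + (\<Sum>p\<in>B. \<Sum>q\<in>B. T v p q)"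
proof -
  have "deg2 v = (\<Sum>x\<in>A. \<Sum>y\<in>A. T v x y) + (\<Sum>x\<in>A. \<Sum>y\<in>B. T v x y)
      + ((\<Sum>x\<in>B. \<Sum>y\<in>A. T v x y) + (\<Sum>x\<in>B. \<Sum>y\<in>B. T v x y))"
    by (simp add: deg2_def sum_V sum.distrib)
  moreover have "(\<Sum>x\<in>B. \<Sum>y\<in>A. T v x y) = (\<Sum>x\<in>A. \<Sum>y\<in>B. T v x y)"
    by (rule sum2_T_sym)
  moreover have "(\<Sum>x\<in>A. \<Sum>y\<in>B. T v x y) = (\<Sum>x\<in>A. Y x v)"
    by (simp add: Y_def T_swap12[of v])
  ultimately show ?thesis by (simp add: S_def)
qed

text \<open>In the ordered degree of \<open>x\<close>, a vertex \<open>u\<close> of \<open>B\<close>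
  contributes \<open>X x u\<close> twice and \<open>Y x u\<close> once. The codegree bound takes
  care of one \<open>X x u + Y x u\<close>, so the degree condition falls on the remaining single
  \<open>X x u\<close>.\<close>

lemma sum_deficit_le:
  assumes "x \<in> A" shows "(\<Sum>u\<in>B. a - X x u) \<le> K"
proof -
  have "a\<^sup>2 - S x = 0" using assms by (simp add: S_def T_A)
  moreover have "(\<Sum>x'\<in>A. Y x' x) = (\<Sum>u\<in>B. X x u)"
    unfolding Y_def X_def by (subst sum.swap) (metis (no_types, lifting) T_swap12 T_swap23 sum.cong)
  moreover have "(\<Sum>p\<in>B. \<Sum>q\<in>B. T x p q) = (\<Sum>u\<in>B. Y x u)"
    by (simp add: Y_def)
  ultimately have "D \<le> 2 * (\<Sum>u\<in>B. X x u) + (\<Sum>u\<in>B. Y x u)"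
    using deg_ge[of x] A_sub assms by (auto simp: deg2_split)
  moreover have "(\<Sum>u\<in>B. X x u + Y x u) \<le> a * b"
    using sum_mono[of B "\<lambda>u. X x u + Y x u" "\<lambda>_. a"] codeg_le by (simp add: mult.commute)
  ultimately show ?thesis by (simp add: sum_subtractf sum.distrib K_def algebra_simps)
qed

lemma K_nonneg: "A \<noteq> {} \<Longrightarrow> 0 \<le> K"
proof -
  assume "A \<noteq> {}"
  then obtain x where "x \<in> A" by blast
  have "0 \<le> (\<Sum>u\<in>B. a - X x u)" by (intro sum_nonneg) (simp add: X_le)
  with sum_deficit_le[OF \<open>x \<in> A\<close>] show ?thesis by linarith
qed

lemma S_eq_X: "S v = (\<Sum>x\<in>A. a - X x v)"
  by (simp add: S_def X_def sum_subtractf power2_eq_square T_swap12[of v])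

text \<open>The deficits of the vertices of \<open>A\<close>, summed in the other order: an average
  vertex of \<open>B\<close> misses at most \<open>a * K / b\<close> ordered pairs of
  \<open>A\<close>.\<close>

lemma sum_S_le: "(\<Sum>v\<in>B. S v) \<le> a * K"
proof -
  have "(\<Sum>v\<in>B. S v) = (\<Sum>x\<in>A. \<Sum>u\<in>B. a - X x u)"
    unfolding S_eq_X by (rule sum.swap)
  also have "\<dots> \<le> (\<Sum>x\<in>A. K)" by (intro sum_mono sum_deficit_le)
  finally show ?thesis by simp
qed

text \<open>If \<open>uvc\<close> is an edge, then no pair of \<open>A\<close>-neighbours of \<open>uv\<close> lies in the link of \<open>c\<close>.\<close>

lemma X_sq_le:
  assumes "{u, v, c} \<in> E" shows "(X u v)\<^sup>2 \<le> S c"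
proof -
  have "(X u v)\<^sup>2 = (\<Sum>p\<in>A. \<Sum>q\<in>A. T u v p * T u v q)"
    by (simp add: X_def power2_eq_square sum_product)
  also have "\<dots> \<le> S c" unfolding S_eq
  proof (intro sum_mono)
    fix p q
    show "T u v p * T u v q \<le> 1 - T c p q"
      using free[of u v c p q] assms by (auto simp: T_def of_bool_def)
  qed
  finally show ?thesis .
qed

context
  fixes c assumes c: "c \<in> B" "\<And>v. v \<in> B \<Longrightarrow> S c \<le> S v"
begin

text \<open>Every \<open>u\<close> counted by \<open>Y x c\<close> forms an edge with
  \<open>x\<close> and \<open>c\<close>, so \<open>X_sq_le\<close> caps \<open>X x u\<close> at
  \<open>sqrt (S c)\<close>. Each such \<open>u\<close> uses up \<open>a - sqrt (S c)\<close> of the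
  deficit allowed to \<open>x\<close>.\<close>

lemma Y_bound:
  assumes "x \<in> A" shows "Y x c * (a - sqrt (S c)) \<le> K"
proof -
  have "Y x c * (a - sqrt (S c)) = (\<Sum>u\<in>B. T x c u * (a - sqrt (S c)))"
    by (simp add: Y_def sum_distrib_right)
  also have "\<dots> \<le> (\<Sum>u\<in>B. a - X x u)"
  proof (intro sum_mono)
    fix u
    show "T x c u * (a - sqrt (S c)) \<le> a - X x u"
    proof (cases "{x, c, u} \<in> E")
      case True
      then have "(X x u)\<^sup>2 \<le> S c" by (intro X_sq_le) (simp add: insert_commute)
      then have "X x u \<le> sqrt (S c)" by (simp add: real_le_rsqrt)
      with True show ?thesis by (simp add: T_def)
    next
      case False
      then show ?thesis using X_le[of x u] by (simp add: T_def)
    qed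
  qed
  also have "\<dots> \<le> K" using assms by (rule sum_deficit_le)
  finally show ?thesis .
qed

text \<open>Here the same edges are read the other way: the edge \<open>x c u\<close> forces
  \<open>S u\<close> to be at least \<open>(X x c)^2\<close>. Since \<open>c\<close> minimises
  \<open>S\<close>, all differences \<open>S u - S c\<close> are nonnegative, and
  \<open>sum_S_le\<close> limits their sum.\<close>

lemma Y_excess:
  assumes "x \<in> A" shows "Y x c * ((X x c)\<^sup>2 - S c) \<le> a * K - b * S c"
proof -
  have "Y x c * ((X x c)\<^sup>2 - S c) = (\<Sum>u\<in>B. T x c u * ((X x c)\<^sup>2 - S c))"
    by (simp add: Y_def sum_distrib_right)
  also have "\<dots> \<le> (\<Sum>u\<in>B. S u - S c)"
  proof (intro sum_mono)
    fix u assume u: "u \<in> B"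
    show "T x c u * ((X x c)\<^sup>2 - S c) \<le> S u - S c"
      using X_sq_le[of x c u] c(2)[OF u] by (auto simp: T_def of_bool_def)
  qed
  also have "\<dots> \<le> a * K - b * S c" using sum_S_le by (simp add: sum_subtractf)
  finally show ?thesis .
qed

lemma sum_Y_le_S: "(\<Sum>x\<in>A. Y x c) \<le> S c"
  unfolding S_eq_X using codeg_le by (intro sum_mono) (simp add: le_diff_eq add.commute)

text \<open>Sums \<open>Y_excess\<close> over \<open>A\<close>: \<open>(X x c)^2\<close> falls short
  of \<open>a^2\<close> by at most \<open>2 * a * (a - X x c)\<close>, and these shortfalls add up
  to \<open>2 * a * S c\<close>. The cap \<open>ym\<close>, later taken from \<open>Y_bound\<close>,
  controls their weight.\<close>

lemma sum_Y_bound: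
  assumes ym: "\<And>x. x \<in> A \<Longrightarrow> Y x c \<le> ym"
  shows "(\<Sum>x\<in>A. Y x c) * (a\<^sup>2 - S c) \<le> a * (a * K - b * S c) + 2 * a * ym * S c"
proof -
  have "Y x c * (a\<^sup>2 - S c) \<le> (a * K - b * S c) + 2 * a * ym * (a - X x c)" if x: "x \<in> A" for x
  proof -
    have "a\<^sup>2 - S c \<le> ((X x c)\<^sup>2 - S c) + 2 * a * (a - X x c)"
      using zero_le_power2[of "a - X x c"] by (simp add: power2_eq_square algebra_simps)
    then have "Y x c * (a\<^sup>2 - S c) \<le> Y x c * ((X x c)\<^sup>2 - S c) + Y x c * (2 * a * (a - X x c))"
      using Y_nonneg[of x c] by (metis distrib_left mult_left_mono)
    moreover have "Y x c * (2 * a * (a - X x c)) \<le> ym * (2 * a * (a - X x c))"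
      using ym[OF x] X_le by (intro mult_right_mono) auto
    ultimately show ?thesis using Y_excess[OF x] by (simp add: algebra_simps)
  qed
  then have "(\<Sum>x\<in>A. Y x c * (a\<^sup>2 - S c)) \<le> (\<Sum>x\<in>A. (a * K - b * S c) + 2 * a * ym * (a - X x c))"
    by (intro sum_mono) auto
  also have "\<dots> = a * (a * K - b * S c) + 2 * a * ym * S c"
    unfolding S_eq_X sum.distrib sum_distrib_left[symmetric] by simp
  finally show ?thesis by (simp add: sum_distrib_right)
qed

text \<open>The set of size \<open>g\<close> is the common neighbourhood in \<open>B\<close> of a pair of \<open>A\<close> in the link of \<open>c\<close>; it contains \<open>c\<close>.\<close>

lemma exists_large_indep:
  assumes pos: "S c < a\<^sup>2"
  obtains g where "0 \<le> g" "g \<le> b" "(b - g) * (a\<^sup>2 - S c) \<le> a * K"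
    "(\<Sum>p\<in>B. \<Sum>q\<in>B. T c p q) \<le> b\<^sup>2 - g\<^sup>2"
proof -
  define f where "f p q = b - (\<Sum>u\<in>B. T p q u)" for p q
  have f0: "0 \<le> f p q" for p q using sum_T_le[of B p q] by (simp add: f_def)
  have tot: "(\<Sum>p\<in>A. \<Sum>q\<in>A. f p q) \<le> a * K"
  proof -
    have "(\<Sum>p\<in>A. \<Sum>q\<in>A. f p q) = (\<Sum>p\<in>A. \<Sum>q\<in>A. \<Sum>u\<in>B. 1 - T u p q)"
      by (simp add: f_def sum_subtractf T_rot[of _ _ _, symmetric] T_rot[symmetric])
    also have "\<dots> = (\<Sum>p\<in>A. \<Sum>u\<in>B. \<Sum>q\<in>A. 1 - T u p q)"
      by (intro sum.cong refl sum.swap)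
    also have "\<dots> = (\<Sum>u\<in>B. \<Sum>p\<in>A. \<Sum>q\<in>A. 1 - T u p q)"
      by (rule sum.swap)
    also have "\<dots> = (\<Sum>u\<in>B. S u)" by (simp add: S_eq)
    finally show ?thesis using sum_S_le by simp
  qed
  \<comment> \<open>Averaging over the link of \<open>c\<close>: it contains
    \<open>a^2 - S c\<close> ordered pairs of \<open>A\<close>, and \<open>f\<close> sums to at most
    \<open>a * K\<close> over all pairs, so some pair of the link has \<open>f\<close> at most the
    quotient.\<close>
  have "\<exists>p\<in>A. \<exists>q\<in>A. {c, p, q} \<in> E \<and> f p q * (a\<^sup>2 - S c) \<le> a * K"
  proof (rule ccontr)
    assume neg: "\<not> ?thesis"
    define m where "m = a * K / (a\<^sup>2 - S c)"
    have lt: "m < f p q" if "p \<in> A" "q \<in> A" "{c, p, q} \<in> E" for p q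
    proof -
      have "a * K < f p q * (a\<^sup>2 - S c)" using neg that by (meson not_le)
      then show ?thesis using pos by (simp add: m_def pos_divide_less_eq)
    qed
    then have m: "T c p q * m \<le> T c p q * f p q" if "p \<in> A" "q \<in> A" for p q
      using that by (auto simp: T_def of_bool_def intro: less_imp_le)
    have S1: "(\<Sum>p\<in>A. \<Sum>q\<in>A. T c p q) = a\<^sup>2 - S c" by (simp add: S_def)
    have "\<exists>p\<in>A. \<exists>q\<in>A. {c, p, q} \<in> E"
    proof (rule ccontr)
      assume "\<not> ?thesis"
      then have "(\<Sum>p\<in>A. \<Sum>q\<in>A. T c p q) = 0" by (intro sum.neutral ballI) (auto simp: T_eq_0)
      with S1 pos show False by simp
    qed
    then obtain p q where pq: "p \<in> A" "q \<in> A" "{c, p, q} \<in> E" by blast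
    have "(\<Sum>q\<in>A. T c p q * m) < (\<Sum>q\<in>A. T c p q * f p q)"
    proof (rule sum_strict_mono_ex1)
      have "T c p q * m < T c p q * f p q" using lt pq by (simp add: T_def)
      then show "\<exists>q\<in>A. T c p q * m < T c p q * f p q" using pq by blast
    qed (use m pq in auto)
    then have "(\<Sum>p\<in>A. \<Sum>q\<in>A. T c p q * m) < (\<Sum>p\<in>A. \<Sum>q\<in>A. T c p q * f p q)"
      using pq m by (intro sum_strict_mono_ex1) (auto intro!: sum_mono)
    also have "\<dots> \<le> (\<Sum>p\<in>A. \<Sum>q\<in>A. f p q)"
      using f0 by (intro sum_mono mult_left_le_one_le) auto
    also have "\<dots> \<le> a * K" by (rule tot)
    finally have "(a\<^sup>2 - S c) * m < a * K"
      by (simp add: sum_distrib_right[symmetric] S1)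
    then show False using pos by (simp add: m_def)
  qed
  then obtain p q where pq: "p \<in> A" "q \<in> A" "{c, p, q} \<in> E" "f p q * (a\<^sup>2 - S c) \<le> a * K"
    by blast
  define g where "g = (\<Sum>u\<in>B. T p q u)"
  show thesis
  proof (rule that[of g])
    show "0 \<le> g" by (simp add: g_def sum_nonneg)
    show "g \<le> b" unfolding g_def by (rule sum_T_le) simp
    show "(b - g) * (a\<^sup>2 - S c) \<le> a * K" using pq by (simp add: f_def g_def)
    have "(\<Sum>u\<in>B. \<Sum>v\<in>B. T c u v) \<le> (\<Sum>u\<in>B. \<Sum>v\<in>B. 1 - T p q u * T p q v)"
    proof (intro sum_mono)
      fix u v
      show "T c u v \<le> 1 - T p q u * T p q v"
        using free_perm[of c p q u v] pq by (auto simp: T_def of_bool_def insert_commute)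
    qed
    also have "\<dots> = b\<^sup>2 - g\<^sup>2"
      by (simp add: sum_subtractf g_def power2_eq_square sum_product)
    finally show "(\<Sum>u\<in>B. \<Sum>v\<in>B. T c u v) \<le> b\<^sup>2 - g\<^sup>2" .
  qed
qed

end

end

section \<open>The main numerical inequality\<close>

lemma bernstein5_pos:
  fixes x y :: real
  assumes "0 \<le> x" "0 \<le> y" "0 < x + y"
    and c: "0 < c0" "0 < c1" "0 < c2" "0 < c3" "0 < c4" "0 < c5"
  shows "0 < c0 * (x^0 * y^5) + c1 * (x^1 * y^4) + c2 * (x^2 * y^3)
    + c3 * (x^3 * y^2) + c4 * (x^4 * y^1) + c5 * (x^5 * y^0)"
proof (cases "y = 0")
  case True
  with assms show ?thesis by simp
next
  case False
  then have "0 < c0 * (x^0 * y^5)" using assms by simp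
  moreover have "0 \<le> c1 * (x^1 * y^4)" "0 \<le> c2 * (x^2 * y^3)" "0 \<le> c3 * (x^3 * y^2)"
    "0 \<le> c4 * (x^4 * y^1)" "0 \<le> c5 * (x^5 * y^0)"
    using assms by simp_all
  ultimately show ?thesis by linarith
qed

text \<open>The proof gives the Bernstein coefficients on three intervals, all of them positive.\<close>

lemma quintic_pos:
  fixes w :: real
  assumes "0 \<le> w" "w \<le> 67/100"
  shows "0 < 16 - (13602/125) * w + (322919/1250) * w^2 - (648636023/2500000) * w^3 + (620465091/5000000) * w^4 - (24170809799/1000000000) * w^5" (is "0 < ?p")
proof -
  \<comment> \<open>The polynomial falls from 16 at \<open>w = 0\<close> to less than 1/8 near
    \<open>w = 0.38\<close>. The middle interval isolates this dip.\<close>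
  consider "w \<le> 1/3" | "1/3 \<le> w" "w \<le> 9/20" | "9/20 \<le> w" by linarith
  then show ?thesis
  proof cases
    case 1
    have "?p = 3888 * (w^0 * ((1/3) - w)^5)
      + (1328238/125) * (w^1 * ((1/3) - w)^4)
      + (13248333/1250) * (w^2 * ((1/3) - w)^3)
      + (11463713793/2500000) * (w^3 * ((1/3) - w)^2)
      + (810866889/1000000) * (w^4 * ((1/3) - w)^1)
      + (61972962001/1000000000) * (w^5 * ((1/3) - w)^0)"
      by algebra
    also have "0 < \<dots>"
      using assms 1 by (intro bernstein5_pos) auto
    finally show ?thesis .
  next
    case 2
    have "?p = (123945924002/10504375) * ((w - (1/3))^0 * ((9/20) - w)^5)
      + (538056329427/21008750) * ((w - (1/3))^1 * ((9/20) - w)^4)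
      + (6345631524609/210087500) * ((w - (1/3))^2 * ((9/20) - w)^3)
      + (193546514582163/4201750000) * ((w - (1/3))^3 * ((9/20) - w)^2)
      + (7677068416706961/168070000000) * ((w - (1/3))^4 * ((9/20) - w)^1)
      + (268633481372072307/16807000000000) * ((w - (1/3))^5 * ((9/20) - w)^0)"
      by algebra
    also have "0 < \<dots>"
      using assms 2 by (intro bernstein5_pos) auto
    finally show ?thesis .
  next
    case 3
    have "?p = (1105487577662849/1649162240000) * ((w - (9/20))^0 * ((67/100) - w)^5)
      + (9993093067916587/1649162240000) * ((w - (9/20))^1 * ((67/100) - w)^4)
      + (86550102280484281/4122905600000) * ((w - (9/20))^2 * ((67/100) - w)^3)
      + (650738302914131603/20614528000000) * ((w - (9/20))^3 * ((67/100) - w)^2)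
      + (4403186235432368689/206145280000000) * ((w - (9/20))^4 * ((67/100) - w)^1)
      + (27684373391992696507/5153632000000000) * ((w - (9/20))^5 * ((67/100) - w)^0)"
      by algebra
    also have "0 < \<dots>"
      using assms 3 by (intro bernstein5_pos) auto
    finally show ?thesis .
  qed
qed

text \<open>\<open>k\<close> is the value with \<open>2 * al * be - k = 4/9 - w^2/9000\<close>. The
  ratio \<open>k / (al * be)\<close> peaks near \<open>w = 1/2\<close> below 2243/10000, and this
  constant is just under \<open>(9/19)^2\<close>, which makes \<open>1 / (1 - sqrt sg)\<close> at
  most 19/10.\<close>

lemma sigma_bound:
  fixes w :: real
  assumes w: "0 < w" "w \<le> 67/100"
    and al: "al = (2 - w)/3" and be: "be = (1 + w)/3" and k: "k = w * (2 - 1999/1000 * w) / 9"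
  shows "k \<le> 2243/10000 * (al * be)" and "sg * (al * be) \<le> k \<Longrightarrow> sg \<le> 2243/10000"
proof -
  have "0 \<le> (w - 1/2)\<^sup>2" by simp
  then have "0 \<le> 17747/10000 * (w * w) - 17747/10000 * w + 17747/40000"
    by (simp add: power2_eq_square algebra_simps)
  moreover have "2243/10000 * ((2 - w) * (1 + w)) - w * (2 - 1999/1000 * w)
      = 17747/10000 * (w * w) - 17757/10000 * w + 4486/10000"
    by algebra
  ultimately have "0 \<le> 2243/10000 * ((2 - w) * (1 + w)) - w * (2 - 1999/1000 * w)"
    using w by linarith
  moreover have "al * be = (2 - w) * (1 + w) / 9" by (simp add: al be)
  ultimately show kab: "k \<le> 2243/10000 * (al * be)" by (simp add: k)
  have "0 < al * be" using w by (simp add: al be)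
  then show "sg \<le> 2243/10000" if "sg * (al * be) \<le> k"
    using order_trans[OF that kab] by (meson mult_le_cancel_right_pos)
qed

text \<open>All quantities are divided by the appropriate power of \<open>n\<close>: \<open>al\<close> and \<open>be\<close> are the sizes of \<open>A\<close> and
  \<open>B\<close>, \<open>sg\<close> is the fraction of pairs of \<open>A\<close> missing from the link of \<open>c\<close>, \<open>z\<close> and \<open>x * (2 * be - x)\<close>
  bound the parts of that link between \<open>A\<close> and \<open>B\<close> and inside \<open>B\<close>.  Averaging the two bounds on \<open>z\<close>
  gives an expression \<open>H\<close> that is linear in \<open>sg\<close>, so only the end points have to be checked.\<close>

lemma near_extremal_contradiction:
  fixes w :: real
  assumes w: "0 < w" "w \<le> 67/100"
    and al: "al = (2 - w)/3" and be: "be = (1 + w)/3" and k: "k = w * (2 - 1999/1000 * w) / 9"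
    and sg: "0 \<le> sg" "sg * (al * be) \<le> k"
    and z1: "z \<le> sg * al\<^sup>2"
    and z2: "sqrt sg < 1 \<Longrightarrow> z * (1 - sg) \<le> k - al * be * sg + 2 * k * sg / (1 - sqrt sg)"
    and x: "0 \<le> x" "x \<le> be" "x * (1 - sg) * al \<le> k"
    and main: "2 * al * be - k \<le> al\<^sup>2 * (1 - sg) + 2 * z + x * (2 * be - x)"
  shows False
proof -
  have al0: "0 < al" and be0: "0 < be" and k0: "0 < k" using w by (auto simp: al be k)
  note kab = sigma_bound(1)[OF w al be k]
  note sg_le = sigma_bound(2)[OF w al be k sg(2)]
  have ab0: "0 < al * be" using al0 be0 by simp
  have tau: "sqrt sg \<le> 9/19" using sg_le by (intro real_le_lsqrt) (auto simp: power2_eq_square sg)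
  have inv: "1 / (1 - sqrt sg) \<le> 19/10" using tau sg_le by (simp add: divide_simps)
  have z2': "z * (1 - sg) \<le> k - al * be * sg + 19/5 * k * sg"
  proof -
    have "2 * k * sg / (1 - sqrt sg) = 2 * k * sg * (1 / (1 - sqrt sg))" by simp
    also have "\<dots> \<le> 2 * k * sg * (19/10)" using inv k0 sg by (intro mult_left_mono) auto
    finally have "2 * k * sg / (1 - sqrt sg) \<le> 2 * k * sg * (19/10)" .
    moreover have "sqrt sg < 1" using tau by linarith
    from z2[OF this] have "z * (1 - sg) \<le> k - al * be * sg + 2 * k * sg / (1 - sqrt sg)" .
    ultimately show ?thesis by linarith
  qed
  define h where "h = k / al"
  have h0: "0 < h" using k0 al0 by (simp add: h_def)
  have hal: "h * al = k" using al0 by (simp add: h_def)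
  have om: "0 < 1 - sg" using sg_le by simp
  have hbe: "h \<le> 2243/10000 * be"
    using kab al0 by (simp add: h_def pos_divide_le_eq mult_ac)
  define x' where "x' = h / (1 - sg)"
  have x'1: "x' * (1 - sg) = h" using om by (simp add: x'_def)
  have x'be: "x' \<le> be"
  proof -
    have "h \<le> be * (1 - sg)"
    proof -
      have "2243/10000 * be \<le> be * (1 - sg)" using be0 sg_le by (simp add: mult.commute)
      then show ?thesis using hbe by linarith
    qed
    then show ?thesis using om by (simp add: x'_def pos_divide_le_eq)
  qed
  have xx': "x \<le> x'"
  proof -
    have "x * (1 - sg) \<le> h" using x(3) al0 by (simp add: h_def pos_le_divide_eq)
    then show ?thesis using om by (simp add: x'_def pos_le_divide_eq)
  qed
  have "x * (2 * be - x) \<le> x' * (2 * be - x')"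
  proof -
    have "x' * (2 * be - x') - x * (2 * be - x) = (x' - x) * ((be - x') + (be - x))"
      by (simp add: algebra_simps)
    also have "\<dots> \<ge> 0" using xx' x x'be by simp
    finally show ?thesis by simp
  qed
  then have "(1 - sg) * (x * (2 * be - x)) \<le> (1 - sg) * (x' * (2 * be - x'))"
    using om by simp
  also have "\<dots> = h * (2 * be - x')" using x'1 by (simp add: mult_ac)
  also have "\<dots> \<le> h * (2 * be - h - h * sg)"
  proof -
    \<comment> \<open>Replacing \<open>1 / (1 - sg)\<close> by its lower bound \<open>1 + sg\<close>
      keeps the final expression linear in \<open>sg\<close>.\<close>
    have "h * (1 + sg) * (1 - sg) \<le> h" using h0 sg by (simp add: algebra_simps)
    then have "h * (1 + sg) \<le> x'" using om by (simp add: x'_def pos_le_divide_eq)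
    then have "2 * be - x' \<le> 2 * be - h - h * sg" by (simp add: algebra_simps)
    then show ?thesis using h0 by (intro mult_left_mono) auto
  qed
  finally have xb: "(1 - sg) * (x * (2 * be - x)) \<le> h * (2 * be - h - h * sg)" .
  \<comment> \<open>This is \<open>main\<close> multiplied by \<open>1 - r\<close>, with one of the
    two copies of \<open>z\<close> bounded by \<open>z1\<close> and the other by
    \<open>z2'\<close>.\<close>
  define H where "H r = (1 - r) * (2 * al * be - k - al\<^sup>2 * (1 - r)) - h * (2 * be - h - h * r)
     - r * al\<^sup>2 * (1 - r) - (k - al * be * r + 19/5 * k * r)" for r
  have "(1 - sg) * (2 * al * be - k) \<le> (1 - sg) * (al\<^sup>2 * (1 - sg) + 2 * z + x * (2 * be - x))"
    using main om by simp
  moreover have "z * (1 - sg) \<le> sg * al\<^sup>2 * (1 - sg)" using z1 om by simp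
  ultimately have Hle: "H sg \<le> 0" using z2' xb unfolding H_def by (simp add: algebra_simps)
  \<comment> \<open>The quadratic terms cancel: \<open>(1 - r) * al^2 * (1 - r) + r * al^2 * (1 - r)
    = al^2 * (1 - r)\<close>.\<close>
  have H_lin: "H r = H 0 + r * (H 1 - H 0)" for r
    unfolding H_def by (simp add: algebra_simps)
  have H0: "0 < H 0"
  proof -
    have "81 * (al\<^sup>2 * H 0) = 81 * (al\<^sup>2 * (2 * al * be - 2 * k - al\<^sup>2) - 2 * k * al * be + k\<^sup>2)"
      unfolding H_def hal[symmetric] by (simp add: power2_eq_square algebra_simps)
    also have "\<dots> = w\<^sup>2 * ((997/250) - (199/100) * w + (996001/1000000) * w^2)" unfolding al be k by algebra
    also have "\<dots> > 0" using w by (intro mult_pos_pos add_pos_nonneg) auto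
    finally show ?thesis using al0 by (simp add: zero_less_mult_iff)
  qed
  \<comment> \<open>The largest value that the averaging bound \<open>sg * (al * be) \<le> k\<close>
    permits for \<open>sg\<close>, hence the second end point.\<close>
  define m where "m = k / (al * be)"
  have mk: "m * (al * be) = k" using al0 be0 by (simp add: m_def)
  have hm: "h = m * be" using al0 be0 by (simp add: h_def m_def)
  have Hm: "0 < H m"
  proof -
    have "729 * (al^3 * be * H m) = 729 * ((al * be - k) * (2 * al^3 * be - al^4 - k * al - k * al * be - k\<^sup>2) - 19/5 * k\<^sup>2 * al\<^sup>2)"
    proof -
      have bal: "be = 1 - al" by (simp add: al be field_simps)
      show ?thesis unfolding H_def hm mk[symmetric] bal by algebra
    qed
    also have "\<dots> = w * (16 - (13602/125) * w + (322919/1250) * w^2 - (648636023/2500000) * w^3 + (620465091/5000000) * w^4 - (24170809799/1000000000) * w^5)"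
      unfolding al be k by algebra
    also have "\<dots> > 0" using w quintic_pos[of w] by simp
    finally have "0 < al^3 * be * H m" by linarith
    moreover have "0 < al^3 * be" using al0 be0 by simp
    ultimately show ?thesis using zero_less_mult_pos by blast
  qed
  have m0: "0 < m" using k0 ab0 by (simp add: m_def)
  have max_semibip: "sg \<le> m" using sg(2) ab0 by (simp add: m_def pos_le_divide_eq)
  have "m * H sg = (m - sg) * H 0 + sg * H m"
    using H_lin[of sg] H_lin[of m] by algebra
  moreover have "\<dots> > 0"
  proof (cases "sg = m")
    case True then show ?thesis using Hm m0 by simp
  next
    case False then show ?thesis using max_semibip sg H0 Hm by (intro add_pos_nonneg) auto
  qed
  ultimately show False using Hle m0 by (smt (verit) mult_nonneg_nonpos)
qed

section \<open>Nearly extremal minimum degree forces a large independent set\<close>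

context max_indep
begin

abbreviation n :: real where "n \<equiv> real (card V)"

lemma deg2_le: "deg2 v \<le> n * a"
proof -
  have "deg2 v = (\<Sum>x\<in>V. X v x + Y v x)" by (simp add: deg2_def X_def Y_def sum_V)
  also have "\<dots> \<le> (\<Sum>x\<in>V. a)" by (intro sum_mono codeg_le)
  finally show ?thesis by simp
qed

text \<open>The parameter \<open>w\<close> measures how far \<open>a\<close> lies below 2n/3. The
  admissible loss in degree is quadratic in \<open>w0\<close> because the margin \<open>H 0\<close>
  in the numerical contradiction is itself of order \<open>w^2\<close>.\<close>

lemma card_A_ge:
  assumes "V \<noteq> {}" and w0: "0 < w0" "w0 \<le> 1" and D: "(4/9 - w0\<^sup>2/9000) * n\<^sup>2 \<le> D"
  shows "(2 - w0)/3 * n \<le> a"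
proof (rule ccontr)
  assume neg: "\<not> ?thesis"
  have n0: "0 < n" using assms(1) fin by (simp add: card_gt_0_iff)
  define w where "w = 2 - 3 * (a / n)"
  define al be k where "al = a / n" and "be = b / n" and "k = w * (2 - 1999/1000 * w) / 9"
  have ww0: "w0 < w" using neg n0 by (simp add: w_def field_simps)
  then have w2: "w0\<^sup>2 \<le> w\<^sup>2" using w0 by (intro power_mono) auto
  have alw: "al = (2 - w)/3" by (simp add: al_def w_def)
  have "al + be = 1" using ab_n n0 by (simp add: al_def be_def add_divide_distrib[symmetric])
  then have bew: "be = (1 + w)/3" unfolding alw by (simp add: field_simps)
  obtain v where "v \<in> V" using assms(1) by blast
  \<comment> \<open>The crude bound \<open>D \<le> n * a\<close> already puts \<open>a / n\<close>
    above roughly 4/9, which keeps \<open>w\<close> within 67/100, the range covered by the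
    polynomial estimate.\<close>
  from deg_ge[OF this] deg2_le[of v] have "D \<le> n * a" by linarith
  moreover have "n * a = al * n\<^sup>2" using n0 by (simp add: al_def power2_eq_square)
  ultimately have "(4/9 - w0\<^sup>2/9000) * n\<^sup>2 \<le> al * n\<^sup>2" using D by linarith
  then have "4/9 - w0\<^sup>2/9000 \<le> al" using n0 by (simp add: mult_le_cancel_right)
  moreover have "w0\<^sup>2 \<le> 1" using w0 by (simp add: power_le_one)
  ultimately have wle: "w \<le> 67/100" unfolding alw by simp
  have w: "0 < w" "w \<le> 67/100" using ww0 w0 wle by auto
  have al0: "0 < al" and be0: "0 < be" using w by (auto simp: alw bew)
  have a0: "0 < a" and b0: "0 < b" using al0 be0 n0 by (auto simp: al_def be_def zero_less_divide_iff)
  have Ane: "A \<noteq> {}" using a0 by auto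
  have aal: "a = al * n" and bbe: "b = be * n" using n0 by (auto simp: al_def be_def)
  have "2 * al * be - k = 4/9 - w\<^sup>2/9000"
    unfolding alw bew k_def by (simp add: power2_eq_square field_simps)
  then have Dk: "(2 * al * be - k) * n\<^sup>2 \<le> D"
    using D w2 mult_right_mono[of "4/9 - w\<^sup>2/9000" "4/9 - w0\<^sup>2/9000" "n\<^sup>2"] by simp
  then have Kk: "K \<le> k * n\<^sup>2"
    by (simp add: K_def aal bbe power2_eq_square algebra_simps)
  have "B \<noteq> {}" using b0 by auto
  define c where "c = arg_min_on S B"
  have c: "c \<in> B" "\<And>v. v \<in> B \<Longrightarrow> S c \<le> S v"
    unfolding c_def using \<open>B \<noteq> {}\<close> by (auto intro: arg_min_if_finite arg_min_least)
  define sg where "sg = S c / a\<^sup>2"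
  have Ssg: "S c = sg * a\<^sup>2"
    unfolding sg_def using a0 by (metis less_irrefl nonzero_eq_divide_eq power_not_zero)
  have sg0: "0 \<le> sg" using S_nonneg by (simp add: sg_def)
  have "b * S c \<le> a * K"
    using sum_S_le sum_mono[of B "\<lambda>_. S c" S] c(2) by simp
  also have "\<dots> \<le> a * (k * n\<^sup>2)" using Kk a0 by simp
  finally have "(sg * (al * be)) * (a * n\<^sup>2) \<le> k * (a * n\<^sup>2)"
    by (simp add: Ssg aal bbe power2_eq_square mult_ac)
  then have sgk: "sg * (al * be) \<le> k" using a0 n0 by simp
  have sgle: "sg \<le> 2243/10000" using sigma_bound(2)[OF w alw bew k_def sgk] .
  then have "sg * a\<^sup>2 < 1 * a\<^sup>2" using a0 by (intro mult_strict_right_mono) auto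
  then have Sa: "S c < a\<^sup>2" by (simp add: Ssg)
  have k0: "0 < k" using w by (auto simp: k_def)
  define Z where "Z = (\<Sum>x\<in>A. Y x c)"
  define z where "z = Z / n\<^sup>2"
  have Zz: "Z = z * n\<^sup>2" using n0 by (simp add: z_def)
  obtain g where g: "0 \<le> g" "g \<le> b" "(b - g) * (a\<^sup>2 - S c) \<le> a * K"
    "(\<Sum>p\<in>B. \<Sum>q\<in>B. T c p q) \<le> b\<^sup>2 - g\<^sup>2"
    using exists_large_indep[OF c Sa] by blast
  define x where "x = (b - g) / n"
  have gx: "g = (be - x) * n" using n0 by (simp add: x_def bbe field_simps)
  have cV: "c \<in> V" using c(1) by (simp add: B_def)
  show False
  proof (rule near_extremal_contradiction[OF w alw bew k_def sg0 sgk])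
    show "z \<le> sg * al\<^sup>2"
    proof -
      have "z * n\<^sup>2 \<le> (sg * al\<^sup>2) * n\<^sup>2"
        using sum_Y_le_S[OF c] by (simp add: Z_def[symmetric] Zz Ssg aal power2_eq_square mult_ac)
      then show ?thesis using n0 by simp
    qed
    show "z * (1 - sg) \<le> k - al * be * sg + 2 * k * sg / (1 - sqrt sg)" if t: "sqrt sg < 1"
    proof -
      have sq: "sqrt (S c) = sqrt sg * a" using a0 by (simp add: Ssg real_sqrt_mult)
      define ym where "ym = k * n\<^sup>2 / (a - sqrt (S c))"
      have pos: "0 < a - sqrt (S c)" using t a0 by (simp add: sq)
      have "Y x' c \<le> ym" if "x' \<in> A" for x'
        using order_trans[OF Y_bound[OF c that] Kk] pos by (simp add: ym_def pos_le_divide_eq)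
      from sum_Y_bound[OF c this]
      have "Z * (a\<^sup>2 - S c) \<le> a * (a * K - b * S c) + 2 * a * ym * S c"
        by (simp add: Z_def)
      also have "\<dots> \<le> a * (a * (k * n\<^sup>2) - b * S c) + 2 * a * ym * S c"
        using Kk a0 by simp
      finally have 1: "Z * (a\<^sup>2 - S c) \<le> a * (a * (k * n\<^sup>2) - b * S c) + 2 * a * ym * S c" .
      have ym': "ym * a = k * n\<^sup>2 / (1 - sqrt sg)"
      proof -
        have "a - sqrt (S c) = a * (1 - sqrt sg)" by (simp add: sq algebra_simps)
        then show ?thesis using Ane by (simp add: ym_def)
      qed
      have "a * (a * (k * n\<^sup>2) - b * S c) + 2 * a * ym * S c
          = (k - al * be * sg + 2 * k * sg / (1 - sqrt sg)) * (a\<^sup>2 * n\<^sup>2)"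
      proof -
        have "2 * a * ym * S c = 2 * (ym * a) * (sg * a\<^sup>2)" by (simp add: Ssg)
        also have "\<dots> = (2 * k * sg / (1 - sqrt sg)) * (a\<^sup>2 * n\<^sup>2)" by (simp add: ym')
        finally show ?thesis by (simp add: Ssg aal bbe power2_eq_square algebra_simps)
      qed
      moreover have "Z * (a\<^sup>2 - S c) = (z * (1 - sg)) * (a\<^sup>2 * n\<^sup>2)"
        by (simp add: Zz Ssg algebra_simps)
      ultimately have "(z * (1 - sg)) * (a\<^sup>2 * n\<^sup>2)
          \<le> (k - al * be * sg + 2 * k * sg / (1 - sqrt sg)) * (a\<^sup>2 * n\<^sup>2)"
        using 1 by linarith
      moreover have "0 < a\<^sup>2 * n\<^sup>2" using a0 n0 by (intro mult_pos_pos zero_less_power)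
      ultimately show ?thesis by (meson mult_le_cancel_right_pos)
    qed
    show "0 \<le> x" "x \<le> be" using g n0 by (auto simp: x_def be_def divide_right_mono)
    have "(x * (1 - sg) * al) * (a * n\<^sup>2) \<le> k * (a * n\<^sup>2)"
    proof -
      have "(b - g) * (a\<^sup>2 - S c) \<le> a * (k * n\<^sup>2)" using g(3) Kk a0 by (smt (verit) mult_left_mono)
      moreover have "b - g = x * n" by (simp add: gx bbe algebra_simps)
      ultimately show ?thesis by (simp add: Ssg aal power2_eq_square algebra_simps)
    qed
    then show "x * (1 - sg) * al \<le> k" using a0 n0 by simp
    have "(2 * al * be - k) * n\<^sup>2 \<le> (a\<^sup>2 - S c) + 2 * Z + (b\<^sup>2 - g\<^sup>2)"
      using Dk deg_ge[OF cV] deg2_split[of c] g(4) by (simp add: Z_def)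
    also have "\<dots> = (al\<^sup>2 * (1 - sg) + 2 * z + x * (2 * be - x)) * n\<^sup>2"
      by (simp add: Zz Ssg aal bbe gx power2_eq_square algebra_simps)
    finally show "2 * al * be - k \<le> al\<^sup>2 * (1 - sg) + 2 * z + x * (2 * be - x)"
      using n0 by simp
  qed
qed

end

section \<open>Degrees and double counting\<close>

context triple_system
begin

definition deg :: "'a \<Rightarrow> nat" where
  "deg v = card {e\<in>E. v \<in> e}"

lemma card_pair_le:
  assumes "u \<noteq> w" shows "card {e\<in>E. u \<in> e \<and> w \<in> e} \<le> card V"
proof -
  have "{e\<in>E. u \<in> e \<and> w \<in> e} \<subseteq> (\<lambda>z. {u, w, z}) ` V"
  proof
    fix e assume "e \<in> {e\<in>E. u \<in> e \<and> w \<in> e}"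
    then have e: "e \<in> E" "u \<in> e" "w \<in> e" by auto
    then have "card (e - {u, w}) = 1"
      using assms uniform[OF e(1)] by (subst card_Diff_subset) auto
    then obtain z' where "e - {u, w} = {z'}" by (auto simp: card_1_singleton_iff)
    then have "e = {u, w, z'}" using e by auto
    moreover have "z' \<in> V" using edge_verts e calculation by auto
    ultimately show "e \<in> (\<lambda>z. {u, w, z}) ` V" by auto
  qed
  then show ?thesis
    using fin by (meson card_image_le card_mono finite_imageI le_trans)
qed

lemma deg2_eq: "deg2 v = 2 * real (deg v)"
proof -
  have pair: "(\<Sum>x\<in>V. \<Sum>y\<in>V. of_bool ({v, x, y} = e)) = (2::real)" if e: "e \<in> E" "v \<in> e" for e
  proof -
    obtain p q where pq: "e = {v, p, q}" "v \<noteq> p" "v \<noteq> q" "p \<noteq> q"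
    proof -
      obtain x y z where "e = {x, y, z}" "x \<noteq> y" "y \<noteq> z" "x \<noteq> z" using e(1) by (rule edge_cases)
      with e(2) that show thesis by (auto simp: insert_commute)
    qed
    have V: "p \<in> V" "q \<in> V" using edge_verts[of v p q] e pq by auto
    have "(of_bool ({v, x, y} = e) :: real)
        = of_bool (x = p) * of_bool (y = q) + of_bool (x = q) * of_bool (y = p)" for x y
      using pq by (auto simp: doubleton_eq_iff of_bool_def insert_eq_iff)
    moreover have "(\<Sum>x\<in>V. of_bool (x = r)) = (1::real)" if "r \<in> V" for r
      using fin that by (simp add: of_bool_def)
    ultimately show ?thesis using V
      by (simp add: sum.distrib sum_distrib_left[symmetric] sum_distrib_right[symmetric])
  qed
  have "deg2 v = (\<Sum>x\<in>V. \<Sum>y\<in>V. \<Sum>e\<in>{e\<in>E. v \<in> e}. of_bool ({v, x, y} = e))"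
  proof -
    have "T v x y = (\<Sum>e\<in>{e\<in>E. v \<in> e}. of_bool ({v, x, y} = e))" for x y
      using finite_E by (simp add: T_def of_bool_def)
    then show ?thesis by (simp add: deg2_def)
  qed
  also have "\<dots> = (\<Sum>x\<in>V. \<Sum>e\<in>{e\<in>E. v \<in> e}. \<Sum>y\<in>V. of_bool ({v, x, y} = e))"
    by (intro sum.cong refl sum.swap)
  also have "\<dots> = (\<Sum>e\<in>{e\<in>E. v \<in> e}. \<Sum>x\<in>V. \<Sum>y\<in>V. of_bool ({v, x, y} = e))"
    by (rule sum.swap)
  also have "\<dots> = (\<Sum>e\<in>{e\<in>E. v \<in> e}. 2)" by (intro sum.cong refl pair) auto
  finally show ?thesis by (simp add: deg_def)
qed

lemma handshake: "(\<Sum>v\<in>V. deg v) = 3 * card E"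
proof -
  have "(\<Sum>v\<in>V. deg v) = (\<Sum>e\<in>E. card {v\<in>V. v \<in> e})"
    unfolding deg_def using fin finite_E by (intro sum_multicount_gen) auto
  also have "\<dots> = (\<Sum>e\<in>E. 3)"
    using uniform by (intro sum.cong refl) (metis Collect_mem_eq Int_absorb1 Int_def)
  finally show ?thesis by simp
qed

lemma sum_deg2: "(\<Sum>v\<in>V. deg2 v) = 6 * real (card E)"
proof -
  have "(\<Sum>v\<in>V. deg2 v) = 2 * real (\<Sum>v\<in>V. deg v)"
    by (simp add: deg2_eq sum_distrib_left)
  then show ?thesis by (simp add: handshake)
qed

end

section \<open>Cleaning up the partition\<close>

text \<open>Lowering \<open>a1\<close> loses pairs inside \<open>A\<close> at rate
  \<open>al + a1\<close> and gains cross pairs only at rate \<open>2 * be\<close>. Once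
  \<open>a1 \<ge> al/2\<close>, the first rate is larger by at least 33/100, so the degree bound
  leaves almost no room for \<open>al - a1\<close>.\<close>

lemma type_one_real:
  fixes al :: real
  assumes al: "2/3 - 1/1000000000 \<le> al" "al \<le> 2/3 + 1/1000000000" and be: "be = 1 - al"
    and d: "4/9 - 1/1000000000 \<le> d" and a1: "0 \<le> a1" "a1 \<le> al" and mu: "0 \<le> mu" "mu \<le> 2/10000"
    and AA: "al\<^sup>2/3 \<le> AA" "AA \<le> a1\<^sup>2 + 2/1000 * al\<^sup>2"
    and main: "d \<le> AA + 2 * (mu + (al - a1) * be) + 2 * be * mu"
  shows "al\<^sup>2 - AA \<le> al\<^sup>2/50"
proof -
  have al2: "al\<^sup>2 \<le> 4/9 + 2/1000000000" "4/9 - 2/1000000000 \<le> al\<^sup>2"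
  proof -
    have "al\<^sup>2 \<le> (2/3 + 1/1000000000)\<^sup>2" using al by (intro power_mono) auto
    then show "al\<^sup>2 \<le> 4/9 + 2/1000000000" by (simp add: power2_eq_square)
    have "(2/3 - 1/1000000000)\<^sup>2 \<le> al\<^sup>2" using al by (intro power_mono) auto
    then show "4/9 - 2/1000000000 \<le> al\<^sup>2" by (simp add: power2_eq_square)
  qed
  have "(al/2)\<^sup>2 \<le> a1\<^sup>2" using AA al2 by (simp add: power_divide)
  then have a1': "al/2 \<le> a1" using a1(1) power2_le_imp_le by blast
  have bmu: "be * mu \<le> 1/2 * (2/10000)" using mu al be by (intro mult_mono) auto
  have "(al - a1) * (33/100) \<le> (al - a1) * (al + a1 - 2 * be)"
    using a1' a1 al be
    by (intro mult_left_mono) auto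
  also have "\<dots> = al\<^sup>2 - a1\<^sup>2 - 2 * ((al - a1) * be)"
    by (simp add: power2_eq_square algebra_simps)
  also have "\<dots> \<le> 2/1000" using AA main d al2 mu bmu by simp
  finally have a2: "al - a1 \<le> 61/10000" by simp
  have "(al - a1) * be \<le> 61/10000 * (1/2)" using a2 a1 al be by (intro mult_mono) auto
  then show ?thesis using main d al2 mu bmu by simp
qed

text \<open>With few pairs inside \<open>A\<close>, the degree must come from the cross term
  \<open>(al - a1) * (be - b1)\<close> or from \<open>b1^2\<close>. Pairs inside \<open>B\<close>
  alone are too few, so \<open>a1\<close> must be small; after that, any positive \<open>a1\<close>
  or \<open>b1\<close> costs more than it brings.\<close>

lemma type_two_real:
  fixes al :: real
  assumes al: "2/3 - 1/1000000000 \<le> al" "al \<le> 2/3 + 1/1000000000" and be: "be = 1 - al"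
    and d: "4/9 - 1/1000000000 \<le> d" and a1: "0 \<le> a1" "a1 \<le> al" and b1: "0 \<le> b1" "b1 \<le> be"
    and mu: "0 \<le> mu" "mu \<le> 2/10000"
    and AA: "AA \<le> al\<^sup>2/3" "AA \<le> a1\<^sup>2 + 2/1000 * al\<^sup>2"
    and CR: "CR \<le> mu + be * al/1000 + (al - a1) * (be - b1)"
    and BB: "BB \<le> b1\<^sup>2 + 2 * be * mu"
    and main: "d \<le> AA + 2 * CR + BB"
  shows "al * be - CR \<le> al * be/50"
proof -
  have al2: "al\<^sup>2 \<le> 4/9 + 2/1000000000"
  proof -
    have "al\<^sup>2 \<le> (2/3 + 1/1000000000)\<^sup>2" using al by (intro power_mono) auto
    then show "al\<^sup>2 \<le> 4/9 + 2/1000000000" by (simp add: power2_eq_square)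
  qed
  have abu: "be * al \<le> 2/9 + 1/100000000"
  proof -
    have "be * al \<le> (1/3 + 1/1000000000) * (2/3 + 1/1000000000)" using al be by (intro mult_mono) auto
    then show ?thesis by simp
  qed
  have abl: "2/9 - 1/100000000 \<le> be * al"
  proof -
    have "(1/3 - 1/1000000000) * (2/3 - 1/1000000000) \<le> be * al" using al be by (intro mult_mono) auto
    then show ?thesis by simp
  qed
  have bmu: "be * mu \<le> 1/2 * (2/10000)" using mu al be by (intro mult_mono) auto
  have low: "29/100 \<le> 2 * ((al - a1) * (be - b1)) + b1\<^sup>2"
    using main d AA(1) CR BB al2 abu bmu mu by linarith
  have "b1 \<le> 2 * (al - a1)"
  proof (rule ccontr)
    assume "\<not> ?thesis"
    then have "2 * ((al - a1) * (be - b1)) + b1\<^sup>2 \<le> b1 * (be - b1) + b1\<^sup>2"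
      proof -
      have "2 * (al - a1) * (be - b1) \<le> b1 * (be - b1)"
        using b1 \<open>\<not> b1 \<le> 2 * (al - a1)\<close> by (intro mult_right_mono) auto
      then show ?thesis by (simp only: mult.assoc add_right_mono)
    qed
    also have "\<dots> = b1 * be" by (simp add: power2_eq_square algebra_simps)
    also have "\<dots> \<le> (1/2) * (1/2)" using b1 al be by (intro mult_mono) auto
    finally show False using low by simp
  qed
  then have "2 * (al - a1) * (be - b1) + b1 * b1 \<le> 2 * (al - a1) * (be - b1) + 2 * (al - a1) * b1"
    using b1 by (intro add_mono mult_right_mono) auto
  also have "\<dots> = 2 * (al - a1) * be" by (simp add: algebra_simps)
  also have "\<dots> \<le> 2 * (al - a1) * (34/100)" using a1 al be by (intro mult_left_mono) auto
  finally have "29/100 \<le> (al - a1) * (68/100)" using low unfolding power2_eq_square by argo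
  then have a2: "a1 \<le> 25/100" using al by simp
  \<comment> \<open>The leading terms amount to \<open>2 * be * al - q * (2 * be - q)\<close> minus
    a nonnegative term, so \<open>q * (2 * be - q)\<close> is small. The bound on \<open>a1\<close>
    rules out \<open>q\<close> near \<open>2 * be\<close>, leaving \<open>q\<close> near 0.\<close>
  define q where "q = a1 + b1"
  have q0: "0 \<le> q" using a1 b1 by (simp add: q_def)
  have gap: "6/100 \<le> 2 * be - q" using a2 b1 al be unfolding q_def by simp
  have "a1\<^sup>2 + b1\<^sup>2 + 2 * ((al - a1) * (be - b1)) = q\<^sup>2 + 2 * (be * al) - 2 * be * q - 2 * ((al - be) * b1)"
    by (simp add: q_def power2_eq_square algebra_simps)
  moreover have "0 \<le> (al - be) * b1" using al be b1 by simp
  ultimately have "q * (2 * be - q) \<le> 21/10000"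
    using main d AA(2) CR BB al2 abu bmu mu by (simp add: power2_eq_square algebra_simps)
  moreover have "q * (6/100) \<le> q * (2 * be - q)" using gap q0 by (rule mult_left_mono)
  ultimately have q: "q \<le> 35/1000" by simp
  have "a1\<^sup>2 + b1\<^sup>2 \<le> q\<^sup>2" using a1 b1 by (simp add: q_def power2_eq_square algebra_simps)
  also have "\<dots> \<le> (35/1000)\<^sup>2" using q q0 by (rule power_mono)
  finally have "a1\<^sup>2 + b1\<^sup>2 \<le> 1225/1000000" by (simp add: power2_eq_square)
  moreover have "al * be = be * al" by simp
  ultimately show ?thesis using main d AA(2) BB al2 abu abl bmu by linarith
qed

context max_indep
begin

text \<open>A vertex of \<open>B\<close> outside this set misses so few pairs of \<open>A\<close>
  that, in every edge through it, the other two vertices have codegree at most \<open>a/1000\<close>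
  into \<open>A\<close>.\<close>

definition Bad :: "'a set" where
  "Bad = {u\<in>B. (1/1000 * a)\<^sup>2 < S u}"

text \<open>A vertex of \<open>A\<close> outside \<open>A1 v\<close>, or one of \<open>B1 v\<close>,
  lies with \<open>v\<close> in an edge ending in a good vertex, so its codegree with
  \<open>v\<close> into \<open>A\<close> is tiny. Up to small errors the link of \<open>v\<close>
  thus lives on \<open>A1 \<times> A1\<close>, \<open>(A - A1) \<times> (B - B1)\<close> and
  \<open>B1 \<times> B1\<close>.\<close>

definition A1 :: "'a \<Rightarrow> 'a set" where
  "A1 v = {x\<in>A. \<forall>u\<in>B - Bad. {x, v, u} \<notin> E}"

definition B1 :: "'a \<Rightarrow> 'a set" where
  "B1 v = {u\<in>B. \<exists>c\<in>B - Bad. {v, u, c} \<in> E}"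

abbreviation mu :: real where "mu \<equiv> real (card Bad)"

lemma Bad_sub: "Bad \<subseteq> B" and A1_sub: "A1 v \<subseteq> A" and B1_sub: "B1 v \<subseteq> B"
  by (auto simp: Bad_def A1_def B1_def)

lemma sum_of_bool_sub: "M \<subseteq> N \<Longrightarrow> finite N \<Longrightarrow> (\<Sum>x\<in>N. of_bool (x \<in> M)) = real (card M)"
  by (simp add: of_bool_def sum.If_cases Int_absorb1 Int_def[symmetric] flip: Int_def)

lemma S_large_card:
  assumes "0 \<le> th" "M \<subseteq> B" "\<And>u. u \<in> M \<Longrightarrow> th \<le> S u"
  shows "real (card M) * th \<le> a * K"
proof -
  have "real (card M) * th = (\<Sum>u\<in>M. th)" by simp
  also have "\<dots> \<le> (\<Sum>u\<in>M. S u)" using assms by (intro sum_mono)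
  also have "\<dots> \<le> (\<Sum>u\<in>B. S u)" using assms S_nonneg by (intro sum_mono2) auto
  finally show ?thesis using sum_S_le by linarith
qed

lemma good_S: "u \<in> B - Bad \<Longrightarrow> S u \<le> (1/1000 * a)\<^sup>2"
  by (auto simp: Bad_def)

lemma X_small_if_good:
  assumes "{x, v, u} \<in> E" "u \<in> B - Bad" shows "X x v \<le> a/1000"
proof -
  have "(X x v)\<^sup>2 \<le> (1/1000 * a)\<^sup>2" using X_sq_le[OF assms(1)] good_S[OF assms(2)] by linarith
  then have "X x v \<le> 1/1000 * a" by (rule power2_le_imp_le) simp
  then show ?thesis by simp
qed

lemma X_sym: "X u v = X v u"
  by (simp add: X_def T_swap12)

lemma AA_bound: "(\<Sum>p\<in>A. \<Sum>q\<in>A. T v p q) \<le> (real (card (A1 v)))\<^sup>2 + 2/1000 * a\<^sup>2"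
proof -
  have row: "of_bool (p \<notin> A1 v) * X v p \<le> a/1000" if "p \<in> A" for p
    using that X_small_if_good[of p v] by (auto simp: A1_def X_sym[of v p])
  have "(\<Sum>p\<in>A. \<Sum>q\<in>A. T v p q) \<le> (\<Sum>p\<in>A. \<Sum>q\<in>A. of_bool (p \<in> A1 v) * of_bool (q \<in> A1 v)
      + of_bool (p \<notin> A1 v) * T v p q + of_bool (q \<notin> A1 v) * T v p q)"
    by (intro sum_mono) auto
  also have "\<dots> = (\<Sum>p\<in>A. of_bool (p \<in> A1 v)) * (\<Sum>q\<in>A. of_bool (q \<in> A1 v))
      + (\<Sum>p\<in>A. of_bool (p \<notin> A1 v) * X v p) + (\<Sum>p\<in>A. \<Sum>q\<in>A. of_bool (q \<notin> A1 v) * T v p q)"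
    by (simp only: sum.distrib sum_distrib_left[symmetric] sum_distrib_right[symmetric] X_def[symmetric])
  also have "(\<Sum>p\<in>A. \<Sum>q\<in>A. of_bool (q \<notin> A1 v) * T v p q) = (\<Sum>q\<in>A. of_bool (q \<notin> A1 v) * X v q)"
    by (subst sum.swap) (simp add: X_def sum_distrib_left T_swap23)
  also have "(\<Sum>p\<in>A. of_bool (p \<in> A1 v)) = real (card (A1 v))"
    using A1_sub by (rule sum_of_bool_sub) simp
  also have "(\<Sum>p\<in>A. of_bool (p \<notin> A1 v) * X v p) \<le> (\<Sum>p\<in>A. a/1000)" by (intro sum_mono row)
  finally show ?thesis by (simp add: power2_eq_square)
qed

lemma Y_sum_bound:
  "(\<Sum>x\<in>A. Y x v) \<le> a * mu + b * a / 1000 + (a - real (card (A1 v))) * (b - real (card (B1 v)))"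
proof -
  have col: "of_bool (u \<in> B1 v) * X v u \<le> a/1000" for u
  proof (cases "u \<in> B1 v")
    case True
    then obtain c where "c \<in> B - Bad" "{v, u, c} \<in> E" by (auto simp: B1_def)
    with True show ?thesis using X_small_if_good[of v u c] by simp
  qed simp
  have "(\<Sum>x\<in>A. Y x v) \<le> (\<Sum>x\<in>A. \<Sum>u\<in>B. of_bool (u \<in> Bad) + of_bool (u \<in> B1 v) * T v u x
       + of_bool (x \<notin> A1 v) * of_bool (u \<notin> B1 v))"
    unfolding Y_def
  proof (intro sum_mono)
    fix x u assume "x \<in> A" "u \<in> B"
    then show "T x v u \<le> of_bool (u \<in> Bad) + of_bool (u \<in> B1 v) * T v u x
       + of_bool (x \<notin> A1 v) * of_bool (u \<notin> B1 v)"
      using T_rot[of x v u] by (auto simp: A1_def T_def)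
  qed
  also have "\<dots> = a * mu + (\<Sum>u\<in>B. of_bool (u \<in> B1 v) * X v u)
      + (\<Sum>x\<in>A. of_bool (x \<notin> A1 v)) * (\<Sum>u\<in>B. of_bool (u \<notin> B1 v))"
  proof -
    have "(\<Sum>x\<in>A. \<Sum>u\<in>B. of_bool (u \<in> B1 v) * T v u x) = (\<Sum>u\<in>B. of_bool (u \<in> B1 v) * X v u)"
      by (subst sum.swap) (simp add: X_def sum_distrib_left)
    moreover have "(\<Sum>u\<in>B. of_bool (u \<in> Bad)) = mu" using Bad_sub by (rule sum_of_bool_sub) simp
    ultimately show ?thesis
      by (simp only: sum.distrib sum_distrib_left[symmetric] sum_distrib_right[symmetric] sum_constant)
  qed
  also have "(\<Sum>x\<in>A. of_bool (x \<notin> A1 v)) = a - real (card (A1 v))"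
    using sum_of_bool_sub[OF A1_sub[of v]] by (simp add: sum_subtractf of_bool_not_iff)
  also have "(\<Sum>u\<in>B. of_bool (u \<notin> B1 v)) = b - real (card (B1 v))"
    using sum_of_bool_sub[OF B1_sub[of v]] by (simp add: sum_subtractf of_bool_not_iff)
  also have "(\<Sum>u\<in>B. of_bool (u \<in> B1 v) * X v u) \<le> (\<Sum>u\<in>B. a/1000)" by (intro sum_mono col)
  finally show ?thesis by simp
qed

lemma BB_bound: "(\<Sum>u\<in>B. \<Sum>w\<in>B. T v u w) \<le> (real (card (B1 v)))\<^sup>2 + 2 * b * mu"
proof -
  have "(\<Sum>u\<in>B. \<Sum>w\<in>B. T v u w) \<le> (\<Sum>u\<in>B. \<Sum>w\<in>B. of_bool (u \<in> B1 v) * of_bool (w \<in> B1 v)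
      + of_bool (u \<in> Bad) + of_bool (w \<in> Bad))"
  proof (intro sum_mono)
    fix u w assume "u \<in> B" "w \<in> B"
    then show "T v u w \<le> of_bool (u \<in> B1 v) * of_bool (w \<in> B1 v) + of_bool (u \<in> Bad) + of_bool (w \<in> Bad)"
      using T_swap23[of v u w] by (auto simp: B1_def T_def)
  qed
  also have "\<dots> = (real (card (B1 v)))\<^sup>2 + 2 * b * mu"
    using sum_of_bool_sub[OF B1_sub[of v]] sum_of_bool_sub[OF Bad_sub]
    by (simp add: sum.distrib sum_product[symmetric] power2_eq_square sum_distrib_left[symmetric])
  finally show ?thesis .
qed

text \<open>A pair of \<open>A\<close> in all three links would have the edge
  \<open>{u, v, w}\<close> inside its neighbourhood, so every pair of \<open>A\<close> is missed by
  one of the three.\<close>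

lemma common_pair:
  assumes "S u + S v + S w < a\<^sup>2" shows "{u, v, w} \<notin> E"
proof
  assume e: "{u, v, w} \<in> E"
  have "(\<Sum>p\<in>A. \<Sum>q\<in>A. 1) \<le> (\<Sum>p\<in>A. \<Sum>q\<in>A. (1 - T u p q) + (1 - T v p q) + (1 - T w p q))"
  proof (intro sum_mono)
    fix p q
    show "1 \<le> (1 - T u p q) + (1 - T v p q) + (1 - T w p q)"
      using free_perm[of u p q v w] e by (auto simp: T_def)
  qed
  also have "\<dots> = S u + S v + S w" by (simp only: sum.distrib S_eq)
  finally show False using assms by (simp add: power2_eq_square)
qed

lemma BB_bound_small:
  assumes "S v \<le> 2/3 * a\<^sup>2" "A \<noteq> {}"
  shows "(\<Sum>u\<in>B. \<Sum>w\<in>B. T v u w) \<le> 2 * b * mu"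
proof -
  have "(\<Sum>u\<in>B. \<Sum>w\<in>B. T v u w) \<le> (\<Sum>u\<in>B. \<Sum>w\<in>B. of_bool (u \<in> Bad) + of_bool (w \<in> Bad))"
  proof (intro sum_mono)
    fix u w assume uw: "u \<in> B" "w \<in> B"
    have "{v, u, w} \<notin> E" if "u \<notin> Bad" "w \<notin> Bad"
    proof (rule common_pair)
      have "S u \<le> (1/1000 * a)\<^sup>2" "S w \<le> (1/1000 * a)\<^sup>2" using that uw good_S by auto
      moreover have "0 < a\<^sup>2" using assms(2) by (simp add: card_gt_0_iff)
      moreover have "(1/1000 * a)\<^sup>2 = a\<^sup>2/1000000" by (simp add: power_mult_distrib power_divide)
      ultimately show "S v + S u + S w < a\<^sup>2" using assms(1) by linarith
    qed
    then show "T v u w \<le> of_bool (u \<in> Bad) + of_bool (w \<in> Bad)" by (auto simp: T_def)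
  qed
  also have "\<dots> = 2 * b * mu"
    using sum_of_bool_sub[OF Bad_sub] by (simp add: sum.distrib sum_distrib_left[symmetric])
  finally show ?thesis .
qed

end

section \<open>Near-optimal minimum degree: every vertex has a type\<close>

locale dense_f32_free = max_indep +
  assumes large: "1000 \<le> card V"
    and D_ge: "(4/9 - 1/10^24) * (real (card V))\<^sup>2 \<le> D"
begin

definition al :: real where "al = a / n"
definition be :: real where "be = b / n"
definition de :: real where "de = D / n\<^sup>2"

lemma n_pos: "1000 \<le> n" "0 < n" using large by auto

lemma a_al: "a = al * n" and b_be: "b = be * n"
  using n_pos large by (auto simp: al_def be_def)

lemma al_be: "be = 1 - al"
  using ab_n n_pos large by (simp add: al_def be_def field_simps)

lemma al_ge: "2/3 - 1/30000000000 \<le> al"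
proof -
  have "(2 - 1/10^10)/3 * n \<le> a"
  proof (rule card_A_ge)
    show "V \<noteq> {}" using large by auto
    have "(4/9 - (1/10^10)\<^sup>2/9000) * n\<^sup>2 \<le> (4/9 - 1/10^24) * n\<^sup>2"
      by (intro mult_right_mono) (auto simp: power2_eq_square)
    then show "(4/9 - (1/10^10)\<^sup>2/9000) * n\<^sup>2 \<le> D" using D_ge by linarith
  qed auto
  then have "((2 - 1/10^10)/3) * n \<le> al * n" by (simp only: a_al)
  then have "(2 - 1/10^10)/3 \<le> al" using n_pos(2) by (meson mult_le_cancel_right_pos)
  then show ?thesis by simp
qed

lemma A_nonempty: "A \<noteq> {}" and a_pos: "0 < a"
proof -
  have "0 < al * n" using al_ge n_pos by (intro mult_pos_pos) auto
  then show "0 < a" by (simp only: a_al)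
  then show "A \<noteq> {}" by auto
qed

lemma D_le_ab: "de \<le> 2 * (al * be)"
proof -
  have "D \<le> 2 * a * b" using K_nonneg[OF A_nonempty] by (simp add: K_def)
  also have "\<dots> = 2 * (al * be) * n\<^sup>2" unfolding a_al b_be by (simp add: power2_eq_square)
  finally show ?thesis using n_pos large by (simp add: de_def pos_divide_le_eq)
qed

lemma D_n: "4/9 - 1/10^24 \<le> de"
  using D_ge n_pos large by (simp add: de_def pos_le_divide_eq)

text \<open>The right-hand side is the tangent at \<open>al = 2/3\<close> of the concave function
  \<open>al * (1 - al)\<close>.\<close>

lemma al_be_le: "al * be \<le> 4/9 - al/3"
proof -
  have "4/9 - al/3 - al * be = (al - 2/3)\<^sup>2"
    unfolding al_be by (simp add: power2_eq_square field_simps)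
  then show ?thesis using zero_le_power2[of "al - 2/3"] by linarith
qed

lemma al_le: "al \<le> 2/3 + 1/10^9"
proof (rule ccontr)
  assume neg: "\<not> ?thesis"
  show False using neg D_le_ab D_n al_be_le by simp
qed

lemma K_le: "K \<le> n\<^sup>2/10^10"
proof -
  have "2 * (al * be) - de \<le> 1/10^10" using al_ge D_n al_be_le by simp
  moreover have "K / n\<^sup>2 = 2 * (al * be) - de"
    using n_pos large unfolding K_def de_def a_al b_be by (simp add: power2_eq_square field_simps)
  ultimately have "K / n\<^sup>2 \<le> 1/10^10" by (simp only:)
  then show ?thesis using n_pos large by (simp add: pos_divide_le_eq)
qed

text \<open>Markov's inequality for \<open>S\<close> on \<open>B\<close>; the factor 2 comes from
  \<open>al \<ge> 1/2\<close>.\<close>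

lemma card_S_large:
  assumes "M \<subseteq> B" "\<And>u. u \<in> M \<Longrightarrow> r * a\<^sup>2 \<le> S u" "0 < r"
  shows "real (card M) * r \<le> 2 * n / 10^10"
proof -
  have "real (card M) * (r * a\<^sup>2) \<le> a * K"
    using assms by (intro S_large_card) auto
  also have "\<dots> \<le> a * (n\<^sup>2/10^10)" using K_le by (intro mult_left_mono) auto
  finally have "(real (card M) * r * a) * a \<le> (n\<^sup>2/10^10) * a"
    by (simp add: power2_eq_square mult_ac)
  then have "real (card M) * r * a \<le> n\<^sup>2/10^10" using a_pos by (meson mult_le_cancel_right_pos)
  then have "(real (card M) * r * al) * n \<le> (n/10^10) * n"
    by (simp only: a_al power2_eq_square mult_ac times_divide_eq_left times_divide_eq_right)
  then have "real (card M) * r * al \<le> n/10^10" using n_pos by (meson mult_le_cancel_right_pos)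
  moreover have "real (card M) * r * (1/2) \<le> real (card M) * r * al"
    using al_ge assms(3) by (intro mult_left_mono) auto
  ultimately show ?thesis by simp
qed

lemma mu_le: "mu / n \<le> 2/10000"
proof -
  have "mu * (1/10^6) \<le> 2 * n / 10^10"
    by (rule card_S_large[OF Bad_sub]) (auto simp: Bad_def power_mult_distrib power2_eq_square)
  then show ?thesis using n_pos large by (simp add: pos_divide_le_eq)
qed

text \<open>A vertex of \<open>B\<close> behaves like one of the small part (its link contains almost all pairs of \<open>A\<close>) or like
  one of the large part (its link contains almost all of \<open>A \<times> B\<close>).\<close>

lemma types:
  assumes v: "v \<in> B"
  shows "S v \<le> a\<^sup>2/50 \<or> a * b - (\<Sum>x\<in>A. Y x v) \<le> a * b/50"
proof -
  define AA where "AA = (a\<^sup>2 - S v)/n\<^sup>2"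
  define CR where "CR = (\<Sum>x\<in>A. Y x v)/n\<^sup>2"
  define BB where "BB = (\<Sum>p\<in>B. \<Sum>q\<in>B. T v p q)/n\<^sup>2"
  define a1 where "a1 = real (card (A1 v))/n"
  define b1 where "b1 = real (card (B1 v))/n"
  define m where "m = mu/n"
  have n2: "0 < n\<^sup>2" using n_pos by simp
  have al_r: "2/3 - 1/1000000000 \<le> al" "al \<le> 2/3 + 1/1000000000" using al_ge al_le by auto
  have d: "4/9 - 1/1000000000 \<le> de" using D_n by simp
  have m: "0 \<le> m" "m \<le> 2/10000" using mu_le by (auto simp: m_def)
  have a1: "0 \<le> a1" "a1 \<le> al"
    using card_mono[OF finA A1_sub[of v]] n_pos by (auto simp: a1_def al_def divide_right_mono)
  have b1: "0 \<le> b1" "b1 \<le> be"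
    using card_mono[OF finB B1_sub[of v]] n_pos by (auto simp: b1_def be_def divide_right_mono)
  have "D \<le> (a\<^sup>2 - S v) + 2 * (\<Sum>x\<in>A. Y x v) + (\<Sum>p\<in>B. \<Sum>q\<in>B. T v p q)"
    using deg_ge[of v] v by (simp add: deg2_split B_def)
  then have "D/n\<^sup>2 \<le> ((a\<^sup>2 - S v) + 2 * (\<Sum>x\<in>A. Y x v) + (\<Sum>p\<in>B. \<Sum>q\<in>B. T v p q))/n\<^sup>2"
    using n2 by (intro divide_right_mono) auto
  then have main: "de \<le> AA + 2 * CR + BB"
    by (simp add: de_def AA_def CR_def BB_def add_divide_distrib)
  have AA_eq: "a\<^sup>2 - S v = AA * n\<^sup>2" using n_pos large by (simp add: AA_def)
  have sa: "a\<^sup>2 = al\<^sup>2 * n\<^sup>2" unfolding a_al by (simp add: power_mult_distrib)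
  have card1: "real (card (A1 v)) = a1 * n" "real (card (B1 v)) = b1 * n" "mu = m * n"
    using n_pos large by (auto simp: a1_def b1_def m_def)
  have AA1: "AA \<le> a1\<^sup>2 + 2/1000 * al\<^sup>2"
  proof -
    have "AA * n\<^sup>2 \<le> (a1\<^sup>2 + 2/1000 * al\<^sup>2) * n\<^sup>2"
      using AA_bound[of v] unfolding AA_eq[symmetric] S_def card1 a_al
      by (simp add: power_mult_distrib algebra_simps)
    then show ?thesis using n2 by (meson mult_le_cancel_right_pos)
  qed
  have CRe: "(\<Sum>x\<in>A. Y x v) = CR * n\<^sup>2" using n_pos large by (simp add: CR_def)
  have CR1: "CR \<le> m + be * al/1000 + (al - a1) * (be - b1)"
  proof -
    have "CR * n\<^sup>2 \<le> (al * m + be * al/1000 + (al - a1) * (be - b1)) * n\<^sup>2"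
      using Y_sum_bound[of v] unfolding CRe[symmetric] card1 a_al b_be
      by (simp add: power2_eq_square algebra_simps)
    then have "CR \<le> al * m + be * al/1000 + (al - a1) * (be - b1)"
      using n2 by (meson mult_le_cancel_right_pos)
    moreover have "al * m \<le> 1 * m" using m al_r by (intro mult_right_mono) auto
    ultimately show ?thesis by simp
  qed
  \<comment> \<open>Up to two thirds of missing pairs, \<open>v\<close> and any two good vertices
    still have a pair of \<open>A\<close> in all three links, so an edge from \<open>v\<close> into
    \<open>B\<close> needs a bad vertex. Beyond that, too few pairs inside \<open>A\<close> remain
    and the other estimate applies.\<close>
  show ?thesis
  proof (cases "S v \<le> 2/3 * a\<^sup>2")
    case True
    have BB1: "BB \<le> 2 * be * m"
    proof -
      have "BB * n\<^sup>2 \<le> (2 * be * m) * n\<^sup>2"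
        using BB_bound_small[OF True A_nonempty] n_pos large unfolding card1 b_be
        by (simp add: BB_def power2_eq_square algebra_simps)
      then show ?thesis using n2 by (meson mult_le_cancel_right_pos)
    qed
    have CR2: "CR \<le> m + (al - a1) * be"
    proof -
      have "(\<Sum>x\<in>A. Y x v) \<le> (\<Sum>x\<in>A. \<Sum>u\<in>B. of_bool (u \<in> Bad) + of_bool (x \<notin> A1 v))"
        unfolding Y_def
      proof (intro sum_mono)
        fix x u assume "x \<in> A" "u \<in> B"
        then show "T x v u \<le> of_bool (u \<in> Bad) + of_bool (x \<notin> A1 v)"
          by (auto simp: A1_def T_def)
      qed
      also have "\<dots> = a * mu + (\<Sum>x\<in>A. of_bool (x \<notin> A1 v)) * b"
        by (simp only: sum.distrib sum_of_bool_sub[OF Bad_sub finB] sum_constant sum_distrib_left[symmetric] mult.commute)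
      also have "(\<Sum>x\<in>A. of_bool (x \<notin> A1 v)) = a - real (card (A1 v))"
        using sum_of_bool_sub[OF A1_sub[of v]] by (simp add: sum_subtractf of_bool_not_iff)
      finally have "CR * n\<^sup>2 \<le> (al * m + (al - a1) * be) * n\<^sup>2"
        unfolding CRe card1 a_al b_be by (simp add: power2_eq_square algebra_simps)
      then have "CR \<le> al * m + (al - a1) * be"
        using n2 by (meson mult_le_cancel_right_pos)
      moreover have "al * m \<le> 1 * m" using m al_r by (intro mult_right_mono) auto
      ultimately show ?thesis by simp
    qed
    have "AA * n\<^sup>2 \<ge> (al\<^sup>2/3) * n\<^sup>2" using True unfolding AA_eq[symmetric] by (simp add: sa mult.commute)
    then have "al\<^sup>2/3 \<le> AA" using n2 by (meson mult_le_cancel_right_pos)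
    then have "al\<^sup>2 - AA \<le> al\<^sup>2/50"
      using main BB1 CR2 AA1
      by (intro type_one_real[OF al_r al_be d a1 m]) auto
    then have "(al\<^sup>2 - AA) * n\<^sup>2 \<le> (al\<^sup>2/50) * n\<^sup>2" using n2 by (intro mult_right_mono) auto
    moreover have "S v = (al\<^sup>2 - AA) * n\<^sup>2" using AA_eq sa by (simp add: algebra_simps)
    ultimately show ?thesis by (simp add: sa)
  next
    case False
    have BB1: "BB \<le> b1\<^sup>2 + 2 * be * m"
    proof -
      have "BB * n\<^sup>2 \<le> (b1\<^sup>2 + 2 * be * m) * n\<^sup>2"
        using BB_bound[of v] n_pos large unfolding card1 b_be
        by (simp add: BB_def power2_eq_square algebra_simps)
      then show ?thesis using n2 by (meson mult_le_cancel_right_pos)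
    qed
    have "AA * n\<^sup>2 \<le> (al\<^sup>2/3) * n\<^sup>2" using False unfolding AA_eq[symmetric] by (simp add: sa mult.commute)
    then have "AA \<le> al\<^sup>2/3" using n2 by (meson mult_le_cancel_right_pos)
    then have "al * be - CR \<le> al * be/50"
      using main BB1 CR1 AA1
      by (intro type_two_real[OF al_r al_be d a1 b1 m]) auto
    then have "(al * be - CR) * n\<^sup>2 \<le> (al * be/50) * n\<^sup>2" using n2 by (intro mult_right_mono) auto
    then show ?thesis unfolding CRe a_al b_be by (simp add: power2_eq_square algebra_simps)
  qed
qed

end

section \<open>Counting edges across the final partition\<close>

context dense_f32_free
begin

text \<open>One fiftieth serves twice: three vertices of \<open>V1\<close> together miss less than
  all pairs of \<open>A\<close>, and \<open>1/50 < 1/49\<close> gives the bound \<open>a/7\<close>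
  in \<open>edge_112_X\<close>. By \<open>types\<close>, the rest \<open>V3\<close> of
  \<open>B\<close> behaves like \<open>A\<close>.\<close>

definition V1 :: "'a set" where "V1 = {v\<in>B. S v \<le> a\<^sup>2/50}"
definition V2 :: "'a set" where "V2 = V - V1"
definition V3 :: "'a set" where "V3 = {v\<in>B. a\<^sup>2/50 < S v}"

lemma V_parts: "V1 \<subseteq> V" "V2 \<subseteq> V" "V = V1 \<union> V2" "V1 \<inter> V2 = {}" "V2 = A \<union> V3" "A \<inter> V3 = {}" "V3 \<subseteq> B"
  using A_sub by (auto simp: V1_def V2_def V3_def B_def)

lemma fin_parts [simp]: "finite V1" "finite V2" "finite V3"
  using V_parts fin finB by (auto intro: finite_subset)

lemma V2_link: "v \<in> V2 \<Longrightarrow> a * b - (\<Sum>x\<in>A. Y x v) \<le> a * b/50"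
proof (cases "v \<in> A")
  case True
  have "(\<Sum>x\<in>A. Y x v) = (\<Sum>u\<in>B. X v u)"
    unfolding Y_def X_def by (subst sum.swap) (metis (no_types, lifting) T_swap12 T_swap23 sum.cong)
  then have "a * b - (\<Sum>x\<in>A. Y x v) \<le> K" using sum_deficit_le[OF True] by (simp add: sum_subtractf mult.commute)
  also have "K \<le> a * b/50"
  proof -
    have "(1/2) * (1/4) \<le> al * be" using al_ge al_le by (intro mult_mono) (auto simp: al_be)
    then have "(1/10^10) * n\<^sup>2 \<le> (al * be/50) * n\<^sup>2" by (intro mult_right_mono) auto
    also have "\<dots> = a * b/50" unfolding a_al b_be by (simp add: power2_eq_square)
    finally show ?thesis using K_le by simp
  qed
  finally show ?thesis .
next
  case False
  assume "v \<in> V2"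
  with False have "v \<in> V3" using V_parts by auto
  then show ?thesis using types[of v] by (auto simp: V3_def)
qed

lemma no_edge_111:
  assumes "u \<in> V1" "v \<in> V1" "w \<in> V1" shows "{u, v, w} \<notin> E"
proof (rule common_pair)
  have "0 < a\<^sup>2" using a_pos by (rule zero_less_power)
  moreover have "S u \<le> a\<^sup>2/50" "S v \<le> a\<^sup>2/50" "S w \<le> a\<^sup>2/50" using assms by (auto simp: V1_def)
  ultimately show "S u + S v + S w < a\<^sup>2" by linarith
qed

lemma ab_pos: "0 < a * b"
proof -
  have "0 < al * be" using al_ge al_le by (intro mult_pos_pos) (auto simp: al_be)
  then have "0 < al * be * (n * n)" using n_pos(2) by (metis mult_pos_pos)
  then show ?thesis unfolding a_al b_be by (simp add: mult_ac)
qed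

text \<open>The analogue of \<open>common_pair\<close> with pairs from \<open>A \<times> B\<close>:
  each vertex of \<open>V2\<close> misses at most a fiftieth of them, so three vertices share
  one.\<close>

lemma no_edge_222:
  assumes "u \<in> V2" "v \<in> V2" "w \<in> V2" shows "{u, v, w} \<notin> E"
proof
  assume e: "{u, v, w} \<in> E"
  have Yc: "a * b - (\<Sum>x\<in>A. Y x r) = (\<Sum>p\<in>A. \<Sum>q\<in>B. 1 - T p r q)" for r
    by (simp add: Y_def sum_subtractf)
  have "a * b = (\<Sum>p\<in>A. \<Sum>q\<in>B. 1)" by simp
  also have "\<dots> \<le> (\<Sum>p\<in>A. \<Sum>q\<in>B. (1 - T p u q) + (1 - T p v q) + (1 - T p w q))"
  proof (intro sum_mono)
    fix p q
    show "1 \<le> (1 - T p u q) + (1 - T p v q) + (1 - T p w q)"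
      using free[of p q u v w] e by (auto simp: T_def insert_commute)
  qed
  also have "\<dots> \<le> 3 * (a * b/50)"
    using V2_link[OF assms(1)] V2_link[OF assms(2)] V2_link[OF assms(3)]
    unfolding Yc sum.distrib by linarith
  finally show False using ab_pos by simp
qed

lemma edge_112_X:
  assumes "x \<in> V1" "y \<in> V" "x' \<in> V1" "{x, y, x'} \<in> E" shows "X x y \<le> a/7"
proof -
  have "(X x y)\<^sup>2 \<le> (a/7)\<^sup>2"
  proof -
    have "(X x y)\<^sup>2 \<le> a\<^sup>2/50" using X_sq_le[OF assms(4)] assms(3) by (auto simp: V1_def)
    moreover have "(a/7)\<^sup>2 = a\<^sup>2/49" by (simp add: power_divide)
    ultimately show ?thesis using zero_le_power2[of a] by linarith
  qed
  then show ?thesis by (rule power2_le_imp_le) simp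
qed

lemma card_V3: "real (card V3) \<le> n/1000"
proof -
  have "real (card V3) * (1/50) \<le> 2 * n / 10^10"
    by (rule card_S_large) (auto simp: V3_def)
  then show ?thesis using n_pos by simp
qed

lemma cards:
  "real (card V1) \<le> 34/100 * n" "66/100 * n \<le> real (card V2)"
proof -
  have "66/100 * n \<le> al * n" using al_ge n_pos by (intro mult_right_mono) auto
  also have "\<dots> \<le> real (card V2)" using V_parts(5) fin_parts(2) unfolding a_al[symmetric]
    by (simp add: card_mono)
  finally show 1: "66/100 * n \<le> real (card V2)" .
  have "card V = card V1 + card V2" using V_parts fin_parts by (metis card_Un_disjoint)
  with 1 show "real (card V1) \<le> 34/100 * n" by simp
qed

definition P :: "'a \<Rightarrow> 'a set" where
  "P y = {x\<in>V1. \<exists>x'\<in>V1. {x, y, x'} \<in> E}"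

text \<open>If \<open>x\<close> is in \<open>P y\<close>, then \<open>X x y \<le> a/7\<close>, and
  even with all of \<open>V1\<close> and \<open>V3\<close> added the row stays below
  \<open>card V2 - 2\<close>. Otherwise the row has no third vertex in \<open>V1\<close>, and
  \<open>- 1\<close> accounts for \<open>y\<close> itself. So edges with two vertices in
  \<open>V1\<close> always lose on balance.\<close>

lemma count_row:
  assumes y: "y \<in> V2"
  shows "(\<Sum>x\<in>V1. \<Sum>x'\<in>V1. T y x x') + (\<Sum>x\<in>V1. \<Sum>y'\<in>V2. T y x y')
    \<le> real (card V1) * (real (card V2) - 1) - real (card (P y))"
proof -
  have P: "P y \<subseteq> V1" by (auto simp: P_def)
  have row: "(\<Sum>x'\<in>V1. T y x x') + (\<Sum>y'\<in>V2. T y x y') \<le> (real (card V2) - 1) - of_bool (x \<in> P y)"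
    if x: "x \<in> V1" for x
  proof (cases "x \<in> P y")
    case True
    then obtain x' where x': "x' \<in> V1" "{x, y, x'} \<in> E" by (auto simp: P_def)
    have "y \<in> V" using y by (simp add: V2_def)
    then have "X x y \<le> a/7" using edge_112_X[OF x _ x'] by simp
    moreover have "(\<Sum>y'\<in>V2. T y x y') = X x y + (\<Sum>y'\<in>V3. T y x y')"
      using V_parts(5,6) finA fin_parts(3) by (simp add: sum.union_disjoint X_def T_swap12)
    moreover have "(\<Sum>y'\<in>V3. T y x y') \<le> real (card V3)" by (rule sum_T_le) simp
    moreover have "(\<Sum>x'\<in>V1. T y x x') \<le> real (card V1)" by (rule sum_T_le) simp
    moreover have "a \<le> n" using card_mono[OF fin A_sub] by simp
    ultimately show ?thesis using True card_V3 cards n_pos by simp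
  next
    case False
    then have "(\<Sum>x'\<in>V1. T y x x') = 0"
      using x by (intro sum.neutral) (auto simp: P_def T_def insert_commute)
    moreover have "(\<Sum>y'\<in>V2. T y x y') = (\<Sum>y'\<in>V2 - {y}. T y x y')"
      using y edge_distinct[of y x y] by (subst sum.remove[of _ y]) (auto simp: T_def)
    moreover have "(\<Sum>y'\<in>V2 - {y}. T y x y') \<le> real (card (V2 - {y}))" by (rule sum_T_le) simp
    moreover have "real (card (V2 - {y})) = real (card V2) - 1"
    proof -
      have "0 < card V2" using y by (auto simp: card_gt_0_iff)
      then show ?thesis using y by (simp add: of_nat_diff Suc_le_eq)
    qed
    ultimately show ?thesis using False by simp
  qed
  have "(\<Sum>x\<in>V1. \<Sum>x'\<in>V1. T y x x') + (\<Sum>x\<in>V1. \<Sum>y'\<in>V2. T y x y')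
      \<le> (\<Sum>x\<in>V1. (real (card V2) - 1) - of_bool (x \<in> P y))"
    unfolding sum.distrib[symmetric] by (intro sum_mono row)
  also have "\<dots> = real (card V1) * (real (card V2) - 1) - real (card (P y))"
    using sum_of_bool_sub[OF P] by (simp only: sum_subtractf sum_constant fin_parts right_diff_distrib mult_1_right)
  finally show ?thesis .
qed

text \<open>Of the eight ways to place three positions in the parts, the two inside one part vanish,
  and the other six are three copies each of two sums, one for every position of the odd
  vertex.\<close>

lemma twice_card_E:
  "2 * real (card E) = (\<Sum>y\<in>V2. (\<Sum>x\<in>V1. \<Sum>x'\<in>V1. T y x x') + (\<Sum>x\<in>V1. \<Sum>y'\<in>V2. T y x y'))"
proof -
  have split: "(\<Sum>x\<in>V. f x) = (\<Sum>x\<in>V1. f x) + (\<Sum>x\<in>V2. (f x :: real))" for f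
    using sum.union_disjoint[OF fin_parts(1,2) V_parts(4), of f] arg_cong[OF V_parts(3), of "sum f"]
    by (rule trans[rotated])
  define t112 where "t112 = (\<Sum>y\<in>V2. \<Sum>x\<in>V1. \<Sum>x'\<in>V1. T y x x')"
  define t122 where "t122 = (\<Sum>y\<in>V2. \<Sum>x\<in>V1. \<Sum>y'\<in>V2. T y x y')"
  have "6 * real (card E) = (\<Sum>x\<in>V. \<Sum>y\<in>V. \<Sum>z\<in>V. T x y z)"
    using sum_deg2 by (simp add: deg2_def)
  also have "\<dots> = (\<Sum>x\<in>V1. \<Sum>y\<in>V1. \<Sum>z\<in>V1. T x y z) + (\<Sum>x\<in>V1. \<Sum>y\<in>V1. \<Sum>z\<in>V2. T x y z)
     + (\<Sum>x\<in>V1. \<Sum>y\<in>V2. \<Sum>z\<in>V1. T x y z) + (\<Sum>x\<in>V1. \<Sum>y\<in>V2. \<Sum>z\<in>V2. T x y z)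
     + (t112 + t122 + (\<Sum>x\<in>V2. \<Sum>y\<in>V2. \<Sum>z\<in>V1. T x y z) + (\<Sum>x\<in>V2. \<Sum>y\<in>V2. \<Sum>z\<in>V2. T x y z))"
    unfolding t112_def t122_def by (simp only: split sum.distrib)
  moreover have "(\<Sum>x\<in>V1. \<Sum>y\<in>V1. \<Sum>z\<in>V1. T x y z) = 0"
    by (intro sum.neutral ballI) (simp add: T_eq_0 no_edge_111)
  moreover have "(\<Sum>x\<in>V2. \<Sum>y\<in>V2. \<Sum>z\<in>V2. T x y z) = 0"
    by (intro sum.neutral ballI) (simp add: T_eq_0 no_edge_222)
  moreover have "(\<Sum>x\<in>V1. \<Sum>y\<in>V2. \<Sum>z\<in>V1. T x y z) = t112"
    unfolding t112_def by (rule trans[OF sum.swap]) (simp only: T_swap12)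
  moreover have "(\<Sum>x\<in>V1. \<Sum>y\<in>V1. \<Sum>z\<in>V2. T x y z) = t112"
  proof -
    have "(\<Sum>x\<in>V1. \<Sum>y\<in>V1. \<Sum>z\<in>V2. T x y z) = (\<Sum>x\<in>V1. \<Sum>z\<in>V2. \<Sum>y\<in>V1. T x z y)"
      by (intro sum.cong refl sum2_T_sym)
    also have "\<dots> = t112"
      unfolding t112_def by (rule trans[OF sum.swap]) (simp only: T_swap12)
    finally show ?thesis .
  qed
  moreover have "(\<Sum>x\<in>V1. \<Sum>y\<in>V2. \<Sum>z\<in>V2. T x y z) = t122"
    unfolding t122_def by (rule trans[OF sum.swap]) (simp only: T_swap12)
  moreover have "(\<Sum>x\<in>V2. \<Sum>y\<in>V2. \<Sum>z\<in>V1. T x y z) = t122"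
    unfolding t122_def by (intro sum.cong refl sum2_T_sym)
  ultimately have "2 * real (card E) = t112 + t122" by linarith
  then show ?thesis by (simp add: t112_def t122_def sum.distrib)
qed

lemma card_E_le:
  "2 * real (card E) \<le> real (card V1) * real (card V2) * (real (card V2) - 1) - (\<Sum>y\<in>V2. real (card (P y)))"
proof -
  have "2 * real (card E) \<le> (\<Sum>y\<in>V2. real (card V1) * (real (card V2) - 1) - real (card (P y)))"
    unfolding twice_card_E by (intro sum_mono count_row)
  then show ?thesis by (simp add: sum_subtractf mult_ac)
qed

lemma extremal_semibipartite:
  assumes "real (card V1) * real (card V2) * (real (card V2) - 1) \<le> 2 * real (card E)" "e \<in> E"
  shows "card (e \<inter> V1) = 1"
proof -
  have "(\<Sum>y\<in>V2. real (card (P y))) = 0"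
    using assms(1) card_E_le sum_nonneg[of V2 "\<lambda>y. real (card (P y))"] by linarith
  then have "card (P y) = 0" if "y \<in> V2" for y
    using that by (simp add: sum_nonneg_eq_0_iff)
  moreover have "finite (P y)" for y by (simp add: P_def)
  ultimately have P0: "P y = {}" if "y \<in> V2" for y using that by auto
  obtain x y z where e: "e = {x, y, z}" "x \<noteq> y" "y \<noteq> z" "x \<noteq> z" using assms(2) by (rule edge_cases)
  have xyz: "x \<in> V" "y \<in> V" "z \<in> V" using edge_verts e assms(2) by auto
  have no112: "{p, q, r} \<notin> E" if "p \<in> V1" "q \<in> V1" "r \<in> V2" for p q r
    using P0[OF that(3)] that by (auto simp: P_def insert_commute)
  have perms: "{x, z, y} \<in> E" "{y, z, x} \<in> E" "{x, y, z} \<in> E" using assms(2) e by (auto simp: insert_commute)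
  have V2: "r \<in> V2" if "r \<in> V" "r \<notin> V1" for r using that by (simp add: V2_def)
  have "x \<in> V1 \<or> y \<in> V1 \<or> z \<in> V1" using no_edge_222[of x y z] perms(3) xyz V2 by metis
  moreover have "\<not> (x \<in> V1 \<and> y \<in> V1)" using no112[of x y z] no_edge_111[of x y z] perms xyz V2 by metis
  moreover have "\<not> (x \<in> V1 \<and> z \<in> V1)" using no112[of x z y] no_edge_111[of x y z] perms xyz V2 by metis
  moreover have "\<not> (y \<in> V1 \<and> z \<in> V1)" using no112[of y z x] no_edge_111[of x y z] perms xyz V2 by metis
  ultimately have "e \<inter> V1 = {x} \<or> e \<inter> V1 = {y} \<or> e \<inter> V1 = {z}" using e by auto
  then show ?thesis by auto
qed

end

section \<open>Semibipartite triple systems and pullbacks\<close>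

text \<open>The number of edges of every member of \<open>S3 m\<close>, by \<open>S3_iff\<close>;
  \<open>x\<close> is the size of the part that each edge meets once.\<close>

definition max_semibip :: "nat \<Rightarrow> nat" where
  "max_semibip m = Max ((\<lambda>x. x * ((m - x) choose 2)) ` {..m})"

lemma max_semibip_ge: "x \<le> m \<Longrightarrow> x * ((m - x) choose 2) \<le> max_semibip m"
  unfolding max_semibip_def by (intro Max_ge) auto

lemma max_semibip_attained: obtains x where "x \<le> m" "max_semibip m = x * ((m - x) choose 2)"
proof -
  have "max_semibip m \<in> (\<lambda>x. x * ((m - x) choose 2)) ` {..m}"
    unfolding max_semibip_def by (intro Max_in) auto
  then show ?thesis using that by auto
qed

lemma choose_two_real: "real (k choose 2) = real k * (real k - 1) / 2"
proof (cases k)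
  case (Suc j)
  have "even (k * (k - 1))" by (cases "even k") auto
  then have "real (k * (k - 1) div 2) = real (k * (k - 1)) / 2" by (simp add: real_of_nat_div)
  with Suc show ?thesis by (simp add: choose_two algebra_simps)
qed simp

text \<open>The inequality of arithmetic and geometric means for \<open>r\<close>,
  \<open>s/2\<close>, \<open>s/2\<close>, with the difference written as an explicit nonnegative
  product.\<close>

lemma max_semibip_upper: "real (max_semibip m) \<le> 2/27 * real m ^ 3"
proof -
  obtain x where x: "x \<le> m" "max_semibip m = x * ((m - x) choose 2)" by (rule max_semibip_attained)
  define r s where "r = real x" and "s = real m - r"
  have rs: "0 \<le> r" "0 \<le> s" "real m = r + s" using x by (auto simp: r_def s_def)
  have "real (max_semibip m) = r * (s * (s - 1) / 2)" using x by (simp add: choose_two_real r_def s_def)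
  also have "\<dots> \<le> r * (s * s / 2)" using rs by (intro mult_left_mono) (auto simp: field_simps)
  also have "\<dots> \<le> 2/27 * (r + s)^3"
  proof -
    have "2/27 * (r + s)^3 - r * (s * s / 2) = (2 * r - s)\<^sup>2 * (r + 4 * s) / 54"
      by (simp add: power2_eq_square power3_eq_cube field_simps)
    moreover have "0 \<le> (2 * r - s)\<^sup>2 * (r + 4 * s) / 54" using rs by simp
    ultimately show ?thesis by linarith
  qed
  finally show ?thesis using rs by simp
qed

text \<open>The leading cubic is stationary at \<open>x = m/3\<close>, so the rounding error
  \<open>f\<close> of \<open>m div 3\<close> enters only with terms at most linear in
  \<open>m\<close>.\<close>

lemma max_semibip_lower: "2/27 * real m ^ 3 - (real m)\<^sup>2/9 - real m \<le> real (max_semibip m)"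
proof -
  define x where "x = m div 3"
  define f where "f = real m / 3 - real x"
  have "real m = 3 * real x + real (m mod 3)"
    unfolding x_def by (metis add.commute mod_mult_div_eq mult.commute of_nat_add of_nat_mult of_nat_numeral)
  moreover have "m mod 3 \<le> 2" by (simp add: less_Suc_eq_le[symmetric])
  moreover have "3 * f = real m - 3 * real x" by (simp add: f_def)
  ultimately have f: "0 \<le> f" "f \<le> 2/3" by linarith+
  have xm: "x \<le> m" by (simp add: x_def)
  have xr: "real x = real m / 3 - f" "real (m - x) = 2 * real m / 3 + f"
    using xm by (simp_all add: f_def)
  have m0: "0 \<le> real m" by simp
  have "real (x * ((m - x) choose 2)) = (real m / 3 - f) * ((2 * real m / 3 + f) * (2 * real m / 3 + f - 1) / 2)"
    by (simp only: of_nat_mult choose_two_real xr)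
  also have "\<dots> = 2/27 * real m ^ 3 - (real m)\<^sup>2/9 - real m * (f * f) / 2 - f * (f * f) / 2
      + real m * f / 6 + f * f / 2"
    by (simp add: power2_eq_square power3_eq_cube field_simps)
  also have "\<dots> \<ge> 2/27 * real m ^ 3 - (real m)\<^sup>2/9 - real m"
  proof -
    have ff: "f * f \<le> (2/3) * (2/3)" using f by (intro mult_mono) auto
    have "real m * (f * f) \<le> real m * (4/9)" using ff by (intro mult_left_mono) auto
    moreover have "f * (f * f) \<le> 1 * (f * f)" using f by (intro mult_right_mono) auto
    moreover have "0 \<le> real m * f" using f by simp
    ultimately show ?thesis by simp
  qed
  finally show ?thesis using max_semibip_ge[OF xm] by linarith
qed

definition semibip_edges :: "'a set \<Rightarrow> 'a set \<Rightarrow> 'a set set" where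
  "semibip_edges V1 V2 = {e. e \<subseteq> V1 \<union> V2 \<and> card e = 3 \<and> card (e \<inter> V1) = 1}"

lemma card_semibip_edges:
  assumes "finite V1" "finite V2" "V1 \<inter> V2 = {}"
  shows "card (semibip_edges V1 V2) = card V1 * (card V2 choose 2)"
proof -
  let ?Q = "{q. q \<subseteq> V2 \<and> card q = 2}"
  have "bij_betw (\<lambda>(x, q). insert x q) (V1 \<times> ?Q) (semibip_edges V1 V2)"
    unfolding bij_betw_def
  proof
    show "inj_on (\<lambda>(x, q). insert x q) (V1 \<times> ?Q)"
    proof (rule inj_onI, clarify)
      fix x q y r
      assume "x \<in> V1" "q \<subseteq> V2" "y \<in> V1" "r \<subseteq> V2" and eq: "insert x q = insert y r"
      with assms(3) have "insert x q \<inter> V1 = {x}" "insert y r \<inter> V1 = {y}"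
        "insert x q \<inter> V2 = q" "insert y r \<inter> V2 = r" by auto
      with eq show "x = y \<and> q = r" by auto
    qed
    show "(\<lambda>(x, q). insert x q) ` (V1 \<times> ?Q) = semibip_edges V1 V2"
    proof (intro equalityI subsetI)
      fix e assume "e \<in> (\<lambda>(x, q). insert x q) ` (V1 \<times> ?Q)"
      then obtain x q where xq: "x \<in> V1" "q \<subseteq> V2" "card q = 2" "e = insert x q" by auto
      then have "x \<notin> q" "e \<inter> V1 = {x}" using assms(3) by auto
      moreover have "finite q" using xq assms(2) finite_subset by blast
      ultimately show "e \<in> semibip_edges V1 V2" using xq by (auto simp: semibip_edges_def)
    next
      fix e assume e: "e \<in> semibip_edges V1 V2"
      then obtain x where x: "e \<inter> V1 = {x}" by (auto simp: semibip_edges_def card_1_singleton_iff)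
      then have "x \<in> e" by auto
      with x have "e = insert x (e - {x})" "e - {x} \<subseteq> V2" "x \<in> V1"
        using e by (auto simp: semibip_edges_def)
      moreover have "card (e - {x}) = 2" using e \<open>x \<in> e\<close> by (auto simp: semibip_edges_def card_Diff_singleton)
      ultimately show "e \<in> (\<lambda>(x, q). insert x q) ` (V1 \<times> ?Q)"
        by (intro image_eqI[of _ _ "(x, e - {x})"]) auto
    qed
  qed
  then have "card (V1 \<times> ?Q) = card (semibip_edges V1 V2)" by (rule bij_betw_same_card)
  then show ?thesis using n_subsets[OF assms(2), of 2] by (simp add: card_cartesian_product)
qed

lemma (in triple_system) semibip_card_le:
  assumes W: "W \<subseteq> V" and sb: "\<And>e. e \<in> E \<Longrightarrow> card (e \<inter> W) = 1"
  shows "card E \<le> max_semibip (card V)"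
proof -
  have 1: "E \<subseteq> semibip_edges W (V - W)"
  proof
    fix e assume e: "e \<in> E"
    have "W \<union> (V - W) = V" using W by blast
    then show "e \<in> semibip_edges W (V - W)"
      unfolding semibip_edges_def using uniform[OF e] sb[OF e] by simp
  qed
  have 2: "finite W" "finite (V - W)" "W \<inter> (V - W) = {}" using finite_subset[OF W fin] fin by auto
  have "finite (Pow (W \<union> (V - W)))" using 2 by simp
  then have 3: "finite (semibip_edges W (V - W))"
    by (rule rev_finite_subset) (auto simp: semibip_edges_def)
  have "card E \<le> card (semibip_edges W (V - W))" using 3 1 by (rule card_mono)
  also have "\<dots> = card W * ((card V - card W) choose 2)"
    using card_semibip_edges[OF 2] card_Diff_subset[OF 2(1) W] by simp
  also have "\<dots> \<le> max_semibip (card V)" by (rule max_semibip_ge[OF card_mono[OF fin W]])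
  finally show ?thesis .
qed

text \<open>Each edge has indicator sum 1, so the three edges through \<open>a\<close>,
  \<open>b\<close> give \<open>c\<close>, \<open>d\<close>, \<open>e\<close> the same indicator; the
  sum over \<open>{c, d, e}\<close> is then divisible by 3.\<close>

lemma (in triple_system) semibip_free:
  assumes sb: "\<And>e. e \<in> E \<Longrightarrow> card (e \<inter> W) = 1"
  shows "f32_free V E"
proof
  fix a b c d e
  assume E: "{a, b, c} \<in> E" "{a, b, d} \<in> E" "{a, b, e} \<in> E" "{c, d, e} \<in> E"
  define i where "i x = (if x \<in> W then 1 else 0 :: nat)" for x
  have one: "i x + i y + i z = 1" if "{x, y, z} \<in> E" for x y z
  proof -
    have "card ({x, y, z} \<inter> W) = (\<Sum>v\<in>{x, y, z}. i v)"
      by (simp add: i_def sum.If_cases del: sum.insert)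
    also have "\<dots> = i x + i y + i z" using edge_distinct[OF that] by simp
    finally show ?thesis using sb[OF that] by simp
  qed
  show False using one[OF E(1)] one[OF E(2)] one[OF E(3)] one[OF E(4)] by presburger
qed

lemma exists_semibip:
  assumes "finite V"
  obtains E where "f32_free V E" "card E = max_semibip (card V)"
    "\<exists>W\<subseteq>V. \<forall>e\<in>E. card (e \<inter> W) = 1"
proof -
  obtain x where x: "x \<le> card V" "max_semibip (card V) = x * ((card V - x) choose 2)" by (rule max_semibip_attained)
  obtain W where W: "W \<subseteq> V" "card W = x" using obtain_subset_with_card_n[OF x(1)] by blast
  define E where "E = semibip_edges W (V - W)"
  have finW: "finite W" "finite (V - W)" "W \<inter> (V - W) = {}" using finite_subset[OF W(1) assms] assms by auto
  have un: "W \<union> (V - W) = V" using W by auto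
  interpret triple_system V E
    using assms un by unfold_locales (auto simp: E_def semibip_edges_def)
  have "f32_free V E" by (rule semibip_free[of W]) (auto simp: E_def semibip_edges_def)
  moreover have "card E = max_semibip (card V)"
    using card_semibip_edges[OF finW] card_Diff_subset[OF finW(1) W(1)] W x by (simp add: E_def)
  moreover have "\<forall>e\<in>E. card (e \<inter> W) = 1" by (auto simp: E_def semibip_edges_def)
  ultimately show ?thesis using that W by blast
qed

text \<open>A set of three elements whose image is an edge is mapped injectively, so pulling back preserves freeness.\<close>

definition pullback :: "'b set \<Rightarrow> ('b \<Rightarrow> 'a) \<Rightarrow> 'a set set \<Rightarrow> 'b set set" where
  "pullback U f E = {e. e \<subseteq> U \<and> card e = 3 \<and> f ` e \<in> E}"

lemma (in f32_free) pullback_free: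
  assumes "finite U" shows "f32_free U (pullback U f E)"
proof
  fix a b c d e
  assume "{a, b, c} \<in> pullback U f E" "{a, b, d} \<in> pullback U f E"
    "{a, b, e} \<in> pullback U f E" "{c, d, e} \<in> pullback U f E"
  then show False using free[of "f a" "f b" "f c" "f d" "f e"] by (simp add: pullback_def)
qed (use assms in \<open>auto simp: pullback_def\<close>)

section \<open>The Turan problem for a single copy\<close>

context f32_free
begin

text \<open>Replace \<open>w\<close> by a clone of \<open>u\<close>.\<close>

lemma deg_difference:
  assumes ext: "\<And>E'. f32_free V E' \<Longrightarrow> card E' \<le> card E" and uw: "u \<in> V" "w \<in> V"
  shows "deg u \<le> deg w + card V"
proof (cases "u = w")
  case False
  define f where "f x = (if x = w then u else x)" for x
  let ?E' = "pullback V f E"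
  let ?R = "{e\<in>E. w \<notin> e}" and ?U = "{e\<in>E. u \<in> e \<and> w \<notin> e}"
  define g where "g e = insert w (e - {u})" for e
  have fe: "f ` e = e" if "w \<notin> e" for e
  proof -
    have "f ` e = (\<lambda>x. x) ` e" using that by (intro image_cong) (auto simp: f_def)
    then show ?thesis by simp
  qed
  have R: "?R \<subseteq> ?E'"
  proof
    fix e assume e: "e \<in> ?R"
    then show "e \<in> ?E'" using uniform[of e] fe[of e] by (simp add: pullback_def)
  qed
  have U: "g ` ?U \<subseteq> ?E'"
  proof
    fix e' assume "e' \<in> g ` ?U"
    then obtain e where e: "e \<in> E" "u \<in> e" "w \<notin> e" "e' = g e" by auto
    have "finite e" using uniform[OF e(1)] by (metis card.infinite zero_neq_numeral)
    then have "card e' = 3" using e uniform[OF e(1)] by (simp add: g_def card_Diff_singleton)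
    moreover have "f ` e' = e"
    proof -
      have "f w = u" by (simp add: f_def)
      then have "f ` e' = insert u (f ` (e - {u}))" by (simp only: e(4) g_def image_insert)
      also have "f ` (e - {u}) = e - {u}" using e by (intro fe) auto
      finally show ?thesis using e(2) by auto
    qed
    ultimately show "e' \<in> ?E'" using e uw uniform[OF e(1)] by (auto simp: pullback_def g_def)
  qed
  have inj: "inj_on g ?U"
  proof (rule inj_onI)
    fix e e' assume "e \<in> ?U" "e' \<in> ?U" "g e = g e'"
    then have "insert u (g e - {w}) = e" "insert u (g e' - {w}) = e'" by (auto simp: g_def)
    with \<open>g e = g e'\<close> show "e = e'" by metis
  qed
  have "card (?R \<union> g ` ?U) \<le> card ?E'"
  proof (rule card_mono)
    have "triple_system V ?E'" using pullback_free[OF fin] by (rule f32_free.axioms(1))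
    then show "finite ?E'" by (rule triple_system.finite_E)
    show "?R \<union> g ` ?U \<subseteq> ?E'" using R U by (rule Un_least)
  qed
  also have "\<dots> \<le> card E" by (rule ext[OF pullback_free[OF fin]])
  finally have "card (?R \<union> g ` ?U) \<le> card E" .
  moreover have "card (?R \<union> g ` ?U) = card ?R + card (g ` ?U)"
    using finite_E by (intro card_Un_disjoint) (auto simp: g_def)
  moreover have "card (g ` ?U) = card ?U" using inj by (rule card_image)
  moreover have "card E = card ?R + deg w"
  proof -
    have "E = ?R \<union> {e\<in>E. w \<in> e}" by auto
    moreover have "card (?R \<union> {e\<in>E. w \<in> e}) = card ?R + card {e\<in>E. w \<in> e}"
      using finite_E by (intro card_Un_disjoint) auto
    ultimately show ?thesis by (simp add: deg_def)
  qed
  \<comment> \<open>Only edges through both \<open>u\<close> and \<open>w\<close> are not inherited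
    by the clone; they make up the error term \<open>card V\<close>.\<close>
  moreover have "deg u \<le> card ?U + card V"
  proof -
    have "card {e\<in>E. u \<in> e \<and> w \<in> e} \<le> card V" using False by (rule card_pair_le)
    moreover have "deg u \<le> card ?U + card {e\<in>E. u \<in> e \<and> w \<in> e}"
      unfolding deg_def using finite_E
      by (intro order_trans[OF card_mono card_Un_le]) auto
    ultimately show ?thesis by simp
  qed
  ultimately show ?thesis by simp
qed simp

lemma turan_min_degree:
  assumes "1000 \<le> card V" "\<And>v. v \<in> V \<Longrightarrow> (4/9 - 1/10^24) * (real (card V))\<^sup>2 \<le> deg2 v"
  shows "card E \<le> max_semibip (card V)" and "card E = max_semibip (card V) \<Longrightarrow> \<exists>W\<subseteq>V. \<forall>e\<in>E. card (e \<inter> W) = 1"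
proof -
  let ?I = "{I. indep I}"
  have "?I \<subseteq> Pow V" by (auto simp: indep_def)
  then have "finite ?I" using fin by (simp add: finite_subset)
  moreover have "indep {}" using uniform by (fastforce simp: indep_def)
  ultimately obtain A where "A \<in> ?I" "Max (card ` ?I) = card A"
    using obtains_MAX[of ?I card] by blast
  then have A: "indep A" "indep I \<Longrightarrow> card I \<le> card A" for I
    using Max_ge[of "card ` ?I" "card I"] \<open>finite ?I\<close> by auto
  interpret dense_f32_free V E A "(4/9 - 1/10^24) * (real (card V))\<^sup>2"
    using A assms by unfold_locales auto
  have VV: "card V = card V1 + card V2" using V_parts fin_parts by (metis card_Un_disjoint)
  have eq: "real (card V1 * (card V2 choose 2)) * 2 = real (card V1) * real (card V2) * (real (card V2) - 1)"
    by (simp add: choose_two_real)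
  have "(\<Sum>y\<in>V2. real (card (P y))) \<ge> 0" by (simp add: sum_nonneg)
  then have "real (card E) \<le> real (card V1 * (card V2 choose 2))" using card_E_le eq by linarith
  then have 1: "card E \<le> card V1 * (card V2 choose 2)" by (simp only: of_nat_le_iff)
  also have 2: "\<dots> \<le> max_semibip (card V)" using max_semibip_ge[of "card V1" "card V"] VV by simp
  finally show "card E \<le> max_semibip (card V)" .
  show "\<exists>W\<subseteq>V. \<forall>e\<in>E. card (e \<inter> W) = 1" if "card E = max_semibip (card V)"
  proof -
    have "card E = card V1 * (card V2 choose 2)" using that 1 2 by simp
    then have "real (card E) = real (card V1 * (card V2 choose 2))" by (simp only:)
    with eq have "real (card V1) * real (card V2) * (real (card V2) - 1) \<le> 2 * real (card E)"
      by linarith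
    then show ?thesis using extremal_semibipartite V_parts(1) by blast
  qed
qed

end

lemma turan_extremal:
  assumes "f32_free V E" and ext: "\<And>E'. f32_free V E' \<Longrightarrow> card E' \<le> card E" and large: "10^25 \<le> card V"
  shows "card E \<le> max_semibip (card V)" and "card E = max_semibip (card V) \<Longrightarrow> \<exists>W\<subseteq>V. \<forall>e\<in>E. card (e \<inter> W) = 1"
proof -
  interpret f32_free V E by fact
  let ?n = "real (card V)"
  have n: "10^25 \<le> ?n" using large by (metis of_nat_le_iff of_nat_numeral of_nat_power)
  have E: "max_semibip (card V) \<le> card E" using exists_semibip[OF fin] ext by metis
  have V: "V \<noteq> {}" using n by auto
  obtain u where u: "u \<in> V" "6 * real (card E) \<le> ?n * deg2 u"
  proof -
    have "\<exists>u\<in>V. 6 * real (card E) / ?n \<le> deg2 u"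
    proof (rule ccontr)
      assume "\<not> ?thesis"
      then have "(\<Sum>v\<in>V. deg2 v) < (\<Sum>v\<in>V. 6 * real (card E) / ?n)"
        using V fin by (intro sum_strict_mono) auto
      then show False using sum_deg2 V fin by simp
    qed
    then show thesis using that V fin by (auto simp: field_simps card_gt_0_iff)
  qed
  have low: "(4/9 - 1/10^24) * ?n\<^sup>2 \<le> deg2 w" if w: "w \<in> V" for w
  proof -
    have "6 * (2/27 * ?n ^ 3 - ?n\<^sup>2/9 - ?n) \<le> 6 * real (card E)" using max_semibip_lower[of "card V"] E by simp
    also have "\<dots> \<le> ?n * deg2 u" by (rule u(2))
    finally have "?n * (4/9 * ?n\<^sup>2 - 2/3 * ?n - 6) \<le> ?n * deg2 u"
      by (simp add: power2_eq_square power3_eq_cube algebra_simps)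
    then have "4/9 * ?n\<^sup>2 - 2/3 * ?n - 6 \<le> deg2 u" using n by simp
    moreover have "deg2 u \<le> deg2 w + 2 * ?n"
      using deg_difference[OF ext u(1) w] by (simp add: deg2_eq)
    \<comment> \<open>With this size, \<open>n^2/10^24\<close> is at least \<open>10 * n\<close> and
      covers the losses \<open>2/3 * n + 6\<close> from averaging and \<open>2 * n\<close> from
      cloning.\<close>
    moreover have "10^25 * ?n \<le> ?n\<^sup>2" using n by (simp add: power2_eq_square)
    ultimately show ?thesis using n by (simp add: algebra_simps)
  qed
  have big: "1000 \<le> card V" using large by simp
  show "card E \<le> max_semibip (card V)" "card E = max_semibip (card V) \<Longrightarrow> \<exists>W\<subseteq>V. \<forall>e\<in>E. card (e \<inter> W) = 1"
    using turan_min_degree[OF big low] by blast+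
qed

text \<open>Cloning gives regularity only in a maximum system, so the bound is first applied to such
  an \<open>M\<close>. A system reaching the bound is then maximum itself and inherits the
  structure.\<close>

theorem turan_f32:
  assumes "f32_free V E" and large: "10^25 \<le> card V"
  shows "card E \<le> max_semibip (card V)" and "card E = max_semibip (card V) \<Longrightarrow> \<exists>W\<subseteq>V. \<forall>e\<in>E. card (e \<inter> W) = 1"
proof -
  interpret f32_free V E by fact
  let ?F = "{E'. f32_free V E'}"
  have "?F \<subseteq> Pow (Pow V)"
    by (auto simp: f32_free_def triple_system_def)
  then have "finite ?F" using fin by (simp add: finite_subset)
  then obtain M where "M \<in> ?F" "Max (card ` ?F) = card M"
    using obtains_MAX[of ?F card] assms(1) by blast
  then have M: "f32_free V M" "f32_free V E' \<Longrightarrow> card E' \<le> card M" for E'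
    using Max_ge[of "card ` ?F" "card E'"] \<open>finite ?F\<close> by auto
  have M_le: "card M \<le> max_semibip (card V)" by (rule turan_extremal(1)[OF M large])
  show le: "card E \<le> max_semibip (card V)" using M(2)[OF assms(1)] M_le by simp
  show "\<exists>W\<subseteq>V. \<forall>e\<in>E. card (e \<inter> W) = 1" if "card E = max_semibip (card V)"
  proof (rule turan_extremal(2)[OF assms(1) _ large that])
    fix E' assume "f32_free V E'"
    then show "card E' \<le> card E" using M(2)[of E'] M_le that by simp
  qed
qed

section \<open>Blow-ups, deletions and copies\<close>

context f32_free
begin

lemma blow_up_edges:
  fixes U :: "'a set"
  assumes U: "finite U" "U \<inter> V = {}" and v: "v \<in> V"
  shows "card E + card U * deg v \<le> card (pullback (V \<union> U) (\<lambda>x. if x \<in> U then v else x) E)"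
proof -
  let ?f = "\<lambda>x. if x \<in> U then v else x"
  let ?E' = "pullback (V \<union> U) ?f E"
  let ?D = "{e\<in>E. v \<in> e}"
  define g where "g = (\<lambda>(x, e). insert x (e - {v}))"
  have fe: "?f ` e = e" if "e \<subseteq> V" for e
  proof -
    have "?f ` e = (\<lambda>x. x) ` e" using that U by (intro image_cong) auto
    then show ?thesis by simp
  qed
  have sub1: "E \<subseteq> ?E'"
  proof
    fix e assume e: "e \<in> E"
    then show "e \<in> ?E'" using uniform[OF e] fe[of e] by (auto simp only: pullback_def)
  qed
  have sub2: "g ` (U \<times> ?D) \<subseteq> ?E'"
  proof
    fix e' assume "e' \<in> g ` (U \<times> ?D)"
    then obtain x e where e: "x \<in> U" "e \<in> E" "v \<in> e" "e' = insert x (e - {v})" by (auto simp: g_def)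
    have eV: "e \<subseteq> V" "card e = 3" using uniform[OF e(2)] by auto
    have "finite e" using eV fin finite_subset by blast
    moreover have "x \<notin> e" using eV(1) e(1) U(2) by blast
    ultimately have "card e' = 3" using e eV by (simp add: card_Diff_singleton)
    moreover have "?f ` e' = e"
    proof -
      have "?f ` e' = insert (?f x) (?f ` (e - {v}))" by (simp only: e(4) image_insert)
      also have "?f ` (e - {v}) = e - {v}" using eV by (intro fe) auto
      also have "?f x = v" using e(1) by simp
      finally show ?thesis using e(3) by auto
    qed
    moreover have "e' \<subseteq> V \<union> U" using e eV by auto
    ultimately show "e' \<in> ?E'" using e(2) by (simp only: pullback_def mem_Collect_eq)
  qed
  have inj: "inj_on g (U \<times> ?D)"
  proof (rule inj_onI, clarify)
    fix x e y d
    assume xy: "x \<in> U" "e \<in> E" "v \<in> e" "y \<in> U" "d \<in> E" "v \<in> d" and eq: "g (x, e) = g (y, d)"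
    have "e \<subseteq> V" "d \<subseteq> V" using uniform xy by blast+
    then have "insert x (e - {v}) \<inter> U = {x}" "insert y (d - {v}) \<inter> U = {y}"
      "insert v (insert x (e - {v}) - U) = e" "insert v (insert y (d - {v}) - U) = d"
      using xy U(2) v by blast+
    then show "x = y \<and> e = d" using eq unfolding g_def by (metis (no_types, lifting) case_prod_conv singleton_inject)
  qed
  have disj: "E \<inter> g ` (U \<times> ?D) = {}"
  proof -
    have "\<not> e' \<subseteq> V" if "e' \<in> g ` (U \<times> ?D)" for e' using that U(2) by (auto simp: g_def)
    then show ?thesis using uniform by blast
  qed
  have finD: "finite ?D" using finite_E by simp
  have "card E + card U * deg v = card (E \<union> g ` (U \<times> ?D))"
    using card_Un_disjoint[OF finite_E _ disj] finD U(1) card_image[OF inj]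
    by (simp add: deg_def card_cartesian_product)
  also have "\<dots> \<le> card ?E'"
  proof (rule card_mono)
    have "triple_system (V \<union> U) ?E'"
      by (rule f32_free.axioms(1)[OF pullback_free]) (use fin U in auto)
    then show "finite ?E'" by (rule triple_system.finite_E)
    show "E \<union> g ` (U \<times> ?D) \<subseteq> ?E'" using sub1 sub2 by (rule Un_least)
  qed
  finally show ?thesis .
qed

end

text \<open>After division by \<open>m\<close>, the missing edges cost at most 21/10000 and the
  higher terms of the cube at most \<open>1/90 + 1/5400\<close>, below 14/1000 in all. A smaller
  \<open>m\<close> would inflate the first error, a larger one the second.\<close>

lemma degree_bound_real:
  fixes n m d e :: real
  assumes n: "1000 \<le> n" and m: "n/21 \<le> m" "m \<le> n/20"
    and e: "(2/27 - 1/10000) * n^3 \<le> e"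
    and le: "e + m * d \<le> 2/27 * (n + m)^3"
  shows "d \<le> (2/9 + 14/1000) * n\<^sup>2"
proof -
  have m0: "0 < m" using n m by linarith
  have "n^3 \<le> (21 * m) * n\<^sup>2"
    using mult_right_mono[of n "21 * m" "n\<^sup>2"] m by (simp add: power2_eq_square power3_eq_cube)
  then have "m * d \<le> 2/27 * ((n + m)^3 - n^3) + 21/10000 * (m * n\<^sup>2)"
    using le e by (simp add: algebra_simps)
  also have "\<dots> = m * (2/27 * (3 * n\<^sup>2 + 3 * n * m + m\<^sup>2) + 21/10000 * n\<^sup>2)"
    by (simp add: power2_eq_square power3_eq_cube algebra_simps)
  finally have "d \<le> 2/27 * (3 * n\<^sup>2 + 3 * n * m + m\<^sup>2) + 21/10000 * n\<^sup>2"
    using m0 by (meson mult_le_cancel_left_pos)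
  moreover have "n * m \<le> n\<^sup>2/20" using mult_left_mono[of m "n/20" n] m n by (simp add: power2_eq_square)
  moreover have "m\<^sup>2 \<le> n\<^sup>2/400" using power_mono[of m "n/20" 2] m m0 by (simp add: power_divide)
  moreover have "0 \<le> n\<^sup>2" by simp
  moreover have "3 * n * m = 3 * (n * m)" by simp
  ultimately show ?thesis unfolding distrib_left distrib_right by linarith
qed

text \<open>Otherwise blowing up \<open>v\<close> by about a twentieth of the vertices would break
  the Turan bound on the larger set. Infinity of the type supplies the new vertices.\<close>

lemma degree_bound:
  fixes V :: "'a set"
  assumes inf: "infinite (UNIV :: 'a set)" and "f32_free V E" and large: "10^25 \<le> card V"
    and e: "(2/27 - 1/10000) * real (card V)^3 \<le> real (card E)" and v: "v \<in> V"
  shows "real (triple_system.deg E v) \<le> (2/9 + 14/1000) * (real (card V))\<^sup>2"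
proof -
  interpret f32_free V E by fact
  define m where "m = card V div 20"
  have "infinite (UNIV - V)" using inf fin by (simp add: Diff_infinite_finite)
  then obtain U where U: "finite U" "card U = m" "U \<subseteq> UNIV - V"
    using infinite_arbitrarily_large by blast
  have UV: "U \<inter> V = {}" using U by auto
  let ?E' = "pullback (V \<union> U) (\<lambda>x. if x \<in> U then v else x) E"
  have cVU: "card (V \<union> U) = card V + m" using U fin UV by (simp add: card_Un_disjoint Int_commute)
  have "f32_free (V \<union> U) ?E'" using fin U by (intro pullback_free) auto
  then have "card ?E' \<le> max_semibip (card V + m)" using turan_f32(1)[of "V \<union> U" ?E'] large cVU by simp
  with blow_up_edges[OF U(1) UV v] have "card E + m * deg v \<le> max_semibip (card V + m)"
    using U by simp
  then have "real (card E + m * deg v) \<le> real (max_semibip (card V + m))" by (simp only: of_nat_le_iff)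
  also have "\<dots> \<le> 2/27 * real (card V + m)^3" by (rule max_semibip_upper)
  finally have "real (card E) + real m * real (deg v) \<le> 2/27 * (real (card V) + real m)^3" by simp
  moreover have "1000 \<le> real (card V)" using large by simp
  moreover have "real (card V) / 21 \<le> real m" "real m \<le> real (card V) / 20"
  proof -
    have "card V = 20 * m + card V mod 20" by (simp add: m_def)
    moreover have "card V mod 20 < 20" by simp
    ultimately have "real (card V) \<le> 20 * real m + 20" "20 * real m \<le> real (card V)" by linarith+
    then show "real (card V) / 21 \<le> real m" "real m \<le> real (card V) / 20"
      using \<open>1000 \<le> real (card V)\<close> by linarith+
  qed
  ultimately show ?thesis using e degree_bound_real by blast
qed

section \<open>Deleting vertices, and copies as vertex sets\<close>

context triple_system
begin

definition restr :: "'a set \<Rightarrow> 'a set set" where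
  "restr W = {e\<in>E. e \<subseteq> W}"

lemma restr_triple_system: "W \<subseteq> V \<Longrightarrow> triple_system W (restr W)"
  using uniform finite_subset[OF _ fin] by unfold_locales (auto simp: restr_def)

lemma card_restr_ge: "W \<subseteq> V \<Longrightarrow> card E \<le> card (restr (V - W)) + (\<Sum>w\<in>W. deg w)"
proof -
  assume W: "W \<subseteq> V"
  have finW: "finite W" using finite_subset[OF W fin] .
  have "E \<subseteq> restr (V - W) \<union> (\<Union>w\<in>W. {e\<in>E. w \<in> e})"
  proof
    fix e assume e: "e \<in> E"
    have "e \<subseteq> V" using uniform[OF e] by simp
    with e show "e \<in> restr (V - W) \<union> (\<Union>w\<in>W. {e\<in>E. w \<in> e})" unfolding restr_def by blast
  qed
  then have "card E \<le> card (restr (V - W) \<union> (\<Union>w\<in>W. {e\<in>E. w \<in> e}))"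
    using finite_E finW by (intro card_mono) (auto simp: restr_def)
  also have "\<dots> \<le> card (restr (V - W)) + card (\<Union>w\<in>W. {e\<in>E. w \<in> e})" by (rule card_Un_le)
  also have "card (\<Union>w\<in>W. {e\<in>E. w \<in> e}) \<le> (\<Sum>w\<in>W. deg w)"
    unfolding deg_def using finW by (rule card_UN_le)
  finally show ?thesis by simp
qed

lemma deg_le: "2 * deg v \<le> card V * card V"
proof -
  have "deg2 v \<le> (\<Sum>x\<in>V. \<Sum>y\<in>V. 1)" unfolding deg2_def by (intro sum_mono) simp
  then have "2 * real (deg v) \<le> real (card V) * real (card V)" by (simp add: deg2_eq)
  then show ?thesis by (metis of_nat_le_iff of_nat_mult of_nat_numeral)
qed

lemma deg_restr_ge:
  assumes W: "W \<subseteq> V" and v: "v \<notin> W"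
  shows "deg v \<le> triple_system.deg (restr (V - W)) v + card W * card V"
proof -
  have finW: "finite W" using finite_subset[OF W fin] .
  have "{e\<in>E. v \<in> e} \<subseteq> {e\<in>restr (V - W). v \<in> e} \<union> (\<Union>w\<in>W. {e\<in>E. v \<in> e \<and> w \<in> e})"
  proof
    fix e assume e: "e \<in> {e\<in>E. v \<in> e}"
    have "e \<subseteq> V" using uniform[of e] e by simp
    with e show "e \<in> {e\<in>restr (V - W). v \<in> e} \<union> (\<Union>w\<in>W. {e\<in>E. v \<in> e \<and> w \<in> e})"
      unfolding restr_def by blast
  qed
  then have "deg v \<le> card ({e\<in>restr (V - W). v \<in> e} \<union> (\<Union>w\<in>W. {e\<in>E. v \<in> e \<and> w \<in> e}))"
    unfolding deg_def using finite_E finW by (intro card_mono) (auto simp: restr_def)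
  also have "\<dots> \<le> card {e\<in>restr (V - W). v \<in> e} + card (\<Union>w\<in>W. {e\<in>E. v \<in> e \<and> w \<in> e})"
    by (rule card_Un_le)
  also have "card (\<Union>w\<in>W. {e\<in>E. v \<in> e \<and> w \<in> e}) \<le> (\<Sum>w\<in>W. card {e\<in>E. v \<in> e \<and> w \<in> e})"
    using finW by (rule card_UN_le)
  also have "\<dots> \<le> (\<Sum>w\<in>W. card V)" using v by (intro sum_mono card_pair_le) auto
  also have "card {e\<in>restr (V - W). v \<in> e} = triple_system.deg (restr (V - W)) v"
    using restr_triple_system[of "V - W"] by (simp add: triple_system.deg_def)
  finally show ?thesis by simp
qed

text \<open>Only the five vertices are recorded, since disjointness of copies concerns nothing
  else.\<close>

definition copy :: "'a set \<Rightarrow> bool" where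
  "copy S \<longleftrightarrow> (\<exists>a b c d e. S = {a, b, c, d, e} \<and>
     {a, b, c} \<in> E \<and> {a, b, d} \<in> E \<and> {a, b, e} \<in> E \<and> {c, d, e} \<in> E)"

lemma copy_sub: "copy S \<Longrightarrow> S \<subseteq> V"
  unfolding copy_def using edge_verts by fast

lemma copy_card: "copy S \<Longrightarrow> S \<noteq> {} \<and> finite S \<and> card S = 5"
proof -
  assume "copy S"
  then obtain a b c d e where S: "S = {a, b, c, d, e}"
    "{a, b, c} \<in> E" "{a, b, d} \<in> E" "{a, b, e} \<in> E" "{c, d, e} \<in> E" unfolding copy_def by blast
  then show ?thesis
    using edge_distinct[OF S(2)] edge_distinct[OF S(3)] edge_distinct[OF S(4)] edge_distinct[OF S(5)] by auto
qed

lemma restr_free_or_copy: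
  assumes W: "W \<subseteq> V" and no: "\<And>S. copy S \<Longrightarrow> \<not> S \<subseteq> W"
  shows "f32_free W (restr W)"
proof -
  interpret R: triple_system W "restr W" using W by (rule restr_triple_system)
  show ?thesis
  proof
    fix a b c d e
    assume r: "{a, b, c} \<in> restr W" "{a, b, d} \<in> restr W" "{a, b, e} \<in> restr W" "{c, d, e} \<in> restr W"
    then have "copy {a, b, c, d, e}" unfolding copy_def restr_def
      by (intro exI[of _ a] exI[of _ b] exI[of _ c] exI[of _ d] exI[of _ e]) simp
    moreover have "{a, b, c, d, e} \<subseteq> W" using r by (simp add: restr_def)
    ultimately show False using no by blast
  qed
qed

end

section \<open>Disjoint copies\<close>

lemma choose_three_real: "real (m choose 3) = real m * (real m - 1) * (real m - 2) / 6"
proof (induction m)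
  case (Suc m)
  have "Suc m choose 3 = (m choose 2) + (m choose 3)"
    by (simp add: numeral_3_eq_3 numeral_2_eq_2)
  then show ?case using Suc by (simp add: choose_two_real field_simps)
qed simp

text \<open>In units of \<open>n^2\<close>: the \<open>k\<close> vertices not joined to everything
  lose at least \<open>499/1000 * k\<close>. Against this stand \<open>2/9 * k\<close> from the
  larger rest, about \<open>75/1000 * s\<close> from the copies (their 2/9 per vertex cancels
  against the \<open>5 * s\<close> deletions), and \<open>1/9\<close> for rounding in
  \<open>Q\<close>, absorbed by \<open>1 \<le> k\<close>. As \<open>s \<le> k\<close>, these stay
  below \<open>41/100 * k\<close>.\<close>

lemma counting_contradiction:
  fixes n :: real
  assumes n: "1000000 \<le> n" and N: "(1 - 1/1000000) * n \<le> N" "N \<le> n"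
    and k: "1 \<le> k" "k \<le> n/1000000" and s: "0 \<le> s" "s \<le> k"
    and P: "P \<le> 2/27 * (N - 5 * s)^3"
    and Q: "2/27 * (N - k)^3 - (N - k)\<^sup>2/9 - (N - k) \<le> Q"
    and main: "N * (N - 1) * (N - 2) / 6 - (N - k) * (N - k - 1) * (N - k - 2) / 6
      \<le> 5 * s * ((2/9 + 15/1000) * n\<^sup>2) + P - Q"
  shows False
proof -
  define y p where "y = N - k" and "p = N - 5 * s"
  have yb: "(1 - 1/100000) * n \<le> y" "y \<le> n" and pb: "(1 - 1/100000) * n \<le> p" "p \<le> n"
    using N k s by (auto simp: y_def p_def)
  have n0: "0 \<le> n" and k0: "0 \<le> k" using n k by auto
  have y0: "0 \<le> y" and p0: "0 \<le> p" using yb(1) pb(1) n0 by auto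
  have sq: "((1 - 1/100000) * n)\<^sup>2 = (1 - 1/100000)\<^sup>2 * n\<^sup>2" by (rule power_mult_distrib)
  have lo: "9999/10000 * n\<^sup>2 \<le> x * z" if "(1 - 1/100000) * n \<le> x" "(1 - 1/100000) * n \<le> z" for x z
  proof -
    have "9999/10000 * n\<^sup>2 \<le> (1 - 1/100000)\<^sup>2 * n\<^sup>2"
      by (intro mult_right_mono) (auto simp: power2_eq_square)
    also have "\<dots> = ((1 - 1/100000) * n) * ((1 - 1/100000) * n)"
      using sq by (simp only: power2_eq_square)
    also have "\<dots> \<le> x * z" using that n0 by (intro mult_mono) auto
    finally show ?thesis .
  qed
  have hi: "x * z \<le> n\<^sup>2" if "0 \<le> x" "x \<le> n" "0 \<le> z" "z \<le> n" for x z
    unfolding power2_eq_square using that n0 by (intro mult_mono) auto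
  have nn: "1000000 * n \<le> n\<^sup>2" using n by (simp add: power2_eq_square)
  have n2: "0 \<le> n\<^sup>2" by simp
  have left: "k * (499/1000 * n\<^sup>2) \<le> N * (N - 1) * (N - 2) / 6 - (N - k) * (N - k - 1) * (N - k - 2) / 6"
  proof -
    have Ny: "N = y + k" by (simp add: y_def)
    have eq: "N * (N - 1) * (N - 2) / 6 - y * (y - 1) * (y - 2) / 6
        = k * ((N * N + N * y + y * y) / 6 - (N + y) / 2 + 1/3)"
      unfolding Ny by (simp add: field_simps)
    have "499/1000 * n\<^sup>2 \<le> (N * N + N * y + y * y) / 6 - (N + y) / 2 + 1/3"
    proof -
      have Nb: "(1 - 1/100000) * n \<le> N" using N(1) n0 by simp
      define Z where "Z = N * N + N * y + y * y"
      have "29997/10000 * n\<^sup>2 \<le> Z"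
        using lo[OF Nb Nb] lo[OF Nb yb(1)] lo[OF yb(1) yb(1)] by (simp add: Z_def)
      then have "499/1000 * n\<^sup>2 \<le> Z / 6 - (N / 2 + y / 2) + 1/3" using yb(2) N(2) nn n by linarith
      then show ?thesis by (simp only: Z_def add_divide_distrib)
    qed
    then show ?thesis unfolding y_def[symmetric] eq using k0 by (rule mult_left_mono)
  qed
  have cubes: "p^3 - y^3 \<le> k * (3 * n\<^sup>2) - 5 * s * (29997/10000 * n\<^sup>2)"
  proof -
    define q where "q = p * p + p * y + y * y"
    have q: "29997/10000 * n\<^sup>2 \<le> q" "q \<le> 3 * n\<^sup>2"
      using lo[OF pb(1) pb(1)] lo[OF pb(1) yb(1)] lo[OF yb(1) yb(1)]
        hi[OF p0 pb(2) p0 pb(2)] hi[OF p0 pb(2) y0 yb(2)] hi[OF y0 yb(2) y0 yb(2)] by (auto simp: q_def)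
    have "p^3 - y^3 = (p - y) * q" by (simp add: q_def power3_eq_cube algebra_simps)
    also have "\<dots> = k * q - 5 * s * q" by (simp add: y_def p_def algebra_simps)
    also have "\<dots> \<le> k * (3 * n\<^sup>2) - 5 * s * (29997/10000 * n\<^sup>2)"
      using q k0 s(1) by (intro diff_mono mult_left_mono) auto
    finally show ?thesis .
  qed
  have Qb: "2/27 * y^3 - n\<^sup>2/9 - n \<le> Q"
    using Q hi[OF y0 yb(2) y0 yb(2)] yb(2) by (simp add: y_def[symmetric] power2_eq_square)
  define A where "A = k * n\<^sup>2"
  define B where "B = s * n\<^sup>2"
  have BA: "B \<le> A" unfolding A_def B_def using s n2 by (intro mult_right_mono) auto
  have nA: "n\<^sup>2 \<le> A" unfolding A_def using mult_right_mono[OF k(1) n2] by simp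
  have P': "P \<le> 2/27 * p^3" using P by (simp only: p_def)
  have "k * (499/1000 * n\<^sup>2) \<le> 5 * s * ((2/9 + 15/1000) * n\<^sup>2) + P - Q"
    using left main by (rule order_trans)
  moreover have "k * (499/1000 * n\<^sup>2) = 499/1000 * A" "5 * s * ((2/9 + 15/1000) * n\<^sup>2) = 427/360 * B"
    by (simp_all add: A_def B_def)
  moreover have "p^3 - y^3 \<le> 3 * A - 29997/2000 * B" using cubes by (simp add: A_def B_def)
  ultimately show False using P' Qb BA nA nn n by linarith
qed

section \<open>Families of disjoint copies, and triples meeting a set\<close>

context triple_system
begin

definition matching :: "'a set set \<Rightarrow> bool" where
  "matching M \<longleftrightarrow> finite M \<and> (\<forall>S\<in>M. copy S) \<and> (\<forall>S\<in>M. \<forall>S'\<in>M. S \<noteq> S' \<longrightarrow> S \<inter> S' = {})"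

lemma matching_sub: "matching M \<Longrightarrow> \<Union>M \<subseteq> V"
  unfolding matching_def by (intro Union_least copy_sub) simp

lemma matching_card_Union: "matching M \<Longrightarrow> card (\<Union>M) = 5 * card M"
proof -
  assume M: "matching M"
  have "card (\<Union>M) = (\<Sum>S\<in>M. card S)"
    using M copy_card by (intro card_Union_disjoint) (auto simp: matching_def pairwise_def disjnt_def)
  also have "\<dots> = (\<Sum>S\<in>M. 5)" using M copy_card by (intro sum.cong refl) (auto simp: matching_def)
  finally show ?thesis by simp
qed

lemma matching_insert:
  assumes "matching M" "copy S" "S \<inter> \<Union>M = {}"
  shows "matching (insert S M)" "card (insert S M) = card M + 1"
proof -
  have "S \<notin> M" using assms copy_card[of S] by auto
  then show "card (insert S M) = card M + 1" using assms by (simp add: matching_def)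
  show "matching (insert S M)" using assms by (auto simp: matching_def)
qed

lemma matching_subset: "matching M \<Longrightarrow> M' \<subseteq> M \<Longrightarrow> matching M'"
  unfolding matching_def by (meson finite_subset in_mono)

definition meeting :: "'a set \<Rightarrow> 'a set set" where
  "meeting L = {e. e \<subseteq> V \<and> card e = 3 \<and> e \<inter> L \<noteq> {}}"

lemma finite_meeting: "finite (meeting L)"
  using fin by (intro finite_subset[of "meeting L" "Pow V"]) (auto simp: meeting_def)

lemma card_meeting:
  assumes "L \<subseteq> V"
  shows "card (meeting L) + ((card V - card L) choose 3) = card V choose 3"
proof -
  have finL: "finite L" using finite_subset[OF assms fin] .
  let ?T = "{e. e \<subseteq> V \<and> card e = 3}" and ?R = "{e. e \<subseteq> V - L \<and> card e = 3}"
  have un: "?T = meeting L \<union> ?R" and disj: "meeting L \<inter> ?R = {}" by (auto simp: meeting_def)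
  have finR: "finite ?R" using fin by (intro finite_subset[of ?R "Pow V"]) auto
  have "card ?T = card (meeting L) + card ?R"
    unfolding un using finite_meeting finR disj by (rule card_Un_disjoint)
  then show ?thesis
    using n_subsets[OF fin, of 3] n_subsets[of "V - L" 3] fin card_Diff_subset[OF finL assms] by simp
qed

lemma edges_split: "E \<subseteq> meeting L \<union> restr (V - L)"
proof
  fix e assume e: "e \<in> E"
  then show "e \<in> meeting L \<union> restr (V - L)"
    using uniform[OF e] by (auto simp: meeting_def restr_def)
qed

lemma finite_restr: "finite (restr W)"
  using finite_E by (simp add: restr_def)

end

text \<open>\<open>dense\<close> asks for at least the edge number of the join: the two binomials
  differ by the triples meeting a fixed set of \<open>t\<close> vertices. The additive form avoids
  truncated subtraction, and \<open>inf\<close> serves the blow-ups.\<close>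

locale matching_extremal = triple_system V E for V :: "'a set" and E +
  fixes t :: nat
  assumes inf: "infinite (UNIV :: 'a set)"
    and large: "10^30 \<le> card V"
    and t_le: "real t \<le> real (card V) / 10^7"
    and no_matching: "\<And>M. matching M \<Longrightarrow> card M \<noteq> t + 1"
    and dense: "(card V choose 3) + max_semibip (card V - t) \<le> card E + ((card V - t) choose 3)"
begin

abbreviation n :: real where "n \<equiv> real (card V)"

lemma n_large: "10^30 \<le> n"
  using large by (metis of_nat_le_iff of_nat_numeral of_nat_power)

lemma t_le_card: "t \<le> card V"
proof -
  have "real t \<le> n" using t_le n_large by simp
  then show ?thesis by simp
qed

lemma max_semibip_le_E: "max_semibip (card V - t) \<le> card E"
proof -
  have "(card V - t) choose 3 \<le> card V choose 3" by (rule binomial_right_mono) simp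
  then show ?thesis using dense by linarith
qed

lemma dense_edges: "(2/27 - 5/100000) * n^3 \<le> real (card E)"
proof -
  define m where "m = real (card V - t)"
  have m: "m = n - real t" using t_le_card by (simp add: m_def)
  have mb: "(1 - 1/10000000) * n \<le> m" "m \<le> n" using t_le by (auto simp: m)
  have n0: "0 \<le> n" by simp
  have "(1 - 1/10000000)^3 * n^3 \<le> m^3"
    using power_mono[OF mb(1), of 3] by (simp only: power_mult_distrib) simp
  moreover have "(1 - 3/1000000) * n^3 \<le> (1 - 1/10000000)^3 * n^3"
    by (intro mult_right_mono) (auto simp: power3_eq_cube)
  ultimately have m3: "(1 - 3/1000000) * n^3 \<le> m^3" by linarith
  have m2: "m\<^sup>2 \<le> n\<^sup>2" using mb n_large t_le by (intro power_mono) (auto simp: m_def)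
  have n3: "1000000 * n\<^sup>2 \<le> n^3" "n \<le> n\<^sup>2"
    using n_large mult_right_mono[of 1000000 n "n\<^sup>2"] mult_right_mono[of 1 n n]
    by (auto simp: power3_eq_cube power2_eq_square)
  have "2/27 * m^3 - m\<^sup>2/9 - m \<le> real (card E)"
    using max_semibip_lower[of "card V - t"] max_semibip_le_E by (simp add: m_def)
  then show ?thesis using m3 m2 mb(2) n3 unfolding left_diff_distrib by linarith
qed

lemma sum_deg_le: "finite W \<Longrightarrow> 2 * (\<Sum>w\<in>W. deg w) \<le> card W * (card V * card V)"
  using sum_mono[of W "\<lambda>w. 2 * deg w" "\<lambda>_. card V * card V"] deg_le
  by (simp add: sum_distrib_left)

text \<open>The copy need not contain \<open>v\<close>, whose degree only shows, through
  \<open>degree_bound\<close>, that \<open>V - W\<close> is not free. Deleting \<open>W\<close>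
  costs \<open>v\<close> at most \<open>n^2/100000\<close>, less than the gap between 15/1000 and
  14/1000.\<close>

lemma find_copy:
  assumes W: "W \<subseteq> V" "real (card W) \<le> n / 100000"
    and v: "v \<in> V" "v \<notin> W" "(2/9 + 15/1000) * n\<^sup>2 \<le> real (deg v)"
  obtains S where "copy S" "S \<inter> W = {}"
proof -
  have "\<exists>S. copy S \<and> S \<subseteq> V - W"
  proof (rule ccontr)
    assume "\<not> ?thesis"
    then have free: "f32_free (V - W) (restr (V - W))" by (intro restr_free_or_copy) auto
    have finW: "finite W" using finite_subset[OF W(1) fin] .
    define w where "w = real (card W)"
    define n' where "n' = real (card (V - W))"
    have n': "n' = n - w"
      using card_Diff_subset[OF finW W(1)] card_mono[OF fin W(1)] by (simp add: n'_def w_def of_nat_diff)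
    have w: "0 \<le> w" "w \<le> n / 100000" using W(2) by (auto simp: w_def)
    have n2: "0 \<le> n\<^sup>2" and n0: "0 \<le> n" by auto
    have n'b: "0 \<le> n'" by (simp add: n'_def)
    have n'n: "n' \<le> n" using w unfolding n' by linarith
    have large': "10^25 \<le> card (V - W)"
    proof -
      have "10^25 \<le> n'" using w n_large unfolding n' by simp
      then have "real (10^25) \<le> real (card (V - W))" by (simp add: n'_def)
      then show ?thesis by (simp only: of_nat_le_iff)
    qed
    have e': "real (card E) \<le> real (card (restr (V - W))) + w * n\<^sup>2 / 2"
    proof -
      have "real (card E) \<le> real (card (restr (V - W)) + (\<Sum>w\<in>W. deg w))"
        using card_restr_ge[OF W(1)] by (simp only: of_nat_le_iff)
      moreover have "real (2 * (\<Sum>w\<in>W. deg w)) \<le> real (card W * (card V * card V))"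
        using sum_deg_le[OF finW] by (simp only: of_nat_le_iff)
      ultimately show ?thesis by (simp add: w_def power2_eq_square)
    qed
    have "w * n\<^sup>2 \<le> n / 100000 * n\<^sup>2" using w n2 by (intro mult_right_mono)
    then have wn: "w * n\<^sup>2 \<le> n^3 / 100000" by (simp add: power2_eq_square power3_eq_cube)
    have n'3: "n'^3 \<le> n^3" "n'\<^sup>2 \<le> n\<^sup>2" using power_mono[OF n'n n'b] by blast+
    have n3: "0 \<le> n^3" by simp
    have "(2/27 - 1/10000) * n'^3 \<le> (2/27 - 1/10000) * n^3" using n'3 by simp
    then have "(2/27 - 1/10000) * n'^3 \<le> real (card (restr (V - W)))"
      using e' wn dense_edges n3 unfolding left_diff_distrib by linarith
    from degree_bound[OF inf free large' this[unfolded n'_def], of v] v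
    have "real (triple_system.deg (restr (V - W)) v) \<le> (2/9 + 14/1000) * n'\<^sup>2"
      by (simp add: n'_def)
    also have "\<dots> \<le> (2/9 + 14/1000) * n\<^sup>2" using n'3 by simp
    finally have "real (triple_system.deg (restr (V - W)) v) \<le> (2/9 + 14/1000) * n\<^sup>2" .
    moreover have "real (deg v) \<le> real (triple_system.deg (restr (V - W)) v + card W * card V)"
      using deg_restr_ge[OF W(1) v(2)] by (simp only: of_nat_le_iff)
    moreover have "w * n \<le> n\<^sup>2/100000" using mult_right_mono[OF w(2) n0] by (simp add: power2_eq_square)
    moreover have "0 < n\<^sup>2" using n_large by simp
    ultimately show False using v(3) unfolding w_def distrib_right of_nat_add of_nat_mult by linarith
  qed
  then show thesis using that by blast
qed

lemma small_card: "real (6 * (t + 1)) \<le> n / 100000"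
  using t_le n_large by simp

text \<open>Each step avoids the vertices of \<open>M\<close> and also those of \<open>R\<close>
  still waiting, which keep their turn. This set has at most \<open>5 * card M + card R\<close>,
  hence at most \<open>6 * (t + 1)\<close>, elements.\<close>

lemma greedy:
  assumes "finite R" "R \<subseteq> V" "\<And>v. v \<in> R \<Longrightarrow> (2/9 + 15/1000) * n\<^sup>2 \<le> real (deg v)"
    and "matching M" "\<Union>M \<inter> R = {}" "card M + card R \<le> t + 1"
  shows "\<exists>M'. matching M' \<and> card M' = card M + card R"
  using assms
proof (induction R arbitrary: M rule: finite_induct)
  case empty
  then show ?case by auto
next
  case (insert v R)
  let ?W = "\<Union>M \<union> R"
  have WV: "?W \<subseteq> V" using matching_sub insert.prems by auto
  have "card ?W \<le> card (\<Union>M) + card R" by (rule card_Un_le)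
  also have "\<dots> = 5 * card M + card R" using matching_card_Union insert.prems by simp
  also have "\<dots> \<le> 6 * (t + 1)" using insert by simp
  finally have "real (card ?W) \<le> real (6 * (t + 1))" by (simp only: of_nat_le_iff)
  then have W: "real (card ?W) \<le> n / 100000" using small_card by linarith
  have v: "v \<in> V" "v \<notin> ?W" "(2/9 + 15/1000) * n\<^sup>2 \<le> real (deg v)" using insert by auto
  obtain S where S: "copy S" "S \<inter> ?W = {}" using find_copy[OF WV W v] by blast
  have M': "matching (insert S M)" "card (insert S M) = card M + 1"
    using matching_insert[of M S] S insert.prems by blast+
  have "\<exists>M'. matching M' \<and> card M' = card (insert S M) + card R"
  proof (rule insert.IH)
    show "R \<subseteq> V" using insert.prems by auto
    show "\<And>v. v \<in> R \<Longrightarrow> (2/9 + 15/1000) * n\<^sup>2 \<le> real (deg v)" using insert.prems by auto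
    show "matching (insert S M)" by fact
    show "\<Union> (insert S M) \<inter> R = {}" using S insert.prems by blast
    show "card (insert S M) + card R \<le> t + 1" using M' insert by simp
  qed
  then show ?case using M' insert.hyps by simp
qed

definition L :: "'a set" where
  "L = {v\<in>V. (2/9 + 15/1000) * n\<^sup>2 \<le> real (deg v)}"

lemma L_sub: "L \<subseteq> V" by (auto simp: L_def)
lemma fin_L: "finite L" using finite_subset[OF L_sub fin] .

lemma matching_plus_L:
  assumes "matching M" "\<Union>M \<inter> L = {}"
  shows "card M + card L \<le> t"
proof (rule ccontr)
  assume neg: "\<not> ?thesis"
  have finM: "finite M" using assms by (simp add: matching_def)
  \<comment> \<open>\<open>L\<close> alone may have more than \<open>t + 1\<close> vertices; then
    \<open>r\<close> cuts it down and \<open>M0\<close> is empty. Otherwise \<open>M0\<close> fills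
    up to exactly \<open>t + 1\<close>.\<close>
  define r where "r = min (card L) (t + 1)"
  obtain R where R: "R \<subseteq> L" "card R = r" using obtain_subset_with_card_n[of r L] by (auto simp: r_def)
  have "t + 1 - r \<le> card M" using neg by (auto simp: r_def)
  then obtain M0 where M0: "M0 \<subseteq> M" "card M0 = t + 1 - r" by (rule obtain_subset_with_card_n)
  have "\<exists>M'. matching M' \<and> card M' = card M0 + card R"
  proof (rule greedy)
    show "finite R" using finite_subset[OF R(1) fin_L] .
    show "R \<subseteq> V" using R L_sub by auto
    show "\<And>v. v \<in> R \<Longrightarrow> (2/9 + 15/1000) * n\<^sup>2 \<le> real (deg v)" using R by (auto simp: L_def)
    show "matching M0" using matching_subset[OF assms(1) M0(1)] .
    show "\<Union>M0 \<inter> R = {}" using assms(2) M0 R by blast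
    show "card M0 + card R \<le> t + 1" using M0 R by (simp add: r_def)
  qed
  moreover have "card M0 + card R = t + 1" using M0 R by (simp add: r_def)
  ultimately show False using no_matching by auto
qed

lemma exists_max_matching:
  obtains M where "matching M" "\<Union>M \<inter> L = {}" "f32_free (V - L - \<Union>M) (restr (V - L - \<Union>M))"
proof -
  let ?P = "\<lambda>M. matching M \<and> \<Union>M \<inter> L = {}"
  have "?P {}" by (simp add: matching_def)
  moreover have "\<forall>M. ?P M \<longrightarrow> card M < t + 1"
    using matching_plus_L by fastforce
  ultimately obtain M where M: "?P M" "\<And>M'. ?P M' \<Longrightarrow> card M' \<le> card M"
    using ex_has_greatest_nat[of ?P "{}" card "t + 1"] by blast
  have "f32_free (V - L - \<Union>M) (restr (V - L - \<Union>M))"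
  proof (rule restr_free_or_copy)
    show "V - L - \<Union>M \<subseteq> V" by blast
    show "\<not> S \<subseteq> V - L - \<Union>M" if "copy S" for S
    proof
      assume sub: "S \<subseteq> V - L - \<Union>M"
      have "S \<inter> \<Union>M = {}" using sub by blast
      note ins = matching_insert[OF conjunct1[OF M(1)] that this]
      have "\<Union>(insert S M) \<inter> L = {}" using sub M(1) by auto
      then have "card (insert S M) \<le> card M" using M(2) ins(1) by blast
      then show False using ins(2) by simp
    qed
  qed
  then show thesis using that M(1) by blast
qed

text \<open>Every edge meets \<open>L\<close>, or meets one of the \<open>5 * s\<close> low-degree
  vertices of \<open>M\<close>, or lies in a free rest. If \<open>L\<close> had fewer than
  \<open>t\<close> vertices, this would contradict \<open>dense\<close>. With
  \<open>card L = t\<close>, the bound \<open>s + l \<le> t\<close> empties \<open>M\<close>, and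
  upper and lower bounds coincide, so every estimate is an equality.\<close>

lemma extremal_decomposition:
  shows "card L = t" "E = meeting L \<union> restr (V - L)" "card E = card (meeting L) + max_semibip (card V - t)"
    "card (restr (V - L)) = max_semibip (card V - t)" "\<exists>W\<subseteq>V - L. \<forall>e\<in>restr (V - L). card (e \<inter> W) = 1"
proof -
  obtain M where M: "matching M" "\<Union>M \<inter> L = {}" "f32_free (V - L - \<Union>M) (restr (V - L - \<Union>M))"
    by (rule exists_max_matching)
  let ?U = "\<Union>M"
  define s where "s = card M"
  define l where "l = card L"
  have sl: "s + l \<le> t" using matching_plus_L[OF M(1,2)] by (simp add: s_def l_def)
  have U: "?U \<subseteq> V - L" using matching_sub[OF M(1)] M(2) by blast
  have finU: "finite ?U" using finite_subset[OF matching_sub[OF M(1)] fin] .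
  have cU: "card ?U = 5 * s" using matching_card_Union[OF M(1)] by (simp add: s_def)
  have cVL: "card (V - L) = card V - l" using card_Diff_subset[OF fin_L L_sub] by (simp add: l_def)
  have cVLU: "card (V - L - ?U) = card V - l - 5 * s" using card_Diff_subset[OF finU U] cVL cU by simp
  have tn: "real t \<le> n / 10000000" using t_le by simp
  have nl: "1000000 \<le> n" "10^30 \<le> n" using n_large by auto
  have slr: "real s + real l \<le> real t" using sl by linarith
  have le_n: "l + 5 * s \<le> card V"
  proof -
    have "real (l + 5 * s) \<le> n" using slr tn nl by simp
    then show ?thesis by (simp only: of_nat_le_iff)
  qed
  have large': "10^25 \<le> card (V - L - ?U)"
  proof -
    have "10^25 \<le> n - real l - 5 * real s" using slr tn nl by simp
    also have "\<dots> = real (card (V - L - ?U))" using cVLU le_n by (simp add: of_nat_diff)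
    finally have "real (10^25) \<le> real (card (V - L - ?U))" by simp
    then show ?thesis by (simp only: of_nat_le_iff)
  qed
  have free_le: "card (restr (V - L - ?U)) \<le> max_semibip (card V - l - 5 * s)"
    using turan_f32(1)[OF M(3) large'] cVLU by simp
  interpret VL: triple_system "V - L" "restr (V - L)" by (rule restr_triple_system) blast
  have rr: "VL.restr W = restr W" if "W \<subseteq> V - L" for W
    using that unfolding VL.restr_def unfolding restr_def by auto
  have degU: "real (VL.deg w) \<le> (2/9 + 15/1000) * n\<^sup>2" if "w \<in> ?U" for w
  proof -
    have "VL.deg w \<le> deg w" unfolding VL.deg_def deg_def using finite_E
      by (intro card_mono) (auto simp: restr_def)
    moreover have "real (deg w) < (2/9 + 15/1000) * n\<^sup>2" using that U by (auto simp: L_def)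
    ultimately show ?thesis by linarith
  qed
  have part: "real (card (restr (V - L))) \<le> 5 * real s * ((2/9 + 15/1000) * n\<^sup>2) + real (max_semibip (card V - l - 5 * s))"
  proof -
    have "card (restr (V - L)) \<le> card (restr (V - L - ?U)) + (\<Sum>w\<in>?U. VL.deg w)"
      using VL.card_restr_ge[OF U] rr by simp
    then have "real (card (restr (V - L))) \<le> real (card (restr (V - L - ?U))) + (\<Sum>w\<in>?U. real (VL.deg w))"
      by (simp flip: of_nat_sum of_nat_add)
    also have "(\<Sum>w\<in>?U. real (VL.deg w)) \<le> (\<Sum>w\<in>?U. (2/9 + 15/1000) * n\<^sup>2)"
      by (intro sum_mono degU)
    also have "\<dots> = 5 * real s * ((2/9 + 15/1000) * n\<^sup>2)" using cU by simp
    finally show ?thesis using free_le by linarith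
  qed
  have tot: "card E \<le> card (meeting L) + card (restr (V - L))"
    using card_mono[OF _ edges_split, of L] card_Un_le[of "meeting L" "restr (V - L)"]
      finite_meeting[of L] finite_restr by (meson finite_UnI le_trans)
  have meetL: "card (meeting L) + ((card V - l) choose 3) = card V choose 3"
    using card_meeting[OF L_sub] by (simp add: l_def)
  have "l = t"
  proof (rule ccontr)
    assume "l \<noteq> t"
    then have lt: "l < t" using sl by simp
    define N where "N = n - real l"
    define k where "k = real t - real l"
    have Nr: "real (card V - l) = N" "real (card V - t) = N - k" "real (card V - l - 5 * s) = N - 5 * real s"
      using le_n t_le_card by (auto simp: N_def k_def of_nat_diff)
    have meetr: "real (card (meeting L)) + real ((card V - l) choose 3) = real (card V choose 3)"
      using meetL by (metis of_nat_add)
    have denser: "real (card V choose 3) + real (max_semibip (card V - t)) \<le> real (card E) + real ((card V - t) choose 3)"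
      using dense by (metis of_nat_add of_nat_le_iff)
    have totr: "real (card E) \<le> real (card (meeting L)) + real (card (restr (V - L)))"
      using tot by (metis of_nat_add of_nat_le_iff)
    show False
    proof (rule counting_contradiction[of n N k "real s" "real (max_semibip (card V - l - 5 * s))" "real (max_semibip (card V - t))"])
      show "1000000 \<le> n" using nl by simp
      show "(1 - 1/1000000) * n \<le> N" using slr tn nl by (simp add: N_def)
      show "N \<le> n" by (simp add: N_def)
      show "1 \<le> k" using lt by (simp add: k_def)
      show "k \<le> n / 1000000" using tn nl by (simp add: k_def)
      show "0 \<le> real s" by simp
      show "real s \<le> k" using slr by (simp add: k_def)
      show "real (max_semibip (card V - l - 5 * s)) \<le> 2/27 * (N - 5 * real s)^3"
        using max_semibip_upper[of "card V - l - 5 * s"] by (simp only: Nr)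
      show "2/27 * (N - k)^3 - (N - k)\<^sup>2/9 - (N - k) \<le> real (max_semibip (card V - t))"
        using max_semibip_lower[of "card V - t"] by (simp only: Nr)
      have "real ((card V - l) choose 3) = N * (N - 1) * (N - 2) / 6"
        "real ((card V - t) choose 3) = (N - k) * (N - k - 1) * (N - k - 2) / 6"
        by (simp_all only: choose_three_real Nr)
      then show "N * (N - 1) * (N - 2) / 6 - (N - k) * (N - k - 1) * (N - k - 2) / 6
          \<le> 5 * real s * ((2/9 + 15/1000) * n\<^sup>2) + real (max_semibip (card V - l - 5 * s)) - real (max_semibip (card V - t))"
        using meetr denser totr part by linarith
    qed
  qed
  then have "s = 0" using sl by simp
  then have "M = {}" using M(1) by (simp add: s_def matching_def)
  show lt: "card L = t" using \<open>l = t\<close> by (simp add: l_def)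
  have free_le': "card (restr (V - L)) \<le> max_semibip (card V - t)"
    using free_le \<open>M = {}\<close> \<open>s = 0\<close> \<open>l = t\<close> by simp
  have sum_le: "card (meeting L) + max_semibip (card V - t) \<le> card E" using meetL dense \<open>l = t\<close> by simp
  then show restr_eq: "card (restr (V - L)) = max_semibip (card V - t)" using tot free_le' by simp
  show cardE: "card E = card (meeting L) + max_semibip (card V - t)" using sum_le tot restr_eq by simp
  show "E = meeting L \<union> restr (V - L)"
  proof (rule card_subset_eq)
    show "finite (meeting L \<union> restr (V - L))" using finite_meeting finite_restr by simp
    show "E \<subseteq> meeting L \<union> restr (V - L)" by (rule edges_split)
    have "meeting L \<inter> restr (V - L) = {}" by (auto simp: meeting_def restr_def)
    then have "card (meeting L \<union> restr (V - L)) = card (meeting L) + card (restr (V - L))"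
      using finite_meeting finite_restr by (intro card_Un_disjoint)
    then show "card E = card (meeting L \<union> restr (V - L))" using cardE restr_eq by simp
  qed
  have "f32_free (V - L) (restr (V - L))" using M(3) \<open>M = {}\<close> by simp
  moreover have "10^25 \<le> card (V - L)" using large' \<open>M = {}\<close> by simp
  moreover have "card (restr (V - L)) = max_semibip (card (V - L))" using restr_eq cVL \<open>l = t\<close> by simp
  ultimately show "\<exists>W\<subseteq>V - L. \<forall>e\<in>restr (V - L). card (e \<inter> W) = 1" by (rule turan_f32(2))
qed

end

section \<open>The extremal theorem\<close>

lemma three_graph_iff: "three_graph G \<longleftrightarrow> triple_system (verts G) (edges G)"
  by (auto simp: three_graph_def triple_system_def)

lemma F32_iso:
  assumes "distinct [a, b, c, d, e]"
  shows "F32 \<simeq> \<lparr>verts = {a, b, c, d, e}, edges = {{a, b, c}, {a, b, d}, {a, b, e}, {c, d, e}}\<rparr>"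
proof -
  define f where "f i = (if i = 1 then a else if i = 2 then b else if i = 3 then c
    else if i = 4 then d else e)" for i :: nat
  have f: "f 1 = a" "f 2 = b" "f 3 = c" "f 4 = d" "f 5 = e" by (simp_all add: f_def)
  have "inj_on f {1, 2, 3, 4, 5}" using assms unfolding inj_on_def by (auto simp: f_def)
  then have "bij_betw f {1, 2, 3, 4, 5} {a, b, c, d, e}"
    unfolding bij_betw_def by (simp only: image_insert image_empty f)
  then show ?thesis unfolding iso_def F32_def
    by (intro exI[of _ f]) (simp only: hgraph.simps image_insert image_empty f)
qed

lemma F32_iso_copy:
  assumes "subgraph C G" "F32 \<simeq> C" "three_graph G"
  shows "triple_system.copy (edges G) (verts C)"
proof -
  obtain f where f: "bij_betw f (verts F32) (verts C)" "edges C = (\<lambda>e. f ` e) ` edges F32"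
    using assms(2) unfolding iso_def by blast
  have G: "triple_system (verts G) (edges G)" using assms(3) by (simp add: three_graph_iff)
  have verts: "verts C = {f 1, f 2, f 3, f 4, f 5}"
    using f(1) by (simp add: bij_betw_def F32_def)
  have "edges C = {{f 1, f 2, f 3}, {f 1, f 2, f 4}, {f 1, f 2, f 5}, {f 3, f 4, f 5}}"
    using f(2) by (simp only: F32_def hgraph.simps image_insert image_empty)
  then have "{f 1, f 2, f 3} \<in> edges G" "{f 1, f 2, f 4} \<in> edges G" "{f 1, f 2, f 5} \<in> edges G"
    "{f 3, f 4, f 5} \<in> edges G"
    using assms(1) by (auto simp: subgraph_def)
  then show ?thesis unfolding verts triple_system.copy_def[OF G]
    by (intro exI[of _ "f 1"] exI[of _ "f 2"] exI[of _ "f 3"] exI[of _ "f 4"] exI[of _ "f 5"]) simp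
qed

lemma matching_contains:
  assumes "three_graph G" "triple_system.matching (edges G) M" "card M = k"
  shows "contains_disjoint_copies k F32 G"
proof -
  interpret triple_system "verts G" "edges G" using assms(1) by (simp add: three_graph_iff)
  have M: "finite M" "\<And>S. S \<in> M \<Longrightarrow> copy S" "\<And>S S'. S \<in> M \<Longrightarrow> S' \<in> M \<Longrightarrow> S \<noteq> S' \<Longrightarrow> S \<inter> S' = {}"
    using assms(2) unfolding matching_def by blast+
  obtain h where h: "bij_betw h {0..<k} M" using ex_bij_betw_nat_finite[OF M(1)] assms(3) by blast
  have "\<exists>C. subgraph C G \<and> F32 \<simeq> C \<and> verts C = S" if cp: "copy S" for S
  proof -
    obtain a b c d e where S: "S = {a, b, c, d, e}"
      "{a, b, c} \<in> edges G" "{a, b, d} \<in> edges G" "{a, b, e} \<in> edges G" "{c, d, e} \<in> edges G"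
      using cp unfolding copy_def by blast
    have dist: "distinct [a, b, c, d, e]"
      using edge_distinct[OF S(2)] edge_distinct[OF S(3)] edge_distinct[OF S(4)] edge_distinct[OF S(5)] by auto
    let ?C = "\<lparr>verts = {a, b, c, d, e}, edges = {{a, b, c}, {a, b, d}, {a, b, e}, {c, d, e}}\<rparr>"
    have "three_graph ?C" using dist by (auto simp: three_graph_def card_insert_if)
    moreover have "{a, b, c, d, e} \<subseteq> verts G" using copy_sub[OF cp] S(1) by simp
    ultimately have "subgraph ?C G" using S by (simp add: subgraph_def)
    then show ?thesis using F32_iso[OF dist] S(1) by (intro exI[of _ ?C]) simp
  qed
  then obtain g where g: "\<And>S. copy S \<Longrightarrow> subgraph (g S) G \<and> F32 \<simeq> g S \<and> verts (g S) = S" by metis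
  have hM: "h i \<in> M" if "i < k" for i using h that by (auto simp: bij_betw_def)
  have hne: "h i \<noteq> h j" if "i < k" "j < k" "i \<noteq> j" for i j
    using h that by (auto simp: bij_betw_def inj_on_def)
  show ?thesis unfolding contains_disjoint_copies_def
  proof (intro exI[of _ "\<lambda>i. g (h i)"] conjI allI impI)
    show "subgraph (g (h i)) G" "F32 \<simeq> g (h i)" if "i < k" for i
      using g[OF M(2)[OF hM[OF that]]] by auto
    show "verts (g (h i)) \<inter> verts (g (h j)) = {}" if "i < k" "j < k" "i \<noteq> j" for i j
      using g[OF M(2)[OF hM[OF that(1)]]] g[OF M(2)[OF hM[OF that(2)]]] M(3)[OF hM[OF that(1)] hM[OF that(2)] hne[OF that]]
      by simp
  qed
qed

section \<open>Maximum semibipartite 3-graphs and their joins\<close>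

lemma semibipartite_iff:
  "semibipartite G \<longleftrightarrow> three_graph G \<and> (\<exists>W\<subseteq>verts G. \<forall>e\<in>edges G. card (e \<inter> W) = 1)"
proof
  assume "semibipartite G"
  then show "three_graph G \<and> (\<exists>W\<subseteq>verts G. \<forall>e\<in>edges G. card (e \<inter> W) = 1)"
    unfolding semibipartite_def by blast
next
  assume "three_graph G \<and> (\<exists>W\<subseteq>verts G. \<forall>e\<in>edges G. card (e \<inter> W) = 1)"
  then obtain W where "three_graph G" "W \<subseteq> verts G" "\<forall>e\<in>edges G. card (e \<inter> W) = 1" by blast
  then show "semibipartite G" unfolding semibipartite_def
    by (intro conjI exI[of _ W] exI[of _ "verts G - W"]) auto
qed

lemma semibipartite_card_le:
  assumes "semibipartite G" shows "card (edges G) \<le> max_semibip (card (verts G))"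
proof -
  interpret triple_system "verts G" "edges G" using assms by (simp add: semibipartite_iff three_graph_iff)
  show ?thesis using assms semibip_card_le unfolding semibipartite_iff by blast
qed

lemma S3_iff: "S \<in> S3 m \<longleftrightarrow> semibipartite S \<and> card (verts S) = m \<and> card (edges S) = max_semibip m"
proof
  assume S: "S \<in> S3 m"
  obtain E where E: "f32_free {..<m} E" "card E = max_semibip (card {..<m})" "\<exists>W\<subseteq>{..<m}. \<forall>e\<in>E. card (e \<inter> W) = 1"
    by (rule exists_semibip[of "{..<m} :: nat set"]) auto
  have "semibipartite \<lparr>verts = {..<m}, edges = E\<rparr>"
    using E f32_free.axioms(1)[OF E(1)] by (simp add: semibipartite_iff three_graph_iff)
  then have "max_semibip m \<le> card (edges S)"
    using S E(2) unfolding S3_def by force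
  moreover have "semibipartite S" "card (verts S) = m" using S by (auto simp: S3_def)
  ultimately show "semibipartite S \<and> card (verts S) = m \<and> card (edges S) = max_semibip m"
    using semibipartite_card_le[of S] by simp
next
  assume "semibipartite S \<and> card (verts S) = m \<and> card (edges S) = max_semibip m"
  then show "S \<in> S3 m" by (auto simp: S3_def dest!: semibipartite_card_le)
qed

lemma S3_on:
  fixes U :: "nat set"
  assumes "finite U"
  obtains S where "S \<in> S3 (card U)" "verts S = U"
proof -
  obtain E where E: "f32_free U E" "card E = max_semibip (card U)" "\<exists>W\<subseteq>U. \<forall>e\<in>E. card (e \<inter> W) = 1"
    using exists_semibip[OF assms] by blast
  have "semibipartite \<lparr>verts = U, edges = E\<rparr>"
    using E f32_free.axioms(1)[OF E(1)] by (simp add: semibipartite_iff three_graph_iff)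
  then have "\<lparr>verts = U, edges = E\<rparr> \<in> S3 (card U)" using E(2) by (simp add: S3_iff)
  then show thesis using that by force
qed

lemma join_complete_edges:
  assumes "three_graph S" "A \<inter> verts S = {}"
  shows "edges (complete3 A \<bowtie> S) = {e. e \<subseteq> A \<union> verts S \<and> card e = 3 \<and> e \<inter> A \<noteq> {}} \<union> edges S"
proof -
  have "e \<noteq> {}" if "card e = 3" for e :: "'a set" using that by auto
  then show ?thesis by (auto simp: join_def complete3_def)
qed

text \<open>A copy that misses \<open>A\<close> would lie in \<open>S\<close>, which is free. So
  disjoint copies use different vertices of \<open>A\<close>, and there are at most \<open>t\<close>
  of them.\<close>

lemma join_extremal:
  fixes S :: "nat hgraph"
  assumes A: "finite A" "card A = t" and S: "S \<in> S3 m" and disj: "A \<inter> verts S = {}"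
  shows "complete3 A \<bowtie> S \<in> copies_free (t + m) (t + 1) F32"
    and "card (edges (complete3 A \<bowtie> S)) + (m choose 3) = ((t + m) choose 3) + max_semibip m"
proof -
  let ?G = "complete3 A \<bowtie> S"
  have S': "three_graph S" "card (verts S) = m" "card (edges S) = max_semibip m" "semibipartite S"
    using S by (auto simp: S3_iff semibipartite_iff)
  interpret S: triple_system "verts S" "edges S" using S'(1) by (simp add: three_graph_iff)
  obtain W where W: "\<forall>e\<in>edges S. card (e \<inter> W) = 1" using S'(4) by (auto simp: semibipartite_iff)
  interpret S: f32_free "verts S" "edges S" using W by (intro S.semibip_free) blast
  have vG: "verts ?G = A \<union> verts S" by (simp add: join_def complete3_def)
  have eG: "edges ?G = {e. e \<subseteq> A \<union> verts S \<and> card e = 3 \<and> e \<inter> A \<noteq> {}} \<union> edges S"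
    by (rule join_complete_edges[OF S'(1) disj])
  have cG: "card (verts ?G) = t + m" using vG A S.fin disj S'(2) by (simp add: card_Un_disjoint)
  have tG: "three_graph ?G"
    unfolding three_graph_def vG eG using A S.fin S.uniform by blast
  interpret G: triple_system "verts ?G" "edges ?G" using tG by (simp add: three_graph_iff)
  have meet: "G.meeting A = {e. e \<subseteq> A \<union> verts S \<and> card e = 3 \<and> e \<inter> A \<noteq> {}}"
    unfolding G.meeting_def by (simp only: vG)
  have "G.meeting A \<inter> edges S = {}"
    unfolding meet using S.uniform disj by blast
  then have "card (edges ?G) = card (G.meeting A) + card (edges S)"
    unfolding eG meet[symmetric] using G.finite_meeting S.finite_E by (intro card_Un_disjoint)
  moreover have "card (G.meeting A) + ((t + m - t) choose 3) = (t + m) choose 3"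
    using G.card_meeting[of A] cG A vG by simp
  ultimately show "card (edges ?G) + (m choose 3) = ((t + m) choose 3) + max_semibip m"
    using S'(3) by simp
  have "\<not> contains_disjoint_copies (t + 1) F32 ?G"
  proof
    assume "contains_disjoint_copies (t + 1) F32 ?G"
    then obtain C where C: "\<And>i. i < t + 1 \<Longrightarrow> subgraph (C i) ?G \<and> F32 \<simeq> C i"
      "\<And>i j. i < t + 1 \<Longrightarrow> j < t + 1 \<Longrightarrow> i \<noteq> j \<Longrightarrow> verts (C i) \<inter> verts (C j) = {}"
      unfolding contains_disjoint_copies_def by blast
    have "\<exists>x. x \<in> verts (C i) \<inter> A" if i: "i < t + 1" for i
    proof (rule ccontr)
      assume no: "\<not> ?thesis"
      have "G.copy (verts (C i))" using F32_iso_copy C(1)[OF i] tG by blast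
      then obtain a b c d e where cp: "verts (C i) = {a, b, c, d, e}"
        "{a, b, c} \<in> edges ?G" "{a, b, d} \<in> edges ?G" "{a, b, e} \<in> edges ?G" "{c, d, e} \<in> edges ?G"
        unfolding G.copy_def by blast
      have "a \<notin> A" "b \<notin> A" "c \<notin> A" "d \<notin> A" "e \<notin> A" using no cp(1) by auto
      then have "{a, b, c} \<in> edges S" "{a, b, d} \<in> edges S" "{a, b, e} \<in> edges S" "{c, d, e} \<in> edges S"
        using cp(2-5) unfolding eG by auto
      then show False by (rule S.free)
    qed
    then obtain g where g: "\<And>i. i < t + 1 \<Longrightarrow> g i \<in> verts (C i) \<inter> A" by metis
    have "inj_on g {..<t + 1}"
    proof (rule inj_onI, rule ccontr)
      fix i j assume ij: "i \<in> {..<t + 1}" "j \<in> {..<t + 1}" "g i = g j" "i \<noteq> j"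
      then show False using g[of i] g[of j] C(2)[of i j] by auto
    qed
    moreover have "g ` {..<t + 1} \<subseteq> A" using g by auto
    ultimately have "card {..<t + 1} \<le> card A" using A(1) by (rule card_inj_on_le)
    then show False using A(2) by simp
  qed
  then show "?G \<in> copies_free (t + m) (t + 1) F32" using tG cG by (simp add: copies_free_def)
qed

text \<open>One hypothesis, having at least as many edges as the join, yields both the upper bound
  and the structure.\<close>

lemma copies_free_extremal:
  fixes G :: "nat hgraph"
  assumes G: "G \<in> copies_free n (t + 1) F32" and n: "10^30 \<le> n" and t: "real t \<le> real n / 10^7"
    and dense: "(n choose 3) + max_semibip (n - t) \<le> card (edges G) + ((n - t) choose 3)"
  shows "card (edges G) + ((n - t) choose 3) = (n choose 3) + max_semibip (n - t)"
    and "\<exists>A S. G = complete3 A \<bowtie> S \<and> finite A \<and> card A = t \<and> S \<in> S3 (n - t) \<and> A \<inter> verts S = {}"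
proof -
  have G': "three_graph G" "card (verts G) = n" "\<not> contains_disjoint_copies (t + 1) F32 G"
    using G by (auto simp: copies_free_def)
  interpret G: triple_system "verts G" "edges G" using G'(1) by (simp add: three_graph_iff)
  interpret G: matching_extremal "verts G" "edges G" t
  proof
    show "infinite (UNIV :: nat set)" by simp
    show "10^30 \<le> card (verts G)" "real t \<le> real (card (verts G)) / 10^7" using n t G'(2) by auto
    show "card M \<noteq> t + 1" if "G.matching M" for M
      using matching_contains[OF G'(1) that] G'(3) by blast
    show "(card (verts G) choose 3) + max_semibip (card (verts G) - t) \<le> card (edges G) + ((card (verts G) - t) choose 3)"
      using dense G'(2) by simp
  qed
  note dec = G.extremal_decomposition
  show "card (edges G) + ((n - t) choose 3) = (n choose 3) + max_semibip (n - t)"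
    using dec(3) G.card_meeting[OF G.L_sub] dec(1) G'(2) by simp
  define S where "S = \<lparr>verts = verts G - G.L, edges = G.restr (verts G - G.L)\<rparr>"
  have cV: "card (verts G - G.L) = n - t"
    using card_Diff_subset[OF G.fin_L G.L_sub] dec(1) G'(2) by simp
  have tS: "three_graph S"
    using G.restr_triple_system[of "verts G - G.L"] by (simp add: S_def three_graph_iff)
  then have "semibipartite S" using dec(5) by (simp add: S_def semibipartite_iff)
  then have S3: "S \<in> S3 (n - t)" using cV dec(4) G'(2) by (simp add: S3_iff S_def)
  have disj: "G.L \<inter> verts S = {}" by (auto simp: S_def)
  have un: "G.L \<union> verts S = verts G" using G.L_sub by (auto simp: S_def)
  have "edges (complete3 G.L \<bowtie> S) = G.meeting G.L \<union> G.restr (verts G - G.L)"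
    unfolding join_complete_edges[OF tS disj] un G.meeting_def by (simp add: S_def)
  also have "\<dots> = edges G" using dec(2) by simp
  finally have "edges (complete3 G.L \<bowtie> S) = edges G" .
  moreover have "verts (complete3 G.L \<bowtie> S) = verts G" using un by (simp add: join_def complete3_def)
  ultimately have "G = complete3 G.L \<bowtie> S" by (simp add: hgraph.equality)
  then show "\<exists>A S. G = complete3 A \<bowtie> S \<and> finite A \<and> card A = t \<and> S \<in> S3 (n - t) \<and> A \<inter> verts S = {}"
    using G.fin_L dec(1) S3 disj by blast
qed

theorem theorem2p13:
  "\<exists>(N0 :: nat) (c :: real). c > 0 \<and>
     (\<forall>(n :: nat) (t :: nat). n \<ge> N0 \<longrightarrow> real t \<le> c * real n \<longrightarrow>
        EX_types n (t + 1) F32 =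
          {iso_class (complete3 A \<bowtie> S) | A S.
             finite A \<and> card A = t \<and> S \<in> S3 (n - t) \<and> A \<inter> verts S = {}})"
proof (rule exI[of _ "10^30"], rule exI[of _ "1/10^7"], intro conjI allI impI)
  \<comment> \<open>The factor keeps \<open>6 * (t + 1)\<close> below \<open>n/100000\<close>, and
    \<open>10^30\<close> leaves more than the \<open>10^25\<close> vertices needed by
    \<open>turan_f32\<close> after every deletion.\<close>
  show "(0::real) < 1/10^7" by simp
  fix n t :: nat
  assume n: "10^30 \<le> n" and "real t \<le> 1/10^7 * real n"
  then have t: "real t \<le> real n / 10^7" by simp
  have "real t \<le> real n" using t by simp
  then have tn: "t + (n - t) = n" by simp
  have join: "complete3 A \<bowtie> S \<in> copies_free n (t + 1) F32"
    "card (edges (complete3 A \<bowtie> S)) + ((n - t) choose 3) = (n choose 3) + max_semibip (n - t)"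
    if "finite A" "card A = t" "S \<in> S3 (n - t)" "A \<inter> verts S = {}" for A and S :: "nat hgraph"
    using join_extremal[OF that] by (simp_all only: tn)
  \<comment> \<open>If the bound failed for \<open>H\<close>, the hypothesis of
    \<open>copies_free_extremal\<close> would hold and force equality.\<close>
  have upper: "card (edges H) + ((n - t) choose 3) \<le> (n choose 3) + max_semibip (n - t)"
    if "H \<in> copies_free n (t + 1) F32" for H
    using copies_free_extremal(1)[OF that n t] by linarith
  show "EX_types n (t + 1) F32 = {iso_class (complete3 A \<bowtie> S) | A S.
      finite A \<and> card A = t \<and> S \<in> S3 (n - t) \<and> A \<inter> verts S = {}}"
  proof (intro equalityI subsetI)
    fix X assume "X \<in> EX_types n (t + 1) F32"
    then obtain G where G: "X = iso_class G" "G \<in> copies_free n (t + 1) F32"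
      "\<And>H. H \<in> copies_free n (t + 1) F32 \<Longrightarrow> card (edges H) \<le> card (edges G)"
      unfolding EX_types_def by blast
    \<comment> \<open>One concrete join, on \<open>{..<t}\<close> and \<open>{t..<n}\<close>:
      comparison with it gives the maximum \<open>G\<close> the number of edges from which the
      structure follows.\<close>
    obtain S where S: "S \<in> S3 (card {t..<n})" "verts S = {t..<n}"
      by (rule S3_on[of "{t..<n}"]) auto
    have "{..<t} \<inter> verts S = {}" using S(2) by auto
    then have J: "complete3 {..<t} \<bowtie> S \<in> copies_free n (t + 1) F32"
      "card (edges (complete3 {..<t} \<bowtie> S)) + ((n - t) choose 3) = (n choose 3) + max_semibip (n - t)"
      using join[of "{..<t}" S] S(1) by simp_all
    have "(n choose 3) + max_semibip (n - t) \<le> card (edges G) + ((n - t) choose 3)"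
      using G(3)[OF J(1)] J(2) by linarith
    from copies_free_extremal(2)[OF G(2) n t this] G(1)
    show "X \<in> {iso_class (complete3 A \<bowtie> S) | A S.
        finite A \<and> card A = t \<and> S \<in> S3 (n - t) \<and> A \<inter> verts S = {}}" by blast
  next
    fix X assume "X \<in> {iso_class (complete3 A \<bowtie> S) | A S.
        finite A \<and> card A = t \<and> S \<in> S3 (n - t) \<and> A \<inter> verts S = {}}"
    then obtain A S where X: "X = iso_class (complete3 A \<bowtie> S)"
      and AS: "finite A" "card A = t" "S \<in> S3 (n - t)" "A \<inter> verts S = {}" by blast
    have "card (edges H) \<le> card (edges (complete3 A \<bowtie> S))" if "H \<in> copies_free n (t + 1) F32" for H
      using upper[OF that] join(2)[OF AS] by linarith
    then show "X \<in> EX_types n (t + 1) F32"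
      unfolding EX_types_def using X join(1)[OF AS] by blast
  qed
qed

end
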